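(* Let $\mathcal{H}$ be the Hilbert space of all sequences $a=\{a_n : n\in\mathbb{N}\}$ of complex numbers with $\sum_{n=1}^{\infty}\frac{|a_n|^2}{n(n+1)}<\infty$, with inner product $\langle a,b\rangle=\sum_{n=1}^{\infty}\frac{a_n\overline{b_n}}{n(n+1)}$. For $l=1,2,3,\dots$ let $\gamma_l\in\mathcal{H}$ be the sequence $\gamma_l=\left\{\left\{\frac{n}{l}\right\} : n=1,2,3,\dots\right\}$, where $\{x\}$ denotes the fractional part of a real number $x$, and let $\gamma=\{1,1,1,\dots\}\in\mathcal{H}$ be the constant sequence. Then the following statements are equivalent: (i) the Riemann hypothesis holds (i.e., the Riemann zeta function $\zeta$ has no zeros in the half-plane $\{s\in\mathbb{C}: \operatorname{Re}s>\tfrac12\}$); (ii) $\gamma$ belongs to the closed linear span in $\mathcal{H}$ of $\{\gamma_l : l=1,2,3,\dots\}$; (iii) the set $\{\gamma_l : l=1,2,3,\dots\}$ is total in $\mathcal{H}$ (i.e., its finite linear combinations are dense in $\mathcal{H}$).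
   Context: A set of vectors in a Hilbert space is total if the set of its finite linear combinations is dense. The Riemann hypothesis is used in the form: $1/\zeta$ is analytic on $\{\operatorname{Re}s>1/2\}$, equivalently $\zeta$ has no zeros there. *)

theory Defs
  imports "HOL-Complex_Analysis.Complex_Analysis"
begin

section \<open>The weighted sequence space\<close>

text \<open>
  Sequences are indexed by the positive integers. An element is represented by a function on
  \<^typ>\<open>nat\<close> whose value at \<^term>\<open>0::nat\<close> is a dummy coordinate fixed to be zero; all sums range
  over \<^term>\<open>{1::nat..}\<close>.
\<close>

typedef hseq =
  "{a :: nat \<Rightarrow> complex. a 0 = 0 \<and>
      (\<lambda>n. (cmod (a n))\<^sup>2 / (real n * (real n + 1))) summable_on {1..}}"
  morphisms coord Abs_hseq
  by (rule exI[of _ "\<lambda>_. 0"]) auto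

setup_lifting type_definition_hseq

lemma hseq_eqI:
  assumes "\<And>n. n \<ge> 1 \<Longrightarrow> coord a n = coord b n"
  shows "a = b"
proof -
  have "coord a n = coord b n" for n
    using assms[of n] coord[of a] coord[of b] by (cases "n = 0") auto
  thus ?thesis
    by (simp add: coord_inject[symmetric] fun_eq_iff)
qed

lemma coord_0 [simp]: "coord a 0 = 0"
  using coord[of a] unfolding mem_Collect_eq by (rule conjunct1)

lemma coord_summable: "(\<lambda>n. (cmod (coord a n))\<^sup>2 / (real n * (real n + 1))) summable_on {1..}"
  using coord[of a] unfolding mem_Collect_eq by (rule conjunct2)

lemma summable_add_aux:
  fixes a b :: "nat \<Rightarrow> complex"
  assumes "(\<lambda>n. (cmod (a n))\<^sup>2 / (real n * (real n + 1))) summable_on {1..}"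
    and "(\<lambda>n. (cmod (b n))\<^sup>2 / (real n * (real n + 1))) summable_on {1..}"
  shows "(\<lambda>n. (cmod (a n + b n))\<^sup>2 / (real n * (real n + 1))) summable_on {1..}"
proof -
  have "(\<lambda>n. 2 * ((cmod (a n))\<^sup>2 / (real n * (real n + 1)) + (cmod (b n))\<^sup>2 / (real n * (real n + 1))))
          summable_on {1..}"
    by (intro summable_on_cmult_right summable_on_add assms)
  moreover have "(cmod (a n + b n))\<^sup>2 / (real n * (real n + 1)) \<le>
      2 * ((cmod (a n))\<^sup>2 / (real n * (real n + 1)) + (cmod (b n))\<^sup>2 / (real n * (real n + 1)))" for n
  proof -
    have "(cmod (a n + b n))\<^sup>2 \<le> (cmod (a n) + cmod (b n))\<^sup>2"
      by (intro power_mono norm_triangle_ineq) auto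
    also have "\<dots> \<le> 2 * ((cmod (a n))\<^sup>2 + (cmod (b n))\<^sup>2)"
      using sum_squares_bound[of "cmod (a n)" "cmod (b n)"] by (simp add: power2_sum)
    finally have "(cmod (a n + b n))\<^sup>2 / (real n * (real n + 1)) \<le>
        2 * ((cmod (a n))\<^sup>2 + (cmod (b n))\<^sup>2) / (real n * (real n + 1))"
      by (intro divide_right_mono) auto
    thus ?thesis by (simp add: add_divide_distrib)
  qed
  ultimately show ?thesis
    by (rule summable_on_comparison_test) auto
qed

lemma summable_cmult_aux:
  fixes a :: "nat \<Rightarrow> complex"
  assumes "(\<lambda>n. (cmod (a n))\<^sup>2 / (real n * (real n + 1))) summable_on {1..}"
  shows "(\<lambda>n. (cmod (c * a n))\<^sup>2 / (real n * (real n + 1))) summable_on {1..}"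
  using summable_on_cmult_right[OF assms, of "(cmod c)\<^sup>2"]
  by (simp add: norm_mult power_mult_distrib)

lift_definition cscale :: "complex \<Rightarrow> hseq \<Rightarrow> hseq" is "\<lambda>c a n. c * a n"
  using summable_cmult_aux by auto

instantiation hseq :: ab_group_add
begin

lift_definition zero_hseq :: hseq is "\<lambda>_. 0" by auto
lift_definition plus_hseq :: "hseq \<Rightarrow> hseq \<Rightarrow> hseq" is "\<lambda>a b n. a n + b n"
  using summable_add_aux by auto
lift_definition uminus_hseq :: "hseq \<Rightarrow> hseq" is "\<lambda>a n. - a n" by auto
lift_definition minus_hseq :: "hseq \<Rightarrow> hseq \<Rightarrow> hseq" is "\<lambda>a b n. a n - b n"
  subgoal for a b using summable_add_aux[of a "\<lambda>n. - b n"] by auto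
  done

instance
  by standard (transfer; auto simp: algebra_simps)+

end

lemma coord_zero [simp]: "coord 0 n = 0" by transfer simp
lemma coord_add [simp]: "coord (a + b) n = coord a n + coord b n" by transfer simp
lemma coord_uminus [simp]: "coord (- a) n = - coord a n" by transfer simp
lemma coord_diff [simp]: "coord (a - b) n = coord a n - coord b n" by transfer simp
lemma coord_cscale [simp]: "coord (cscale c a) n = c * coord a n" by transfer simp

global_interpretation hseq: vector_space cscale
  by standard (auto intro!: hseq_eqI simp: algebra_simps)

definition hinner :: "hseq \<Rightarrow> hseq \<Rightarrow> complex" where
  "hinner a b =
     (\<Sum>\<^sub>\<infinity>n\<in>{1..}. coord a n * cnj (coord b n) / (of_nat n * (of_nat n + 1)))"

lemma hinner_summable:
  "(\<lambda>n. coord a n * cnj (coord b n) / (of_nat n * (of_nat n + 1))) summable_on {1..}"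
proof -
  have "(\<lambda>n. (cmod (coord a n))\<^sup>2 / (real n * (real n + 1)) +
             (cmod (coord b n))\<^sup>2 / (real n * (real n + 1))) summable_on {1..}"
    by (intro summable_on_add coord_summable)
  moreover have "norm (coord a n * cnj (coord b n) / (of_nat n * (of_nat n + 1))) \<le>
      (cmod (coord a n))\<^sup>2 / (real n * (real n + 1)) +
      (cmod (coord b n))\<^sup>2 / (real n * (real n + 1))" for n
  proof -
    have n: "norm (of_nat n + 1 :: complex) = real n + 1"
      by (metis norm_of_nat of_nat_Suc add.commute)
    have "0 \<le> (cmod (coord a n) - cmod (coord b n))\<^sup>2 + (cmod (coord a n))\<^sup>2 + (cmod (coord b n))\<^sup>2"
      by simp
    hence "cmod (coord a n) * cmod (coord b n) \<le> (cmod (coord a n))\<^sup>2 + (cmod (coord b n))\<^sup>2"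
      by (simp add: power2_diff)
    hence "cmod (coord a n) * cmod (coord b n) / (real n * (real n + 1)) \<le>
        ((cmod (coord a n))\<^sup>2 + (cmod (coord b n))\<^sup>2) / (real n * (real n + 1))"
      by (intro divide_right_mono) auto
    thus ?thesis by (simp add: norm_mult norm_divide n add_divide_distrib)
  qed
  ultimately have "(\<lambda>n. norm (coord a n * cnj (coord b n) / (of_nat n * (of_nat n + 1))))
      summable_on {1..}"
    by (rule Infinite_Sum.abs_summable_on_comparison_test')
  thus ?thesis by (rule abs_summable_summable)
qed

lemma hinner_cnj: "hinner b a = cnj (hinner a b)"
  unfolding hinner_def by (subst infsum_cnj[symmetric]) (simp add: mult.commute)

lemma hinner_add_left: "hinner (a + b) c = hinner a c + hinner b c"
  unfolding hinner_def
  by (subst infsum_add[OF hinner_summable hinner_summable, symmetric])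
     (simp add: add_divide_distrib distrib_right)

lemma hinner_cscale_left: "hinner (cscale r a) b = r * hinner a b"
  unfolding hinner_def by (subst infsum_cmult_right'[symmetric]) (simp add: mult.assoc)

lemma hinner_self:
  "hinner a a = of_real (\<Sum>\<^sub>\<infinity>n\<in>{1..}. (cmod (coord a n))\<^sup>2 / (real n * (real n + 1)))"
proof -
  have "coord a n * cnj (coord a n) / (of_nat n * (of_nat n + 1)) =
        of_real ((cmod (coord a n))\<^sup>2 / (real n * (real n + 1)))" for n
    by (simp add: complex_norm_square del: of_real_power)
  thus ?thesis
    unfolding hinner_def
    by (simp only: has_sum_of_real[THEN infsumI, OF has_sum_infsum[OF coord_summable]])
qed

text \<open>
  The norm induced by \<^const>\<open>hinner\<close>. The class \<^class>\<open>real_inner\<close> only provides a real-valued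
  inner product, namely the real part of \<^const>\<open>hinner\<close>; it induces the same norm and topology.
\<close>

instantiation hseq :: real_inner
begin

definition scaleR_hseq :: "real \<Rightarrow> hseq \<Rightarrow> hseq" where
  "scaleR_hseq r = cscale (of_real r)"

definition inner_hseq :: "hseq \<Rightarrow> hseq \<Rightarrow> real" where
  "inner_hseq a b = Re (hinner a b)"

definition norm_hseq :: "hseq \<Rightarrow> real" where
  "norm_hseq a = sqrt (Re (hinner a a))"

definition dist_hseq :: "hseq \<Rightarrow> hseq \<Rightarrow> real" where
  "dist_hseq a b = norm (a - b)"

definition sgn_hseq :: "hseq \<Rightarrow> hseq" where
  "sgn_hseq a = cscale (of_real (inverse (norm a))) a"

definition uniformity_hseq :: "(hseq \<times> hseq) filter" where
  "uniformity_hseq = (INF e\<in>{0 <..}. principal {(x, y). dist x y < e})"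

definition open_hseq :: "hseq set \<Rightarrow> bool" where
  "open_hseq U \<longleftrightarrow> (\<forall>x\<in>U. \<forall>\<^sub>F (x', y) in uniformity. x' = x \<longrightarrow> y \<in> U)"

instance
proof
  fix x y z :: hseq and r s :: real
  show "dist x y = norm (x - y)" by (rule dist_hseq_def)
  show "sgn x = inverse (norm x) *\<^sub>R x" by (simp add: sgn_hseq_def scaleR_hseq_def)
  show "(uniformity :: (hseq \<times> hseq) filter) = (INF e\<in>{0 <..}. principal {(x, y). dist x y < e})"
    by (rule uniformity_hseq_def)
  show "open U \<longleftrightarrow> (\<forall>x\<in>U. \<forall>\<^sub>F (x', y) in uniformity. x' = x \<longrightarrow> y \<in> U)" for U :: "hseq set"
    by (rule open_hseq_def)
  show "r *\<^sub>R (x + y) = r *\<^sub>R x + r *\<^sub>R y" "(r + s) *\<^sub>R x = r *\<^sub>R x + s *\<^sub>R x"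
    "r *\<^sub>R s *\<^sub>R x = (r * s) *\<^sub>R x" "1 *\<^sub>R x = x"
    by (simp_all add: scaleR_hseq_def hseq.scale_right_distrib hseq.scale_left_distrib)
  show "inner x y = inner y x"
    unfolding inner_hseq_def using hinner_cnj[of x y] by simp
  show "inner (x + y) z = inner x z + inner y z"
    by (simp add: inner_hseq_def hinner_add_left)
  show "inner (r *\<^sub>R x) y = r * inner x y"
    by (simp add: inner_hseq_def scaleR_hseq_def hinner_cscale_left)
  show "0 \<le> inner x x"
    by (auto simp: inner_hseq_def hinner_self intro!: infsum_nonneg)
  show "inner x x = 0 \<longleftrightarrow> x = 0"
  proof
    assume "inner x x = 0"
    hence 0: "(\<Sum>\<^sub>\<infinity>n\<in>{1..}. (cmod (coord x n))\<^sup>2 / (real n * (real n + 1))) \<le> 0"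
      by (simp add: inner_hseq_def hinner_self)
    show "x = 0"
    proof (rule hseq_eqI)
      fix n :: nat assume "n \<ge> 1"
      hence "(cmod (coord x n))\<^sup>2 / (real n * (real n + 1)) = 0"
        by (intro nonneg_infsum_le_0D[OF 0 coord_summable]) auto
      with \<open>n \<ge> 1\<close> show "coord x n = coord 0 n" by simp
    qed
  qed (simp add: inner_hseq_def hinner_def)
  show "norm x = sqrt (inner x x)"
    by (simp add: norm_hseq_def inner_hseq_def)
qed

end

lemma bounded_in_hseq:
  assumes "\<And>n. n \<ge> 1 \<Longrightarrow> cmod (a n) \<le> 1"
  shows "(\<lambda>n. (cmod (a n))\<^sup>2 / (real n * (real n + 1))) summable_on {1..}"
proof -
  have "summable (\<lambda>n. 1 / real n ^ 2)"
    using inverse_power_summable[of 2, where 'a = real] by (simp add: inverse_eq_divide)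
  hence "(\<lambda>n. 1 / real n ^ 2) summable_on UNIV"
    by (simp add: summable_on_UNIV_nonneg_real_iff)
  hence "(\<lambda>n. 1 / real n ^ 2) summable_on {1..}"
    by (rule summable_on_subset_banach) auto
  moreover have "(cmod (a n))\<^sup>2 / (real n * (real n + 1)) \<le> 1 / real n ^ 2" if "n \<in> {1..}" for n
  proof (rule frac_le)
    show "(cmod (a n))\<^sup>2 \<le> 1" using assms[of n] that by (simp add: power_le_one)
    show "(real n)\<^sup>2 \<le> real n * (real n + 1)" by (simp add: power2_eq_square distrib_left)
  qed (use that in auto)
  ultimately show ?thesis
    by (rule summable_on_comparison_test) auto
qed

lift_definition frac_seq :: "nat \<Rightarrow> hseq" is
  "\<lambda>l n. complex_of_real (frac (real n / real l))"
  by (intro conjI bounded_in_hseq) (simp_all add: less_imp_le[OF frac_lt_1])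

lift_definition one_seq :: hseq is
  "\<lambda>n. if n = 0 then 0 else 1"
  by (intro conjI bounded_in_hseq) simp_all


section \<open>The Riemann zeta function\<close>

definition dirichlet_zeta :: "complex \<Rightarrow> complex" where
  "dirichlet_zeta s = (\<Sum>n. 1 / of_nat (Suc n) powr s)"

text \<open>
  The unique analytic continuation of the Dirichlet series to the plane without the point \<^term>\<open>1::complex\<close>;
  existence and uniqueness are proved below. At the pole \<^term>\<open>1::complex\<close> the value is set to zero
  by convention, so this point has to be excluded when speaking about zeros of \<open>zeta\<close>.
\<close>

definition zeta :: "complex \<Rightarrow> complex" where
  "zeta = (THE f. f holomorphic_on - {1} \<and> (\<forall>s. Re s > 1 \<longrightarrow> f s = dirichlet_zeta s) \<and> f 1 = 0)"

lemma summable_Suc_powr: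
  assumes "a > (1::real)"
  shows "summable (\<lambda>n. real (Suc n) powr (- a))"
  using summable_Suc_iff[of "\<lambda>n. real n powr (-a)"] assms summable_real_powr_iff[of "-a"] by simp

lemma norm_Suc_powr: "norm (of_nat (Suc n) powr (s::complex)) = real (Suc n) powr Re s"
  by (subst norm_powr_real_powr) (auto simp del: of_nat_Suc)

lemma summable_dirichlet:
  assumes "Re s > 1"
  shows "summable (\<lambda>n. of_nat (Suc n) powr (-s))"
  by (rule summable_norm_cancel)
     (use summable_Suc_powr[OF assms] in \<open>simp only: norm_Suc_powr uminus_complex.simps\<close>)

lemma dirichlet_zeta_altdef: "dirichlet_zeta s = (\<Sum>n. of_nat (Suc n) powr (-s))"
  unfolding dirichlet_zeta_def by (simp add: powr_minus field_simps)

lemma holomorphic_suminf: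
  fixes f :: "nat \<Rightarrow> complex \<Rightarrow> complex"
  assumes S: "open S" and hol: "\<And>n. f n holomorphic_on S"
    and M: "\<And>x. x \<in> S \<Longrightarrow> \<exists>d M. 0 < d \<and> cball x d \<subseteq> S \<and> summable M \<and>
              (\<forall>n. \<forall>s\<in>cball x d. norm (f n s) \<le> M n)"
  shows "(\<lambda>s. \<Sum>n. f n s) holomorphic_on S"
proof (rule holomorphic_uniform_sequence[OF S])
  show "(\<lambda>s. \<Sum>i<n. f i s) holomorphic_on S" for n
    by (intro holomorphic_intros hol)
  fix x assume "x \<in> S"
  from M[OF this] obtain d B where d: "0 < d" "cball x d \<subseteq> S" "summable B"
    "\<forall>n. \<forall>s\<in>cball x d. norm (f n s) \<le> B n" by blast
  have "uniform_limit (cball x d) (\<lambda>n s. \<Sum>i<n. f i s) (\<lambda>s. \<Sum>n. f n s) sequentially"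
    using d by (intro Weierstrass_m_test[of _ _ B]) auto
  with d show "\<exists>d>0. cball x d \<subseteq> S \<and>
      uniform_limit (cball x d) (\<lambda>n s. \<Sum>i<n. f i s) (\<lambda>s. \<Sum>n. f n s) sequentially"
    by blast
qed

lemma Re_cball_ge: "s \<in> cball x d \<Longrightarrow> Re s \<ge> Re x - d"
  using abs_Re_le_cmod[of "x - s"] by (auto simp: dist_norm)

lemma holomorphic_dirichlet_zeta: "dirichlet_zeta holomorphic_on {s. Re s > 1}"
proof -
  have "(\<lambda>s. \<Sum>n. of_nat (Suc n) powr (-s)) holomorphic_on {s. Re s > 1}"
  proof (rule holomorphic_suminf)
    show "open {s. Re s > 1}" by (rule open_halfspace_Re_gt)
    show "(\<lambda>s. of_nat (Suc n) powr (-s)) holomorphic_on {s. Re s > 1}" for n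
      by (intro holomorphic_intros)
    fix x :: complex assume "x \<in> {s. Re s > 1}"
    define d where "d = (Re x - 1) / 2"
    have d: "d > 0" "Re x - d = 1 + d"
      using \<open>x \<in> _\<close> by (auto simp: d_def field_simps)
    have "norm (of_nat (Suc n) powr (-s)) \<le> real (Suc n) powr (- (1 + d))"
      if "s \<in> cball x d" for n s
      unfolding norm_Suc_powr using Re_cball_ge[OF that] d by (intro powr_mono) auto
    moreover have "cball x d \<subseteq> {s. Re s > 1}"
      using Re_cball_ge[of _ x d] d by force
    moreover have "summable (\<lambda>n. real (Suc n) powr (- (1 + d)))"
      by (rule summable_Suc_powr) (use d in auto)
    ultimately show "\<exists>d M. 0 < d \<and> cball x d \<subseteq> {s. Re s > 1} \<and> summable M \<and>
              (\<forall>n. \<forall>s\<in>cball x d. norm (of_nat (Suc n) powr (-s)) \<le> M n)"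
      using d(1) by blast
  qed
  thus ?thesis unfolding dirichlet_zeta_altdef[abs_def] .
qed

definition falling :: "nat \<Rightarrow> complex \<Rightarrow> complex" where
  "falling j s = (\<Prod>i<j. 1 - s - of_nat i)"

definition taylor_rem :: "nat \<Rightarrow> nat \<Rightarrow> complex \<Rightarrow> complex" where
  "taylor_rem m n s = of_nat (Suc (Suc n)) powr (1 - s) -
     (\<Sum>j\<le>m. falling j s / fact j * of_nat (Suc n) powr (1 - s - of_nat j))"

lemma holomorphic_falling [holomorphic_intros]: "falling j holomorphic_on A"
  unfolding falling_def[abs_def] by (intro holomorphic_intros)

lemma holomorphic_taylor_rem: "taylor_rem m n holomorphic_on A"
  unfolding taylor_rem_def[abs_def] by (intro holomorphic_intros) (auto simp del: of_nat_Suc)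

lemma taylor_rem_bound:
  assumes "Re s + real m \<ge> 0"
  shows "norm (taylor_rem m n s) \<le> norm (falling (Suc m) s) * real (Suc n) powr (- Re s - real m)"
proof -
  define w z :: complex where "w = of_nat (Suc n)" and "z = of_nat (Suc (Suc n))"
  define S where "S = closed_segment w z"
  define f where "f = (\<lambda>j x. falling j s * x powr (1 - s - of_nat j))"
  have S: "\<exists>t. t \<ge> real (Suc n) \<and> x = of_real t" if "x \<in> S" for x
  proof -
    from that obtain u where u: "0 \<le> u" "x = (1 - u) *\<^sub>R w + u *\<^sub>R z"
      unfolding S_def in_segment by blast
    have "x = of_real (real (Suc n) + u)"
      using u by (simp add: w_def z_def scaleR_conv_of_real algebra_simps)
    with u show ?thesis by (intro exI[of _ "real (Suc n) + u"]) auto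
  qed
  have 1: "(f i has_field_derivative f (Suc i) x) (at x within S)" if x_in: "x \<in> S" for i x
  proof -
    obtain t where t: "t \<ge> real (Suc n)" "x = of_real t" using S[OF x_in] by blast
    have x: "x \<notin> \<real>\<^sub>\<le>\<^sub>0" using t by auto
    have "(f i has_field_derivative falling i s * ((1 - s - of_nat i) * x powr (1 - s - of_nat i - 1)))
        (at x within S)"
      unfolding f_def
      by (intro DERIV_cmult has_field_derivative_at_within[OF has_field_derivative_powr[OF x]])
    also have "falling i s * ((1 - s - of_nat i) * x powr (1 - s - of_nat i - 1)) = f (Suc i) x"
      by (simp add: f_def falling_def algebra_simps)
    finally show ?thesis .
  qed
  have 2: "norm (f (Suc m) x) \<le> norm (falling (Suc m) s) * real (Suc n) powr (- Re s - real m)"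
    if x_in: "x \<in> S" for x
  proof -
    obtain t where t: "t \<ge> real (Suc n)" "x = of_real t" using S[OF x_in] by blast
    have "norm (x powr (1 - s - of_nat (Suc m))) = t powr (- Re s - real m)"
      using t by (subst norm_powr_real_powr) auto
    also have "\<dots> \<le> real (Suc n) powr (- Re s - real m)"
      using assms t by (intro powr_mono2') auto
    finally show ?thesis unfolding f_def norm_mult by (intro mult_left_mono) auto
  qed
  have "norm (f 0 z - (\<Sum>i\<le>m. f i w * (z - w) ^ i / fact i)) \<le>
      norm (falling (Suc m) s) * real (Suc n) powr (- Re s - real m) * cmod (z - w) ^ Suc m / fact m"
    by (rule complex_Taylor[of S]) (use 1 2 in \<open>auto simp: S_def\<close>)
  also have "z - w = 1" by (simp add: z_def w_def)
  also have "f 0 z - (\<Sum>i\<le>m. f i w * 1 ^ i / fact i) = taylor_rem m n s"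
    by (simp add: taylor_rem_def f_def z_def w_def falling_def)
  also have "norm (falling (Suc m) s) * real (Suc n) powr (- Re s - real m) * cmod 1 ^ Suc m / fact m
      \<le> norm (falling (Suc m) s) * real (Suc n) powr (- Re s - real m) / 1"
    unfolding norm_one power_one mult_1_right
    by (intro divide_left_mono mult_nonneg_nonneg) (auto simp: fact_ge_1)
  finally show ?thesis by simp
qed

lemma holomorphic_sum_taylor_rem:
  "(\<lambda>s. \<Sum>n. taylor_rem (Suc k) n s) holomorphic_on {s. Re s > - real k}"
proof (rule holomorphic_suminf)
  show "open {s. Re s > - real k}" by (rule open_halfspace_Re_gt)
  show "taylor_rem (Suc k) n holomorphic_on {s. Re s > - real k}" for n
    by (rule holomorphic_taylor_rem)
  fix x assume x: "x \<in> {s. Re s > - real k}"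
  define d where "d = (Re x + real k) / 2"
  have d: "d > 0" "Re x - d = - real k + d"
    using x by (auto simp: d_def field_simps)
  have "continuous_on (cball x d) (falling (Suc (Suc k)))"
    by (intro holomorphic_on_imp_continuous_on holomorphic_falling)
  hence "bounded (falling (Suc (Suc k)) ` cball x d)"
    by (intro compact_imp_bounded compact_continuous_image) auto
  then obtain C where C: "\<And>s. s \<in> cball x d \<Longrightarrow> norm (falling (Suc (Suc k)) s) \<le> C"
    unfolding bounded_iff by (meson imageI)
  have "norm (taylor_rem (Suc k) n s) \<le> C * real (Suc n) powr (- (1 + d))"
    if "s \<in> cball x d" for n s
  proof -
    have Re: "Re s \<ge> - real k + d" using Re_cball_ge[OF that] d by simp
    have "norm (taylor_rem (Suc k) n s) \<le>
        norm (falling (Suc (Suc k)) s) * real (Suc n) powr (- Re s - real (Suc k))"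
      by (rule taylor_rem_bound) (use Re d in auto)
    also have "\<dots> \<le> C * real (Suc n) powr (- (1 + d))"
      using Re C[OF that] order_trans[OF norm_ge_zero C[OF that]]
      by (intro mult_mono powr_mono) auto
    finally show ?thesis .
  qed
  moreover have "cball x d \<subseteq> {s. Re s > - real k}"
    using Re_cball_ge[of _ x d] d by force
  moreover have "summable (\<lambda>n. C * real (Suc n) powr (- (1 + d)))"
    by (intro summable_mult summable_Suc_powr) (use d in auto)
  ultimately show "\<exists>d M. 0 < d \<and> cball x d \<subseteq> {s. Re s > - real k} \<and> summable M \<and>
      (\<forall>n. \<forall>s\<in>cball x d. norm (taylor_rem (Suc k) n s) \<le> M n)"
    using d(1) by blast
qed

lemma taylor_rem_sums:
  assumes s: "Re s > 1"
  shows "(\<lambda>n. taylor_rem m n s) sums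
           (-1 - (\<Sum>j=1..m. falling j s / fact j * dirichlet_zeta (s + of_nat j - 1)))"
proof -
  have "(\<lambda>n. norm (of_nat (Suc n) powr (1 - s))) \<longlonglongrightarrow> 0"
    unfolding norm_Suc_powr
    by (intro tendsto_neg_powr filterlim_compose[OF filterlim_real_sequentially filterlim_Suc])
       (use s in auto)
  hence "(\<lambda>n. of_nat (Suc n) powr (1 - s)) \<longlonglongrightarrow> 0"
    by (rule tendsto_norm_zero_cancel)
  hence "(\<lambda>n. of_nat (Suc (Suc n)) powr (1 - s) - of_nat (Suc n) powr (1 - s)) sums
      (0 - of_nat (Suc 0) powr (1 - s))"
    by (rule telescope_sums)
  moreover have "(\<lambda>n. \<Sum>j=1..m. falling j s / fact j * of_nat (Suc n) powr (1 - s - of_nat j)) sums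
      (\<Sum>j=1..m. falling j s / fact j * dirichlet_zeta (s + of_nat j - 1))"
  proof (intro sums_sum sums_mult)
    fix j assume j: "j \<in> {1..m}"
    have "(\<lambda>n. of_nat (Suc n) powr (-(s + of_nat j - 1))) sums dirichlet_zeta (s + of_nat j - 1)"
      unfolding dirichlet_zeta_altdef
      by (intro summable_sums summable_dirichlet) (use s j in auto)
    thus "(\<lambda>n. of_nat (Suc n) powr (1 - s - of_nat j)) sums dirichlet_zeta (s + of_nat j - 1)"
      by (simp add: algebra_simps)
  qed
  ultimately have "(\<lambda>n. (of_nat (Suc (Suc n)) powr (1 - s) - of_nat (Suc n) powr (1 - s)) -
      (\<Sum>j=1..m. falling j s / fact j * of_nat (Suc n) powr (1 - s - of_nat j))) sums
      (0 - of_nat (Suc 0) powr (1 - s) - (\<Sum>j=1..m. falling j s / fact j * dirichlet_zeta (s + of_nat j - 1)))"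
    by (rule sums_diff)
  moreover have "{..m} = insert 0 {1..m}" by auto
  hence "taylor_rem m n s = (of_nat (Suc (Suc n)) powr (1 - s) - of_nat (Suc n) powr (1 - s)) -
      (\<Sum>j=1..m. falling j s / fact j * of_nat (Suc n) powr (1 - s - of_nat j))" for n
    by (simp add: taylor_rem_def falling_def del: of_nat_Suc)
  ultimately show ?thesis by simp
qed

text \<open>
  Taylor expansion of \<open>(n + 1) powr (1 - s)\<close> around \<open>n\<close>, summed over \<open>n\<close>, expresses
  \<open>(s - 1) * zeta s\<close> through the values at \<open>s + 1, s + 2, \<dots>\<close> and a convergent remainder.
  This extends the domain of holomorphy by one strip at a time.
\<close>

lemma zeta_continuation_halfplane:
  "\<exists>h. h holomorphic_on {s. Re s > 1 - real k} \<and>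
       (\<forall>s. Re s > 1 \<longrightarrow> h s = (s - 1) * dirichlet_zeta s)"
proof (induction k)
  case 0
  show ?case
    by (intro exI[of _ "\<lambda>s. (s - 1) * dirichlet_zeta s"] conjI holomorphic_intros)
       (use holomorphic_dirichlet_zeta in auto)
next
  case (Suc k)
  then obtain h where h: "h holomorphic_on {s. Re s > 1 - real k}"
    "\<And>s. Re s > 1 \<Longrightarrow> h s = (s - 1) * dirichlet_zeta s" by blast
  define g where "g = (\<lambda>s. 1 + (\<Sum>n. taylor_rem (Suc k) n s) -
      (\<Sum>j=2..Suc k. falling (j - 1) s / fact j * h (s + of_nat j - 1)))"
  have "(\<lambda>s. h (s + of_nat j - 1)) holomorphic_on {s. Re s > - real k}" if "j \<in> {2..Suc k}" for j
    by (rule holomorphic_on_compose_gen[OF _ h(1), unfolded o_def])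
       (use that in \<open>auto intro!: holomorphic_intros\<close>)
  hence "g holomorphic_on {s. Re s > - real k}"
    unfolding g_def by (intro holomorphic_intros holomorphic_sum_taylor_rem) auto
  moreover have "g s = (s - 1) * dirichlet_zeta s" if s: "Re s > 1" for s
  proof -
    have "falling (j - 1) s / fact j * h (s + of_nat j - 1) =
        - (falling j s / fact j * dirichlet_zeta (s + of_nat j - 1))" if "j \<in> {2..Suc k}" for j
    proof -
      from that obtain i where j: "j = Suc i" by (cases j) auto
      have "h (s + of_nat j - 1) = (s + of_nat j - 1 - 1) * dirichlet_zeta (s + of_nat j - 1)"
        by (rule h(2)) (use s that in auto)
      moreover have "falling j s = - (falling (j - 1) s * (s + of_nat j - 1 - 1))"
        by (simp add: falling_def j algebra_simps)
      ultimately show ?thesis by simp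
    qed
    hence "g s = 1 + (\<Sum>n. taylor_rem (Suc k) n s) +
        (\<Sum>j=2..Suc k. falling j s / fact j * dirichlet_zeta (s + of_nat j - 1))"
      unfolding g_def by (subst sum.cong[OF refl]) (auto simp only: sum_negf diff_minus_eq_add)
    also have "(\<Sum>n. taylor_rem (Suc k) n s) =
        -1 - (\<Sum>j=1..Suc k. falling j s / fact j * dirichlet_zeta (s + of_nat j - 1))"
      using taylor_rem_sums[OF s, of "Suc k"] by (simp add: sums_iff)
    also have "(\<Sum>j=1..Suc k. falling j s / fact j * dirichlet_zeta (s + of_nat j - 1)) =
        (1 - s) * dirichlet_zeta s +
        (\<Sum>j=2..Suc k. falling j s / fact j * dirichlet_zeta (s + of_nat j - 1))"
      by (subst sum.atLeast_Suc_atMost) (auto simp: falling_def numeral_2_eq_2)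
    finally show ?thesis by (simp add: algebra_simps)
  qed
  ultimately show ?case by (intro exI[of _ g]) auto
qed

lemma zeta_continuation:
  "\<exists>f. f holomorphic_on - {1} \<and> (\<forall>s. Re s > 1 \<longrightarrow> f s = dirichlet_zeta s) \<and> f 1 = 0"
proof -
  from zeta_continuation_halfplane obtain h where
    h: "\<And>k. h k holomorphic_on {s. Re s > 1 - real k}"
       "\<And>k s. Re s > 1 \<Longrightarrow> h k s = (s - 1) * dirichlet_zeta s"
    by metis
  have eq: "h k s = h l s" if "Re s > 1 - real k" "Re s > 1 - real l" for k l s
  proof (rule analytic_continuation_open[where s = "{s. Re s > 1}" and s' = "{s. Re s > 1 - real (min k l)}"
                 and f = "h k" and g = "h l"])
    show "{s. Re s > 1} \<noteq> {}" by (auto intro: exI[of _ 2])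
    show "connected {s. Re s > 1 - real (min k l)}"
      by (intro convex_connected convex_halfspace_Re_gt)
  qed (use that h in \<open>auto intro: open_halfspace_Re_gt holomorphic_on_subset[OF h(1)]\<close>)
  define H where "H = (\<lambda>s. h (nat \<lceil>2 - Re s\<rceil>) s)"
  have H: "H s = h k s" if "Re s > 1 - real k" for s k
    unfolding H_def by (rule eq) (use that in linarith)+
  have "H analytic_on UNIV"
    unfolding analytic_on_def
  proof
    fix s :: complex
    define k where "k = nat \<lceil>2 - Re s\<rceil>"
    have s: "s \<in> {s. Re s > 1 - real k}" unfolding k_def mem_Collect_eq by linarith
    have "H holomorphic_on {s. Re s > 1 - real k}"
      using h(1)[of k] by (rule holomorphic_transform) (use H in auto)
    thus "\<exists>e>0. H holomorphic_on ball s e"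
      using s open_halfspace_Re_gt[of "1 - real k"] by (meson holomorphic_on_subset openE)
  qed
  hence "H holomorphic_on - {1}" by (meson analytic_imp_holomorphic holomorphic_on_subset subset_UNIV)
  hence "(\<lambda>s. if s = 1 then 0 else H s / (s - 1)) holomorphic_on - {1} \<longleftrightarrow> True"
    by (subst holomorphic_cong[OF refl, where g = "\<lambda>s. H s / (s - 1)"])
       (auto intro!: holomorphic_intros)
  moreover have "H s / (s - 1) = dirichlet_zeta s" if "Re s > 1" for s
    using that H[of 0 s] h(2)[of s 0] by auto
  ultimately show ?thesis
    by (intro exI[of _ "\<lambda>s. if s = 1 then 0 else H s / (s - 1)"]) auto
qed

lemma zeta_props:
  "zeta holomorphic_on - {1} \<and> (\<forall>s. Re s > 1 \<longrightarrow> zeta s = dirichlet_zeta s) \<and> zeta 1 = 0"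
proof -
  have "\<exists>!f. f holomorphic_on - {1} \<and> (\<forall>s. Re s > 1 \<longrightarrow> f s = dirichlet_zeta s) \<and> f 1 = 0"
  proof (rule ex_ex1I[OF zeta_continuation])
    fix f g :: "complex \<Rightarrow> complex"
    assume fg: "f holomorphic_on - {1} \<and> (\<forall>s. Re s > 1 \<longrightarrow> f s = dirichlet_zeta s) \<and> f 1 = 0"
      "g holomorphic_on - {1} \<and> (\<forall>s. Re s > 1 \<longrightarrow> g s = dirichlet_zeta s) \<and> g 1 = 0"
    have "f s = g s" if "s \<noteq> 1" for s
    proof (rule analytic_continuation_open[where s = "{s. Re s > 1}" and s' = "- {1}" and f = f and g = g])
      show "{s. Re s > 1} \<noteq> {}" by (auto intro: exI[of _ 2])
      show "connected (- {1 :: complex})"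
        by (intro connected_punctured_universe) auto
    qed (use that fg in \<open>auto intro: open_halfspace_Re_gt\<close>)
    thus "f = g" using fg by (metis ext)
  qed
  from theI'[OF this] show ?thesis unfolding zeta_def .
qed

lemma holomorphic_zeta: "zeta holomorphic_on - {1}"
  and zeta_eq_dirichlet_zeta: "Re s > 1 \<Longrightarrow> zeta s = dirichlet_zeta s"
  using zeta_props by auto

end

theory Submission
  imports Defs
begin

text \<open>
  On the line \<open>Re s = 1/2\<close>, with the Cauchy distribution as measure, the sequence \<open>\<gamma>\<close> corresponds to
  the constant \<open>1\<close> and \<open>\<gamma>\<^sub>l\<close> to \<open>zeta s * (1 / l - l powr (- s))\<close>. Hence (ii) asks for Dirichlet
  polynomials \<open>P\<close> with \<open>P 1 = 0\<close> such that \<open>zeta * P\<close> is close to \<open>1\<close> in \<open>L\<^sup>2\<close>.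

  Under the Riemann hypothesis consider \<open>K\<^sub>w s = zeta s * (1 / zeta (s + w) - 1 / zeta (1 + w))\<close> for
  \<open>Re w > 0\<close>. For large \<open>Re w\<close> it is a limit of such products, and since it is holomorphic in \<open>w\<close> with
  locally bounded norm, the identity theorem keeps it in their closed span for all \<open>Re w > 0\<close>. As
  \<open>w\<close> tends to \<open>0\<close> from the right, \<open>K\<^sub>w\<close> tends to \<open>1\<close> by dominated convergence. The required growth
  estimates follow from Montel's theorem applied to real powers \<open>zeta powr (1 / ln t)\<close> at height \<open>t\<close>;
  for \<open>zeta s / zeta (s + w)\<close>, the nearby zeros are first divided out.

  Conversely, a zero \<open>s\<close> of \<open>zeta\<close> gives a bounded functional, the Mellin transform at \<open>s\<close>, that
  vanishes on all \<open>\<gamma>\<^sub>l\<close> but not on \<open>\<gamma>\<close>. Finally, (ii) implies (iii) because the dilations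
  \<open>a n \<mapsto> a (n div k)\<close> preserve the closed span and map \<open>\<gamma>\<close> to the indicator of \<open>n \<ge> k\<close>.
\<close>

section \<open>Compactness for bounded holomorphic functions\<close>

text \<open>The dictionary is the Mellin transform: \<open>a\<close> goes to s times the integral of
  a(floor x) x^(-s-1) over x >= 1. The weight 1/(n(n+1)) is the integral of x^(-2) over [n, n+1],
  and |s|^2 = t^2 + 1/4 on the line, so Plancherel singles out the density of \<open>cauchy\<close>.

  Truncating the Dirichlet series of 1/zeta gives no direct approximation on the critical line. The
  shift by w moves the approximation to where that series converges absolutely; moving w back takes
  only analyticity and local bounds, no rate of convergence. Subtracting 1/zeta(1 + w) enforces P 1
  = 0 and costs nothing in the limit, because 1/zeta vanishes at 1.

  In the last limit the zeros of zeta on the line itself endanger domination: 1/zeta(s + w) blows up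
  near them as w tends to 0. Hence zeta(s)/zeta(s + w) is estimated as a whole, uniformly in w. The
  density decays like t^(-2), so growth exponents below 1/2 are square integrable, and subpolynomial
  bounds leave ample room.\<close>

lemma uniform_limit_sequentially_diagonal:
  fixes f :: "nat \<Rightarrow> 'a::metric_space \<Rightarrow> 'b::metric_space"
  assumes u: "uniform_limit K f g sequentially" and g: "continuous_on K g"
    and x: "\<And>n. x n \<in> K" "x \<longlonglongrightarrow> l" "l \<in> K"
  shows "(\<lambda>n. f n (x n)) \<longlonglongrightarrow> g l"
proof (rule metric_LIMSEQ_I)
  fix e :: real assume "e > 0"
  have "(\<lambda>n. g (x n)) \<longlonglongrightarrow> g l"
    by (rule continuous_on_tendsto_compose[OF g x(2)]) (use x in auto)
  then have "\<forall>\<^sub>F n in sequentially. dist (g (x n)) (g l) < e/2"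
    by (rule tendstoD) (use \<open>e > 0\<close> in simp)
  moreover have "\<forall>\<^sub>F n in sequentially. \<forall>y\<in>K. dist (f n y) (g y) < e/2"
    using uniform_limitD[OF u, of "e/2"] \<open>e > 0\<close> by simp
  ultimately have "\<forall>\<^sub>F n in sequentially. dist (f n (x n)) (g l) < e"
  proof eventually_elim
    case (elim n)
    then show ?case
      using x(1)[of n] dist_triangle[of "f n (x n)" "g l" "g (x n)"] by fastforce
  qed
  then show "\<exists>N. \<forall>n\<ge>N. dist (f n (x n)) (g l) < e"
    by (simp add: eventually_sequentially)
qed

lemma Montel_bounded:
  fixes u :: "nat \<Rightarrow> complex \<Rightarrow> complex"
  assumes "open S" and u: "\<And>n. u n holomorphic_on S" "\<And>n z. z \<in> S \<Longrightarrow> cmod (u n z) \<le> A"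
  obtains g r where "g holomorphic_on S" "strict_mono (r :: nat \<Rightarrow> nat)"
    "\<And>x. x \<in> S \<Longrightarrow> (\<lambda>n. u (r n) x) \<longlonglongrightarrow> g x"
    "\<And>K. \<lbrakk>compact K; K \<subseteq> S\<rbrakk> \<Longrightarrow> uniform_limit K (u \<circ> r) g sequentially"
proof (rule Montel[OF \<open>open S\<close>, of "range u" u])
  show "\<And>h. h \<in> range u \<Longrightarrow> h holomorphic_on S" using u(1) by auto
  show "\<exists>B. \<forall>h\<in>range u. \<forall>z\<in>K. cmod (h z) \<le> B" if "compact K" "K \<subseteq> S" for K
    using that u(2) by (intro exI[of _ A]) auto
qed (use that in auto)

text \<open>A uniform modulus of continuity for log |u| over a normal family. Counterexamples at
  ever smaller distances have a locally uniform limit g; the lower bound c at the centre keeps g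
  from vanishing identically, so by Hurwitz it has no zeros, and at the common limit l of the two
  points the assumed inequality becomes (1 + e) |g l| <= |g l|.\<close>

lemma zero_free_ratio_bound:
  assumes "0 < r" "compact K" "K \<subseteq> ball z0 r" "0 < c" "0 < e"
  obtains d where "d > 0"
    "\<And>u x y. \<lbrakk>u holomorphic_on ball z0 r; \<And>z. z \<in> ball z0 r \<Longrightarrow> u z \<noteq> 0 \<and> cmod (u z) \<le> A;
       c \<le> cmod (u z0); x \<in> K; y \<in> K; dist x y < d\<rbrakk> \<Longrightarrow> cmod (u x) \<le> (1 + e) * cmod (u y)"
proof (rule ccontr)
  assume no: "\<not> thesis"
  define P where "P = (\<lambda>n u x y. u holomorphic_on ball z0 r \<and>
      (\<forall>z\<in>ball z0 r. u z \<noteq> 0 \<and> cmod (u z) \<le> A) \<and> c \<le> cmod (u z0) \<and> x \<in> K \<and> y \<in> K \<and>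
      dist x y < inverse (real (Suc n)) \<and> cmod (u x) > (1 + e) * cmod (u y))"
  have "\<exists>u x y. P n u x y" for n
  proof (rule ccontr)
    assume *: "\<nexists>u x y. P n u x y"
    have thesis
    proof (rule that[of "inverse (real (Suc n))"])
      fix u x y
      assume "u holomorphic_on ball z0 r" "\<And>z. z \<in> ball z0 r \<Longrightarrow> u z \<noteq> 0 \<and> cmod (u z) \<le> A"
          "c \<le> cmod (u z0)" "x \<in> K" "y \<in> K" "dist x y < inverse (real (Suc n))"
      moreover have "\<not> P n u x y" using * by simp
      ultimately show "cmod (u x) \<le> (1 + e) * cmod (u y)"
        unfolding P_def by auto
    qed simp
    with no show False ..
  qed
  then obtain u x y where "\<And>n. P n (u n) (x n) (y n)" by metis
  then have
    u: "\<And>n. u n holomorphic_on ball z0 r" "\<And>n z. z \<in> ball z0 r \<Longrightarrow> u n z \<noteq> 0 \<and> cmod (u n z) \<le> A"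
       "\<And>n. c \<le> cmod (u n z0)" and
    xy: "\<And>n. x n \<in> K" "\<And>n. y n \<in> K" "\<And>n. dist (x n) (y n) < inverse (real (Suc n))"
       "\<And>n. cmod (u n (x n)) > (1 + e) * cmod (u n (y n))"
    unfolding P_def by blast+
  obtain g k where g: "g holomorphic_on ball z0 r" and k: "strict_mono (k :: nat \<Rightarrow> nat)"
    and lim: "\<And>x. x \<in> ball z0 r \<Longrightarrow> (\<lambda>n. u (k n) x) \<longlonglongrightarrow> g x"
    and ul: "\<And>K. \<lbrakk>compact K; K \<subseteq> ball z0 r\<rbrakk> \<Longrightarrow> uniform_limit K (u \<circ> k) g sequentially"
    using Montel_bounded[of "ball z0 r" u A] u by auto
  have "c \<le> cmod (g z0)"
    using u(3) lim[of z0] \<open>0 < r\<close> by (intro tendsto_lowerbound[OF tendsto_norm]) auto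
  then have gz0: "g z0 \<noteq> 0" using \<open>0 < c\<close> by auto
  \<comment> \<open>Hurwitz requires a nonconstant limit; a constant one equals g z0, which is
    nonzero.\<close>
  have gnz: "g w \<noteq> 0" if w: "w \<in> ball z0 r" for w
  proof (cases "g constant_on ball z0 r")
    case True
    then show ?thesis
      using gz0 w \<open>0 < r\<close> unfolding constant_on_def by (metis centre_in_ball)
  next
    case False
    show ?thesis
      by (rule Hurwitz_no_zeros[of "ball z0 r" "u \<circ> k" g]) (use g ul u w False in auto)
  qed
  have xk: "\<And>n. (x \<circ> k) n \<in> K" using xy by auto
  obtain l q where l: "l \<in> K" "strict_mono (q :: nat \<Rightarrow> nat)" "(x \<circ> k \<circ> q) \<longlonglongrightarrow> l"
    using \<open>compact K\<close> xk unfolding compact_def by metis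
  have ul': "uniform_limit K (\<lambda>n. u (k (q n))) g sequentially"
    using filterlim_compose[OF ul[OF assms(2,3), unfolded comp_def] filterlim_subseq[OF l(2)]] .
  have gc: "continuous_on K g"
    using g assms(3) by (meson holomorphic_on_imp_continuous_on continuous_on_subset)
  have mono: "strict_mono (\<lambda>n. k (q n))" using k l(2) by (simp add: strict_mono_def)
  have "(\<lambda>n. inverse (real (Suc (k (q n))))) \<longlonglongrightarrow> 0"
    by (rule LIMSEQ_subseq_LIMSEQ[OF LIMSEQ_inverse_real_of_nat mono, unfolded comp_def])
  then have "(\<lambda>n. dist (x (k (q n))) (y (k (q n)))) \<longlonglongrightarrow> 0"
    by (rule Lim_null_comparison[rotated]) (use xy(3) in \<open>auto intro!: always_eventually less_imp_le\<close>)
  then have "(\<lambda>n. x (k (q n)) - y (k (q n))) \<longlonglongrightarrow> 0"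
    by (simp add: dist_norm tendsto_norm_zero_iff)
  from tendsto_diff[OF l(3) this] have yl: "(\<lambda>n. y (k (q n))) \<longlonglongrightarrow> l"
    by (simp add: comp_def)
  have 1: "(\<lambda>n. u (k (q n)) (x (k (q n)))) \<longlonglongrightarrow> g l"
    by (rule uniform_limit_sequentially_diagonal[OF ul' gc]) (use xy l in \<open>auto simp: comp_def\<close>)
  have 2: "(\<lambda>n. u (k (q n)) (y (k (q n)))) \<longlonglongrightarrow> g l"
    by (rule uniform_limit_sequentially_diagonal[OF ul' gc]) (use xy l yl in auto)
  have "(1 + e) * cmod (g l) \<le> cmod (g l)"
    by (rule tendsto_le[OF _ tendsto_norm[OF 1] tendsto_mult_left[OF tendsto_norm[OF 2]]])
       (use xy(4) in \<open>auto intro!: always_eventually less_imp_le\<close>)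
  moreover have "cmod (g l) > 0" using gnz l assms(3) by auto
  ultimately show False using \<open>0 < e\<close> by (simp add: algebra_simps mult_le_0_iff)
qed

text \<open>A qualitative two-constants theorem. A limit of counterexamples has modulus exactly 1 on
  the small ball, hence a local maximum of the modulus, so it is constant on the connected set S and
  has modulus 1 on K too. It transports information about zeta from the region of absolute
  convergence towards the critical line.\<close>

lemma near_unimodular_propagation:
  assumes "compact K" "K \<subseteq> S" "open S" "connected S" "0 < r" "ball z1 r \<subseteq> S" "0 < e"
  obtains d where "d > 0"
    "\<And>u x. \<lbrakk>u holomorphic_on S; \<And>z. z \<in> S \<Longrightarrow> cmod (u z) \<le> A;
       \<And>z. z \<in> ball z1 r \<Longrightarrow> \<bar>cmod (u z) - 1\<bar> \<le> d; x \<in> K\<rbrakk> \<Longrightarrow> \<bar>cmod (u x) - 1\<bar> \<le> e"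
proof (rule ccontr)
  assume no: "\<not> thesis"
  define P where "P = (\<lambda>n u x. u holomorphic_on S \<and> (\<forall>z\<in>S. cmod (u z) \<le> A) \<and>
      (\<forall>z\<in>ball z1 r. \<bar>cmod (u z) - 1\<bar> \<le> inverse (real (Suc n))) \<and> x \<in> K \<and>
      \<bar>cmod (u x) - 1\<bar> > e)"
  have "\<exists>u x. P n u x" for n
  proof (rule ccontr)
    assume *: "\<nexists>u x. P n u x"
    have thesis
    proof (rule that[of "inverse (real (Suc n))"])
      fix u x
      assume "u holomorphic_on S" "\<And>z. z \<in> S \<Longrightarrow> cmod (u z) \<le> A"
          "\<And>z. z \<in> ball z1 r \<Longrightarrow> \<bar>cmod (u z) - 1\<bar> \<le> inverse (real (Suc n))" "x \<in> K"
      moreover have "\<not> P n u x" using * by simp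
      ultimately show "\<bar>cmod (u x) - 1\<bar> \<le> e"
        unfolding P_def by auto
    qed simp
    with no show False ..
  qed
  then obtain u x where "\<And>n. P n (u n) (x n)" by metis
  then have
    u: "\<And>n. u n holomorphic_on S" "\<And>n z. z \<in> S \<Longrightarrow> cmod (u n z) \<le> A"
       "\<And>n z. z \<in> ball z1 r \<Longrightarrow> \<bar>cmod (u n z) - 1\<bar> \<le> inverse (real (Suc n))" and
    x: "\<And>n. x n \<in> K" "\<And>n. \<bar>cmod (u n (x n)) - 1\<bar> > e"
    unfolding P_def by blast+
  obtain g k where g: "g holomorphic_on S" and k: "strict_mono (k :: nat \<Rightarrow> nat)"
    and lim: "\<And>x. x \<in> S \<Longrightarrow> (\<lambda>n. u (k n) x) \<longlonglongrightarrow> g x"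
    and ul: "\<And>K. \<lbrakk>compact K; K \<subseteq> S\<rbrakk> \<Longrightarrow> uniform_limit K (u \<circ> k) g sequentially"
    using Montel_bounded[of S u A] u assms by auto
  have inv0: "(\<lambda>n. inverse (real (Suc (k n)))) \<longlonglongrightarrow> 0"
    by (rule LIMSEQ_subseq_LIMSEQ[OF LIMSEQ_inverse_real_of_nat k, unfolded comp_def])
  have g1: "cmod (g z) = 1" if z: "z \<in> ball z1 r" for z
  proof -
    have "(\<lambda>n. cmod (u (k n) z) - 1) \<longlonglongrightarrow> cmod (g z) - 1"
      using lim z assms by (intro tendsto_intros) auto
    moreover have "(\<lambda>n. cmod (u (k n) z) - 1) \<longlonglongrightarrow> 0"
      by (rule Lim_null_comparison[OF _ inv0]) (use u(3) z in auto)
    ultimately show ?thesis using LIMSEQ_unique by fastforce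
  qed
  have "g constant_on S"
    by (rule maximum_modulus_principle[of g S "ball z1 r" z1]) (use g assms g1 in auto)
  then have g1S: "cmod (g z) = 1" if "z \<in> S" for z
    using g1[of z1] that assms unfolding constant_on_def by (metis centre_in_ball subsetD)
  have "\<forall>\<^sub>F n in sequentially. \<forall>y\<in>K. dist ((u \<circ> k) n y) (g y) < e"
    using uniform_limitD[OF ul[OF assms(1,2)] assms(7)] .
  then obtain n where n: "dist (u (k n) (x (k n))) (g (x (k n))) < e"
    using x(1) by (auto simp: eventually_sequentially)
  have "\<bar>cmod (u (k n) (x (k n))) - cmod (g (x (k n)))\<bar> \<le> dist (u (k n) (x (k n))) (g (x (k n)))"
    by (simp add: dist_norm norm_triangle_ineq3)
  with n g1S[of "x (k n)"] x[of "k n"] assms(2) show False by auto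
qed

text \<open>Any branch of the logarithm on the ball serves, since only the modulus of the power is
  prescribed.\<close>

lemma holomorphic_real_power:
  assumes f: "f holomorphic_on ball z0 r" "\<And>z. z \<in> ball z0 r \<Longrightarrow> f z \<noteq> 0"
  obtains u where "u holomorphic_on ball z0 r"
    "\<And>z. z \<in> ball z0 r \<Longrightarrow> u z \<noteq> 0 \<and> cmod (u z) = cmod (f z) powr c"
proof -
  obtain g where g: "g holomorphic_on ball z0 r" "\<And>z. z \<in> ball z0 r \<Longrightarrow> f z = exp (g z)"
    using contractible_imp_holomorphic_log[OF f(1)] f(2) convex_imp_contractible convex_ball by metis
  show ?thesis
  proof (rule that)
    show "(\<lambda>z. exp (of_real c * g z)) holomorphic_on ball z0 r"
      by (intro holomorphic_intros g)
    show "exp (of_real c * g z) \<noteq> 0 \<and> cmod (exp (of_real c * g z)) = cmod (f z) powr c"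
      if "z \<in> ball z0 r" for z
      using g(2)[OF that] by (simp add: powr_def)
  qed
qed

section \<open>Dividing out zeros\<close>

text \<open>The zeros form a list so that multiplicities are recorded. The induction is on the
  number of distinct zeros in K, each step removing one point with its full order.\<close>

lemma holomorphic_divide_out_zeros:
  assumes "f holomorphic_on S" "open S" "connected S" "compact K" "K \<subseteq> S" "\<exists>z\<in>S. f z \<noteq> 0"
  obtains g zs where "set zs \<subseteq> {z \<in> K. f z = 0}" "g holomorphic_on S"
    "\<And>z. z \<in> S \<Longrightarrow> f z = (\<Prod>\<rho>\<leftarrow>zs. z - \<rho>) * g z" "\<And>z. z \<in> K \<Longrightarrow> g z \<noteq> 0"
proof -
  have "\<exists>g zs. set zs \<subseteq> {z \<in> K. f z = 0} \<and> g holomorphic_on S \<and>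
    (\<forall>z\<in>S. f z = (\<Prod>\<rho>\<leftarrow>zs. z - \<rho>) * g z) \<and> (\<forall>z\<in>K. g z \<noteq> 0)"
    using assms(1,6)
  proof (induction "card {z\<in>K. f z = 0}" arbitrary: f rule: less_induct)
    case less
    show ?case
    proof (cases "{z\<in>K. f z = 0} = {}")
      case True
      then show ?thesis using less.prems by (intro exI[of _ f] exI[of _ "[]"]) auto
    next
      case False
      then obtain \<xi> where \<xi>: "\<xi> \<in> K" "f \<xi> = 0" by auto
      have nc: "\<not> f constant_on S"
        using \<xi> less.prems(2) assms(5) unfolding constant_on_def by (metis subsetD)
      have fin: "finite {z\<in>K. f z = 0}"
        using holomorphic_compact_finite_zeros[OF less.prems(1) assms(2-5) nc] .
      obtain h r n where h: "0 < n" "0 < r" "ball \<xi> r \<subseteq> S" "h holomorphic_on ball \<xi> r"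
        "\<And>w. w \<in> ball \<xi> r \<Longrightarrow> f w = (w - \<xi>)^n * h w" "\<And>w. w \<in> ball \<xi> r \<Longrightarrow> h w \<noteq> 0"
        by (rule holomorphic_factor_zero_nonconstant[OF less.prems(1) assms(2,3) _ \<xi>(2) nc])
           (use \<xi> assms(5) in auto)
      \<comment> \<open>The local factor h fills the removable singularity at \<xi> with a nonzero
        value, so no other zero is created or lost.\<close>
      define g where "g = (\<lambda>z. if z = \<xi> then h \<xi> else f z / (z - \<xi>)^n)"
      have "g holomorphic_on ball \<xi> r"
        by (rule holomorphic_transform[OF h(4)]) (use h(5) in \<open>auto simp: g_def\<close>)
      moreover have "g holomorphic_on S - {\<xi>}"
      proof (rule holomorphic_transform)
        show "(\<lambda>z. f z / (z - \<xi>)^n) holomorphic_on S - {\<xi>}"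
          by (intro holomorphic_intros holomorphic_on_subset[OF less.prems(1)]) auto
      qed (auto simp: g_def)
      ultimately have "g holomorphic_on (ball \<xi> r \<union> (S - {\<xi>}))"
        by (intro holomorphic_on_Un) (auto simp: assms(2) open_delete)
      moreover have "S \<subseteq> ball \<xi> r \<union> (S - {\<xi>})" using h(2) by auto
      ultimately have g: "g holomorphic_on S" by (rule holomorphic_on_subset)
      have fg: "f z = (z - \<xi>)^n * g z" for z
        using \<xi> h(1) by (auto simp: g_def)
      have "g \<xi> \<noteq> 0" using h(2,6) by (simp add: g_def)
      then have gz: "{z\<in>K. g z = 0} = {z\<in>K. f z = 0} - {\<xi>}"
        by (auto simp: g_def)
      have "card {z\<in>K. g z = 0} < card {z\<in>K. f z = 0}"
        unfolding gz using \<xi> fin by (intro card_Diff1_less) auto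
      moreover have "\<exists>z\<in>S. g z \<noteq> 0" using less.prems(2) fg by (metis mult_zero_right)
      ultimately obtain G zs where G: "set zs \<subseteq> {z \<in> K. g z = 0}" "G holomorphic_on S"
        "\<And>z. z \<in> S \<Longrightarrow> g z = (\<Prod>\<rho>\<leftarrow>zs. z - \<rho>) * G z" "\<And>z. z \<in> K \<Longrightarrow> G z \<noteq> 0"
        using less.hyps[of g] g by metis
      have "\<forall>z\<in>S. f z = (\<Prod>\<rho>\<leftarrow>replicate n \<xi> @ zs. z - \<rho>) * G z"
        using fg G(3) by (simp add: map_replicate_const)
      moreover have "set (replicate n \<xi> @ zs) \<subseteq> {z \<in> K. f z = 0}"
        using G(1) gz \<xi> by auto
      ultimately show ?thesis using G(2,4) by blast
    qed
  qed
  then show ?thesis using that by blast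
qed

lemma prod_list_norm_mono:
  fixes x y :: complex
  assumes "\<And>\<rho>. \<rho> \<in> set zs \<Longrightarrow> cmod (x - \<rho>) \<le> cmod (y - \<rho>)"
  shows "cmod (\<Prod>\<rho>\<leftarrow>zs. x - \<rho>) \<le> cmod (\<Prod>\<rho>\<leftarrow>zs. y - \<rho>)"
  using assms by (induction zs) (auto simp: norm_mult intro!: mult_mono)

lemma norm_diff_le_shift_right:
  assumes "Re \<rho> \<le> Re s" "0 \<le> d"
  shows "cmod (s - \<rho>) \<le> cmod (s + of_real d - \<rho>)"
  using assms by (auto simp: cmod_def intro!: real_sqrt_le_mono power_mono)

section \<open>The Cauchy distribution\<close>

text \<open>The factor t^2 + 1/4 is the squared modulus of s = 1/2 + it, and 1/(2 pi) normalises the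
  total mass to 1.\<close>

definition cauchy :: "real measure" where
  "cauchy = density lborel (\<lambda>t. ennreal (1 / (2 * pi * (t\<^sup>2 + 1/4))))"

lemma space_cauchy [simp]: "space cauchy = UNIV" by (simp add: cauchy_def)

lemma sets_cauchy [simp, measurable_cong]: "sets cauchy = sets borel" by (simp add: cauchy_def)

lemma quarter_pos: "0 < t\<^sup>2 + 1/4" for t :: real
  by (smt (verit) zero_le_power2 divide_pos_pos)

lemma integrable_cauchy_iff:
  fixes f :: "real \<Rightarrow> 'b::{banach,second_countable_topology}"
  assumes "f \<in> borel_measurable borel"
  shows "integrable cauchy f \<longleftrightarrow> integrable lborel (\<lambda>t. (1 / (2 * pi * (t\<^sup>2 + 1/4))) *\<^sub>R f t)"
  unfolding cauchy_def by (rule integrable_density) (use assms quarter_pos in \<open>auto simp: less_imp_le\<close>)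

lemma integral_cauchy:
  fixes f :: "real \<Rightarrow> 'b::{banach,second_countable_topology}"
  assumes "f \<in> borel_measurable borel"
  shows "integral\<^sup>L cauchy f = (LINT t|lborel. (1 / (2 * pi * (t\<^sup>2 + 1/4))) *\<^sub>R f t)"
  unfolding cauchy_def by (rule integral_density) (use assms quarter_pos in \<open>auto simp: less_imp_le\<close>)

lemma cauchy_density_integral:
  shows "integrable lborel (\<lambda>t::real. 1 / (t\<^sup>2 + 1/4))"
    and "(LINT t|lborel. 1 / (t\<^sup>2 + 1/4)) = 2 * pi"
proof -
  define F where "F = (\<lambda>t::real. 2 * arctan (2 * t))"
  have D: "(F has_real_derivative 1 / (t\<^sup>2 + 1/4)) (at t)" for t
  proof -
    have "(F has_real_derivative 2 * (inverse (1 + (2 * t)\<^sup>2) * 2)) (at t)"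
      unfolding F_def by (rule derivative_eq_intros refl | simp)+
    also have "2 * (inverse (1 + (2 * t)\<^sup>2) * 2) = 1 / (t\<^sup>2 + 1/4)"
      using quarter_pos[of t] by (simp add: field_simps power2_eq_square)
    finally show ?thesis .
  qed
  have C: "isCont (\<lambda>t::real. 1 / (t\<^sup>2 + 1/4)) t" for t
    using quarter_pos[of t] by (intro continuous_intros) auto
  have top: "(F \<longlongrightarrow> pi) at_top"
  proof -
    have "((\<lambda>t. 2 * arctan (2 * t)) \<longlongrightarrow> 2 * (pi/2)) at_top"
      by (intro tendsto_mult tendsto_const filterlim_compose[OF tendsto_arctan_at_top])
         (auto intro!: filterlim_tendsto_pos_mult_at_top[OF tendsto_const _ filterlim_ident])
    then show ?thesis by (simp add: F_def)
  qed
  have "F (- t) = - F t" for t by (simp add: F_def arctan_minus)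
  then have bot: "(F \<longlongrightarrow> - pi) at_bot"
    using tendsto_minus[OF top] by (simp add: filterlim_at_bot_mirror)
  have 0: "AE t in lborel. -\<infinity> < ereal t \<longrightarrow> ereal t < \<infinity> \<longrightarrow> 0 \<le> 1 / (t\<^sup>2 + 1/4)"
    using quarter_pos by (auto simp: less_imp_le)
  have bot': "((F \<circ> real_of_ereal) \<longlongrightarrow> - pi) (at_right (-\<infinity>))"
    using bot by (simp add: ereal_tendsto_simps)
  have top': "((F \<circ> real_of_ereal) \<longlongrightarrow> pi) (at_left \<infinity>)"
    using top by (simp add: ereal_tendsto_simps)
  have "set_integrable lborel (einterval (-\<infinity>) \<infinity>) (\<lambda>t::real. 1 / (t\<^sup>2 + 1/4))"
    by (rule interval_integral_FTC_nonneg(1)[OF _ D C 0 bot' top']) simp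
  then show "integrable lborel (\<lambda>t::real. 1 / (t\<^sup>2 + 1/4))"
    by (simp add: set_integrable_def einterval_def)
  have "(LBINT t=-\<infinity>..\<infinity>. 1 / (t\<^sup>2 + 1/4)) = pi - (- pi)"
    by (rule interval_integral_FTC_nonneg(2)[OF _ D C 0 bot' top']) simp
  then show "(LINT t|lborel. 1 / (t\<^sup>2 + 1/4)) = 2 * pi"
    by (simp add: interval_lebesgue_integral_def set_lebesgue_integral_def einterval_def)
qed

text \<open>Subtracting \<open>exp (- a / 2)\<close> from the numerator cancels the pole in the upper half-plane, so that
  Cauchy's theorem on a half-disc applies without computing a winding number.\<close>

lemma cauchy_segment_bound:
  fixes a R :: real
  assumes "a \<ge> 0" "R > 1"
  shows "cmod (integral {-R..R} (\<lambda>t. (exp (\<i> * of_real (a * t)) - of_real (exp (- a / 2))) / of_real (t\<^sup>2 + 1/4)))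
          \<le> 2 / (R\<^sup>2 - 1/4) * R * pi"
proof -
  define S where "S = {z. Im z > - 1/2}"
  define h where "h = (\<lambda>z. (exp (\<i> * of_real a * z) - of_real (exp (- a / 2))) / (z + \<i> / 2))"
  \<comment> \<open>The zero of \<open>h\<close> at i/2 cancels one factor of z^2 + 1/4 = (z -
    i/2)(z + i/2), so \<open>f\<close> extends the integrand holomorphically to
    \<open>S\<close>.\<close>
  define f where "f = (\<lambda>z. if z = \<i> / 2 then deriv h (\<i> / 2) else h z / (z - \<i> / 2))"
  have nz: "z + \<i> / 2 \<noteq> 0" if "z \<in> S" for z
    using that by (auto simp: S_def complex_eq_iff)
  have hh: "h holomorphic_on S"
    unfolding h_def by (intro holomorphic_intros) (use nz in auto)
  have h0: "h (\<i> / 2) = 0"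
    by (simp add: h_def exp_of_real[symmetric] mult.commute)
  have oS: "open S" unfolding S_def by (rule open_halfspace_Im_gt)
  have hf: "h z = (z - \<i> / 2) * f z" if "z \<in> S - {\<i> / 2}" for z
    using that unfolding f_def by simp
  have "f (\<i> / 2) = deriv h (\<i> / 2)" unfolding f_def by simp
  then have f: "f holomorphic_on S"
    using hf by (intro pole_theorem_open_0[OF hh oS _ _ h0]) blast+
  define g where "g = part_circlepath 0 R 0 pi +++ linepath (- of_real R) (of_real R)"
  have half: "Im z \<ge> 0" if z: "z \<in> path_image (part_circlepath 0 R 0 pi)" for z
  proof -
    obtain x where "0 \<le> x" "x \<le> pi" "z = of_real R * exp (\<i> * of_real x)"
      using z path_image_part_circlepath[of 0 pi 0 R] by auto
    then show ?thesis using \<open>R > 1\<close> by (simp add: Im_exp sin_ge_zero)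
  qed
  have eqf: "f z = (exp (\<i> * of_real a * z) - of_real (exp (- a / 2))) / (z\<^sup>2 + 1/4)" if "z \<noteq> \<i> / 2" for z
    using that by (simp add: f_def h_def field_simps power2_eq_square)
  have ci: "f contour_integrable_on part_circlepath 0 R 0 pi"
    by (rule contour_integrable_holomorphic_simple[OF f])
       (use half in \<open>force simp: S_def open_halfspace_Im_gt\<close>)+
  have li: "f contour_integrable_on linepath (- of_real R) (of_real R)"
    by (rule contour_integrable_holomorphic_simple[OF f])
       (auto simp: S_def open_halfspace_Im_gt closed_segment_def)
  have e: "pathfinish (part_circlepath 0 R 0 pi) = - of_real R" by (simp add: exp_pi_i)
  have s: "pathstart (part_circlepath 0 R 0 pi) = of_real R" by simp
  have "(f has_contour_integral 0) g"
  proof (rule Cauchy_theorem_convex_simple[OF f])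
    show "convex S" unfolding S_def by (rule convex_halfspace_Im_gt)
    show "valid_path g" unfolding g_def by (rule valid_path_join) (use e in auto)
    show "pathfinish g = pathstart g" using s by (simp add: g_def)
    have "path_image g \<subseteq> path_image (part_circlepath 0 R 0 pi) \<union> path_image (linepath (- of_real R) (of_real R))"
      unfolding g_def by (rule path_image_join_subset)
    moreover have "path_image (part_circlepath 0 R 0 pi) \<subseteq> S" using half by (force simp: S_def)
    moreover have "path_image (linepath (- of_real R) (of_real R)) \<subseteq> S"
      by (auto simp: S_def closed_segment_def)
    ultimately show "path_image g \<subseteq> S" by blast
  qed
  then have "contour_integral g f = 0" by (rule contour_integral_unique)
  moreover have "contour_integral g f = contour_integral (part_circlepath 0 R 0 pi) f +
      contour_integral (linepath (- of_real R) (of_real R)) f"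
    unfolding g_def by (rule contour_integral_join) (use ci li e in auto)
  ultimately have "cmod (contour_integral (linepath (- of_real R) (of_real R)) f) =
      cmod (contour_integral (part_circlepath 0 R 0 pi) f)"
    by (metis add_eq_0_iff norm_minus_cancel)
  also have "\<dots> \<le> 2 / (R\<^sup>2 - 1/4) * R * \<bar>pi - 0\<bar>"
  proof (rule contour_integral_bound_part_circlepath[OF ci])
    have R2: "R\<^sup>2 - 1/4 > 0" using one_less_power[OF \<open>R > 1\<close>, of 2] by simp
    then show "0 \<le> 2 / (R\<^sup>2 - 1/4)" "0 \<le> R" using \<open>R > 1\<close> by auto
    fix z assume z: "z \<in> path_image (part_circlepath 0 R 0 pi)"
    have nR: "cmod z = R"
      using z \<open>R > 1\<close> by (auto simp: path_image_part_circlepath norm_mult)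
    have "cmod (\<i> / 2) = 1/2" by (simp add: norm_divide)
    then have "z \<noteq> \<i> / 2" using \<open>R > 1\<close> nR by fastforce
    then have "cmod (f z) = cmod (exp (\<i> * of_real a * z) - of_real (exp (- a / 2))) / cmod (z\<^sup>2 + 1/4)"
      by (simp add: eqf norm_divide)
    also have "\<dots> \<le> 2 / (R\<^sup>2 - 1/4)"
    proof (rule frac_le[OF _ _ R2])
      \<comment> \<open>Here a >= 0 makes the exponential bounded in the upper half-plane; negative
        frequencies are reduced to this case by conjugation.\<close>
      have "cmod (exp (\<i> * of_real a * z)) \<le> 1"
        using half[OF z] \<open>a \<ge> 0\<close> by (simp add: norm_exp_eq_Re)
      moreover have "cmod (of_real (exp (- a / 2))) \<le> 1" using \<open>a \<ge> 0\<close> by simp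
      ultimately show "cmod (exp (\<i> * of_real a * z) - of_real (exp (- a / 2))) \<le> 2"
        using norm_triangle_ineq4[of "exp (\<i> * of_real a * z)" "of_real (exp (- a / 2))"] by linarith
      show "R\<^sup>2 - 1/4 \<le> cmod (z\<^sup>2 + 1/4)"
        using norm_diff_ineq[of "z\<^sup>2" "1/4"] nR by (simp add: norm_power norm_divide)
    qed simp
    finally show "cmod (f z) \<le> 2 / (R\<^sup>2 - 1/4)" .
  qed
  also have "contour_integral (linepath (- of_real R) (of_real R)) f = integral {-R..R} (\<lambda>t. f (of_real t))"
    using contour_integral_linepath_Reals_eq[of "- of_real R" "of_real R" f] \<open>R > 1\<close> by simp
  also have "(\<lambda>t. f (of_real t)) =
     (\<lambda>t. (exp (\<i> * of_real (a * t)) - of_real (exp (- a / 2))) / of_real (t\<^sup>2 + 1/4))"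
    by (rule ext, subst eqf) (auto simp: complex_eq_iff mult.assoc)
  finally show ?thesis by simp
qed

text \<open>The characteristic function of the Cauchy distribution with scale 1/2. The half-disc
  bound is of order 1/R, so the numerator with exp (- a / 2) subtracted integrates to 0, and the
  subtracted constant contributes itself times the total mass 1.\<close>

lemma cauchy_fourier_nonneg:
  fixes a :: real
  assumes "a \<ge> 0"
  shows "integral\<^sup>L cauchy (\<lambda>t. exp (\<i> * of_real (a * t))) = of_real (exp (- a / 2))"
proof -
  define E :: "real \<Rightarrow> complex" where
    "E = (\<lambda>t. (exp (\<i> * of_real (a * t)) - of_real (exp (- a / 2))) / of_real (t\<^sup>2 + 1/4))"
  have meas: "(\<lambda>t. exp (\<i> * of_real (a * t))) \<in> borel_measurable borel"
    by (intro borel_measurable_continuous_onI continuous_intros)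
  have Em: "E \<in> borel_measurable borel"
    unfolding E_def by (intro borel_measurable_continuous_onI continuous_intros) (metis of_real_eq_0_iff quarter_pos less_irrefl)
  have Eb: "cmod (E t) \<le> 2 * (1 / (t\<^sup>2 + 1/4))" for t
  proof -
    have "cmod (E t) = cmod (exp (\<i> * of_real (a * t)) - of_real (exp (- a / 2))) / (t\<^sup>2 + 1/4)"
      unfolding E_def norm_divide using quarter_pos[of t] by (simp only: norm_of_real abs_of_pos)
    also have "\<dots> \<le> 2 / (t\<^sup>2 + 1/4)"
    proof (rule divide_right_mono)
      have "cmod (of_real (exp (- a / 2))) \<le> 1" using \<open>a \<ge> 0\<close> by simp
      moreover have "cmod (exp (\<i> * of_real (a * t))) = 1" by simp
      ultimately show "cmod (exp (\<i> * of_real (a * t)) - of_real (exp (- a / 2))) \<le> 2"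
        using norm_triangle_ineq4[of "exp (\<i> * of_real (a * t))" "of_real (exp (- a / 2))"] by linarith
    qed (use quarter_pos[of t] in linarith)
    finally show ?thesis by simp
  qed
  have dom: "integrable lborel (\<lambda>t::real. 2 * (1 / (t\<^sup>2 + 1/4)))"
    by (intro integrable_mult_right cauchy_density_integral)
  have Ei: "integrable lborel E"
    by (rule Bochner_Integration.integrable_bound[OF dom]) (use Em Eb in \<open>auto intro!: AE_I2 order_trans[OF _ abs_ge_self]\<close>)
  have "(\<lambda>n. LINT t|lborel. indicator {- real n..real n} t *\<^sub>R E t) \<longlonglongrightarrow> integral\<^sup>L lborel E"
  proof (rule integral_dominated_convergence[OF _ _ dom])
    show "AE t in lborel. (\<lambda>n. indicator {- real n..real n} t *\<^sub>R E t) \<longlonglongrightarrow> E t"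
    proof (rule AE_I2)
      fix t :: real
      obtain N where N: "\<bar>t\<bar> \<le> real N" using real_arch_simple by blast
      show "(\<lambda>n. indicator {- real n..real n} t *\<^sub>R E t) \<longlonglongrightarrow> E t"
        by (rule tendsto_eventually, rule eventually_sequentiallyI[of N]) (use N in \<open>auto simp: indicator_def\<close>)
    qed
    show "AE t in lborel. cmod (indicator {- real n..real n} t *\<^sub>R E t) \<le> 2 * (1 / (t\<^sup>2 + 1/4))" for n
      using Eb order_trans[OF norm_ge_zero Eb] by (intro AE_I2) (auto simp: indicator_def)
  qed (use Em in auto)
  moreover have "(\<lambda>n. LINT t|lborel. indicator {- real n..real n} t *\<^sub>R E t) \<longlonglongrightarrow> 0"
  proof (rule Lim_null_comparison)
    have "integrable lborel (\<lambda>t. indicator {- real n..real n} t *\<^sub>R E t)" for n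
      using Ei by (intro integrable_mult_indicator) auto
    then have "(LINT t|lborel. indicator {- real n..real n} t *\<^sub>R E t) = integral {- real n..real n} E" for n
      using set_borel_integral_eq_integral(2)[of "{- real n..real n}" E]
      by (simp add: set_integrable_def set_lebesgue_integral_def)
    then show "\<forall>\<^sub>F n in sequentially. cmod (LINT t|lborel. indicator {- real n..real n} t *\<^sub>R E t) \<le>
        2 / ((real n)\<^sup>2 - 1/4) * real n * pi"
      using cauchy_segment_bound[OF assms] by (intro eventually_sequentiallyI[of 2]) (simp add: E_def)
    have "(\<lambda>n. 2 * pi * (inverse (real n) / (1 - 1/4 * (inverse (real n))\<^sup>2))) \<longlonglongrightarrow> 2 * pi * (0 / (1 - 1/4 * 0\<^sup>2))"
      by (intro tendsto_intros LIMSEQ_inverse_real_of_nat lim_inverse_n) auto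
    moreover have "\<forall>\<^sub>F n in sequentially. 2 * pi * (inverse (real n) / (1 - 1/4 * (inverse (real n))\<^sup>2)) =
        2 / ((real n)\<^sup>2 - 1/4) * real n * pi"
    proof (rule eventually_sequentiallyI[of 1])
      fix n :: nat assume "1 \<le> n"
      then have n: "real n > 0" "(real n)\<^sup>2 \<ge> 1" by (auto simp: one_le_power)
      show "2 * pi * (inverse (real n) / (1 - 1/4 * (inverse (real n))\<^sup>2)) = 2 / ((real n)\<^sup>2 - 1/4) * real n * pi"
        using n by (simp add: divide_simps) (simp add: power2_eq_square)
    qed
    ultimately show "(\<lambda>n. 2 / ((real n)\<^sup>2 - 1/4) * real n * pi) \<longlonglongrightarrow> 0"
      using Lim_transform_eventually by fastforce
  qed
  ultimately have E0: "integral\<^sup>L lborel E = 0" by (rule LIMSEQ_unique)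
  have gen: "(1 / (2 * pi * q)) *\<^sub>R X = (1 / (2 * pi)) *\<^sub>R ((X - of_real e) / of_real q) +
      of_real (1 / (2 * pi) * e * (1 / q))" if "q > 0" for q e and X :: complex
    using that by (simp add: scaleR_conv_of_real field_simps)
  have "integral\<^sup>L cauchy (\<lambda>t. exp (\<i> * of_real (a * t))) =
      (LINT t|lborel. (1 / (2 * pi)) *\<^sub>R E t + of_real (1 / (2 * pi) * exp (- a / 2) * (1 / (t\<^sup>2 + 1/4))))"
    unfolding integral_cauchy[OF meas]
    unfolding E_def by (rule Bochner_Integration.integral_cong[OF refl gen[OF quarter_pos]])
  also have "\<dots> = (1 / (2 * pi)) *\<^sub>R integral\<^sup>L lborel E +
      (LINT t|lborel. complex_of_real (1 / (2 * pi) * exp (- a / 2) * (1 / (t\<^sup>2 + 1/4))))"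
    unfolding integral_scaleR_right[symmetric]
    by (intro Bochner_Integration.integral_add integrable_scaleR_right Ei integrable_of_real
          integrable_mult_right cauchy_density_integral)
  also have "\<dots> = of_real (1 / (2 * pi) * exp (- a / 2) * (2 * pi))"
    unfolding integral_complex_of_real integral_mult_right_zero cauchy_density_integral(2) E0 by (simp only: scaleR_zero_right add_0)
  also have "1 / (2 * pi) * exp (- a / 2) * (2 * pi) = exp (- a / 2)" by simp
  finally show ?thesis .
qed

lemma cauchy_fourier:
  "integral\<^sup>L cauchy (\<lambda>t. exp (\<i> * of_real (a * t))) = of_real (exp (- \<bar>a\<bar> / 2))"
proof (cases "a \<ge> 0")
  case False
  have "(\<lambda>t. exp (\<i> * of_real (a * t))) = (\<lambda>t. cnj (exp (\<i> * of_real (- a * t))))"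
    by (simp add: exp_cnj)
  then show ?thesis using cauchy_fourier_nonneg[of "- a"] False by simp
qed (use cauchy_fourier_nonneg in simp)

lemma integrable_cauchy_powr:
  assumes "p < 1"
  shows "integrable cauchy (\<lambda>t. (1 + \<bar>t\<bar>) powr p)"
proof -
  define F where "F = (\<lambda>t::real. (1 + t) powr (p - 1) / (p - 1))"
  have p1: "p - 1 \<noteq> 0" using assms by simp
  have D: "(F has_real_derivative (1 + t) powr (p - 2)) (at t)" if "t > 0" for t
  proof -
    have "((\<lambda>t. (1 + t) powr (p - 1)) has_real_derivative (p - 1) * (1 + t) powr (p - 1 - 1)) (at t)"
      using that by (auto intro!: derivative_eq_intros)
    then have "(F has_real_derivative (p - 1) * (1 + t) powr (p - 1 - 1) / (p - 1)) (at t)"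
      unfolding F_def by (rule DERIV_cdivide)
    also have "(p - 1) * (1 + t) powr (p - 1 - 1) / (p - 1) = (1 + t) powr (p - 2)"
      using p1 by (simp add: diff_diff_eq)
    finally show ?thesis .
  qed
  have "set_integrable lborel (einterval (ereal 0) \<infinity>) (\<lambda>t. (1 + t) powr (p - 2))"
  proof (rule interval_integral_FTC_nonneg(1))
    show "(F has_real_derivative (1 + t) powr (p - 2)) (at t)" if "ereal 0 < ereal t" for t
      using D that by simp
    show "isCont (\<lambda>t. (1 + t) powr (p - 2)) t" if "ereal 0 < ereal t" for t
      using that by (intro continuous_intros) auto
    have "(F \<longlongrightarrow> F 0) (at_right 0)"
      unfolding F_def by (intro tendsto_intros) (use p1 in auto)
    then show "((F \<circ> real_of_ereal) \<longlongrightarrow> F 0) (at_right (ereal 0))"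
      by (simp add: ereal_tendsto_simps)
    have "((\<lambda>t. (1 + t) powr (p - 1) / (p - 1)) \<longlongrightarrow> 0 / (p - 1)) at_top"
      by (intro tendsto_divide tendsto_const tendsto_neg_powr filterlim_tendsto_add_at_top[OF tendsto_const filterlim_ident])
         (use assms in auto)
    then show "((F \<circ> real_of_ereal) \<longlongrightarrow> 0) (at_left \<infinity>)"
      by (simp add: ereal_tendsto_simps F_def)
  qed auto
  then have half: "integrable lborel (\<lambda>t. indicator {0<..} t * (1 + t) powr (p - 2))"
    by (simp add: set_integrable_def einterval_def greaterThan_def)
  have half': "integrable lborel (\<lambda>t. indicator {0<..} (- t) * (1 - t) powr (p - 2))"
    using lborel_integrable_real_affine[OF half, of "-1" 0] by simp
  have "integrable lborel (\<lambda>t. 8 * (indicator {0<..} t * (1 + t) powr (p - 2) + indicator {0<..} (- t) * (1 - t) powr (p - 2)) :: real)"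
    by (intro integrable_mult_right Bochner_Integration.integrable_add half half')
  then have "integrable lborel (\<lambda>t. (1 / (2 * pi * (t\<^sup>2 + 1/4))) *\<^sub>R (1 + \<bar>t\<bar>) powr p)"
  proof (rule Bochner_Integration.integrable_bound)
    \<comment> \<open>At t = 0 both indicators vanish and the majorant fails, but a single point is
      a null set. The factor 8 comes from (1 + |t|)^2 <= 2 + 2 t^2 <= 8 (t^2 + 1/4).\<close>
    have "norm ((1 / (2 * pi * (t\<^sup>2 + 1/4))) *\<^sub>R (1 + \<bar>t\<bar>) powr p) \<le>
        norm (8 * (indicator {0<..} t * (1 + t) powr (p - 2) + indicator {0<..} (- t) * (1 - t) powr (p - 2)))"
      if "t \<noteq> 0" for t
    proof -
      have "(1 + \<bar>t\<bar>)\<^sup>2 \<le> 8 * (2 * pi * (t\<^sup>2 + 1/4))"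
      proof -
        have "(1 + \<bar>t\<bar>)\<^sup>2 \<le> 2 + 2 * t\<^sup>2"
          using zero_le_power2[of "1 - \<bar>t\<bar>"] by (simp add: power2_eq_square algebra_simps)
        also have "\<dots> \<le> 8 * (1 * (t\<^sup>2 + 1/4))" by (simp add: algebra_simps)
        also have "\<dots> \<le> 8 * (2 * pi * (t\<^sup>2 + 1/4))"
          using pi_gt3 quarter_pos[of t] by (intro mult_left_mono mult_right_mono) auto
        finally show ?thesis .
      qed
      then have "1 / (2 * pi * (t\<^sup>2 + 1/4)) \<le> 8 / (1 + \<bar>t\<bar>)\<^sup>2"
        using quarter_pos[of t] by (simp add: divide_simps)
      then have "1 / (2 * pi * (t\<^sup>2 + 1/4)) * (1 + \<bar>t\<bar>) powr p \<le> 8 / (1 + \<bar>t\<bar>)\<^sup>2 * (1 + \<bar>t\<bar>) powr p"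
        by (intro mult_right_mono) auto
      also have "\<dots> = 8 * (1 + \<bar>t\<bar>) powr (p - 2)"
      proof -
        have "1 + \<bar>t\<bar> > 0" by linarith
        then have "(1 + \<bar>t\<bar>) powr (p - 2) = (1 + \<bar>t\<bar>) powr p / (1 + \<bar>t\<bar>)\<^sup>2"
          by (simp only: powr_diff powr_numeral)
        then show ?thesis by simp
      qed
      also have "\<dots> = 8 * (indicator {0<..} t * (1 + t) powr (p - 2) + indicator {0<..} (- t) * (1 - t) powr (p - 2))"
        using that by (cases "t > 0") auto
      finally show ?thesis using quarter_pos[of t] by simp
    qed
    then show "AE t in lborel. norm ((1 / (2 * pi * (t\<^sup>2 + 1/4))) *\<^sub>R (1 + \<bar>t\<bar>) powr p) \<le>
        norm (8 * (indicator {0<..} t * (1 + t) powr (p - 2) + indicator {0<..} (- t) * (1 - t) powr (p - 2)) :: real)"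
      using AE_lborel_singleton[of 0] by auto
  qed auto
  then show ?thesis by (subst integrable_cauchy_iff) auto
qed

section \<open>The zeta function in the right half-plane\<close>

text \<open>This is (s - 1) * zeta s with the pole removed. The formula is the case m = 1 of
  \<open>taylor_rem_sums\<close>, whose remainders are summable for Re s > 0; it yields holomorphy
  at 1 and an explicit growth bound at once.\<close>

definition zeta_reg :: "complex \<Rightarrow> complex" where
  "zeta_reg s = 1 + (\<Sum>n. taylor_rem 1 n s)"

lemma holomorphic_zeta_reg: "zeta_reg holomorphic_on {s. Re s > 0}"
  unfolding zeta_reg_def[abs_def]
  using holomorphic_sum_taylor_rem[of 0] by (intro holomorphic_intros) simp

lemma open_connected_right_half_plane_minus_1:
  "open ({s. Re s > 0} - {1 :: complex})" "connected ({s. Re s > 0} - {1 :: complex})"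
  by (intro open_delete connected_open_delete open_halfspace_Re_gt convex_connected convex_halfspace_Re_gt;
      simp)+

lemma zeta_reg_eq:
  assumes "Re s > 0" "s \<noteq> 1"
  shows "zeta_reg s = (s - 1) * zeta s"
proof (rule analytic_continuation_open[where s = "{s. Re s > 1}" and s' = "{s. Re s > 0} - {1}"
          and f = zeta_reg and g = "\<lambda>s. (s - 1) * zeta s"])
  show "{s. Re s > 1} \<noteq> {}" by (auto intro: exI[of _ 2])
  show "zeta_reg holomorphic_on {s. Re s > 0} - {1}"
    by (rule holomorphic_on_subset[OF holomorphic_zeta_reg]) auto
  show "(\<lambda>s. (s - 1) * zeta s) holomorphic_on {s. Re s > 0} - {1}"
    by (intro holomorphic_intros holomorphic_on_subset[OF holomorphic_zeta]) auto
  show "zeta_reg z = (z - 1) * zeta z" if "z \<in> {s. Re s > 1}" for z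
    using taylor_rem_sums[of z 1] that
    by (simp add: zeta_reg_def sums_iff falling_def zeta_eq_dirichlet_zeta algebra_simps)
qed (use assms open_connected_right_half_plane_minus_1 in \<open>auto intro: open_halfspace_Re_gt\<close>)

lemma zeta_reg_1: "zeta_reg 1 = 1"
proof -
  have "taylor_rem 1 n 1 = 0" for n
    by (simp add: taylor_rem_def falling_def del: of_nat_Suc)
  then show ?thesis by (simp add: zeta_reg_def)
qed

lemma norm_zeta_reg_le:
  obtains C where "C \<ge> 0" "\<And>s. Re s \<ge> 1/4 \<Longrightarrow> cmod (zeta_reg s) \<le> 1 + C * cmod s * cmod (s - 1)"
proof
  let ?b = "\<lambda>n. real (Suc n) powr (- (5/4))"
  have sb: "summable ?b" by (rule summable_Suc_powr) simp
  show "suminf ?b \<ge> 0" by (rule suminf_nonneg[OF sb]) simp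
  fix s :: complex assume s: "Re s \<ge> 1/4"
  have "cmod (taylor_rem 1 n s) \<le> cmod s * cmod (s - 1) * ?b n" for n
  proof -
    have "cmod (taylor_rem 1 n s) \<le> cmod (falling 2 s) * real (Suc n) powr (- Re s - 1)"
      using taylor_rem_bound[of s 1 n] s by (simp add: numeral_2_eq_2)
    also have "\<dots> \<le> cmod (falling 2 s) * ?b n"
      using s by (intro mult_left_mono powr_mono) auto
    also have "cmod (falling 2 s) = cmod s * cmod (s - 1)"
      by (simp add: falling_def numeral_2_eq_2 norm_mult norm_minus_commute)
    finally show ?thesis .
  qed
  then have "cmod (\<Sum>n. taylor_rem 1 n s) \<le> (\<Sum>n. cmod s * cmod (s - 1) * ?b n)"
    by (intro norm_suminf_le summable_mult sb)
  also have "\<dots> = cmod s * cmod (s - 1) * suminf ?b" by (rule suminf_mult[OF sb])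
  finally show "cmod (zeta_reg s) \<le> 1 + suminf ?b * cmod s * cmod (s - 1)"
    unfolding zeta_reg_def using norm_triangle_ineq[of 1 "\<Sum>n. taylor_rem 1 n s"]
    by (simp add: mult_ac)
qed

text \<open>A crude polynomial bound is enough, because the power 1 / ln t turns it into a constant.
  The strip has to contain the discs on which this is done: radius 7/2 about 4, and radius 5/16
  about 9/16.\<close>

lemma norm_zeta_le_linear:
  obtains C where "C \<ge> 1" "\<And>s. \<lbrakk>Re s \<ge> 1/4; Re s \<le> 8; \<bar>Im s\<bar> \<ge> 1\<rbrakk> \<Longrightarrow> cmod (zeta s) \<le> C * \<bar>Im s\<bar>"
proof -
  obtain C where C: "C \<ge> 0" "\<And>s. Re s \<ge> 1/4 \<Longrightarrow> cmod (zeta_reg s) \<le> 1 + C * cmod s * cmod (s - 1)"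
    using norm_zeta_reg_le by blast
  show ?thesis
  proof
    show "1 + 9 * C \<ge> 1" using C by simp
    fix s :: complex assume s: "Re s \<ge> 1/4" "Re s \<le> 8" "\<bar>Im s\<bar> \<ge> 1"
    have s1: "cmod (s - 1) \<ge> 1" using abs_Im_le_cmod[of "s - 1"] s by simp
    then have ne: "s \<noteq> 1" by auto
    have "cmod (s - 1) * cmod (zeta s) \<le> 1 + C * cmod s * cmod (s - 1)"
      using C(2)[OF s(1)] zeta_reg_eq[of s] ne s by (simp add: norm_mult)
    also have "\<dots> \<le> cmod (s - 1) * (1 + C * cmod s)"
      using s1 by (simp add: algebra_simps)
    finally have "cmod (zeta s) \<le> 1 + C * cmod s"
      by (rule mult_left_le_imp_le) (use s1 in linarith)
    also have "\<dots> \<le> 1 + C * (9 * \<bar>Im s\<bar>)"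
      using cmod_le[of s] s C(1) by (intro add_left_mono mult_left_mono) auto
    also have "\<dots> \<le> (1 + 9 * C) * \<bar>Im s\<bar>" using s by (simp add: algebra_simps)
    finally show "cmod (zeta s) \<le> (1 + 9 * C) * \<bar>Im s\<bar>" .
  qed
qed

text \<open>The cubes 1/m^3 for m >= 2 are compared with the telescoping terms 1/(2 (m - 1) m),
  whose sum is 1/2. The purpose is to keep |zeta| between two positive constants for Re s >=
  3.\<close>

lemma norm_zeta_minus_1_le:
  assumes "Re s \<ge> 3"
  shows "cmod (zeta s - 1) \<le> 1/2"
proof -
  have sm: "summable (\<lambda>n. of_nat (Suc n) powr (- s))"
    by (rule summable_dirichlet) (use assms in simp)
  have "zeta s = (\<Sum>n. of_nat (Suc n) powr (- s))"
    using assms by (simp add: zeta_eq_dirichlet_zeta dirichlet_zeta_altdef)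
  then have "zeta s - 1 = (\<Sum>n. of_nat (Suc (Suc n)) powr (- s))"
    using suminf_split_head[OF sm] by simp
  also have "cmod \<dots> \<le> (\<Sum>n. 1/2 * (1 / real (Suc n) - 1 / real (Suc (Suc n))))"
  proof (rule norm_suminf_le)
    have "(\<lambda>n. 1 / real (Suc n)) \<longlonglongrightarrow> 0" by (rule LIMSEQ_Suc[OF lim_1_over_n])
    then have "(\<lambda>n. 1 / real (Suc n) - 1 / real (Suc (Suc n))) sums (1 / real (Suc 0) - 0)"
      by (rule telescope_sums')
    then show "summable (\<lambda>n. 1/2 * (1 / real (Suc n) - 1 / real (Suc (Suc n))))"
      by (intro summable_mult) (auto simp: sums_iff)
    fix n
    have "cmod (of_nat (Suc (Suc n)) powr (- s)) = real (Suc (Suc n)) powr (- Re s)"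
      by (subst norm_Suc_powr) simp
    also have "\<dots> \<le> real (Suc (Suc n)) powr (- 3)"
      using assms by (intro powr_mono) auto
    also have "\<dots> = 1 / (real (Suc (Suc n)))^3" by (simp add: powr_minus powr_numeral divide_inverse)
    also have "\<dots> \<le> 1 / (2 * (real (Suc n) * real (Suc (Suc n))))"
    proof (rule frac_le)
      show "2 * (real (Suc n) * real (Suc (Suc n))) \<le> (real (Suc (Suc n)))^3"
        by (simp add: power3_eq_cube algebra_simps)
    qed simp_all
    also have "\<dots> = 1/2 * (1 / real (Suc n) - 1 / real (Suc (Suc n)))"
      by (simp add: field_simps)
    finally show "cmod (of_nat (Suc (Suc n)) powr (- s)) \<le> 1/2 * (1 / real (Suc n) - 1 / real (Suc (Suc n)))" .
  qed
  also have "\<dots> = 1/2"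
  proof -
    have "(\<lambda>n. 1 / real (Suc n)) \<longlonglongrightarrow> 0" by (rule LIMSEQ_Suc[OF lim_1_over_n])
    then have "(\<lambda>n. 1 / real (Suc n) - 1 / real (Suc (Suc n))) sums (1 / real (Suc 0) - 0)"
      by (rule telescope_sums')
    from sums_mult[OF this, of "1/2"] show ?thesis by (simp add: sums_iff)
  qed
  finally show ?thesis .
qed

section \<open>The Dirichlet series attached to the fractional parts\<close>

text \<open>The transform of a unit sequence: s times the integral of x^(-s-1) over [k + 1, k + 2].
  The index k stands for position \<open>Suc k\<close>.\<close>

definition dpow :: "nat \<Rightarrow> complex \<Rightarrow> complex" where
  "dpow k s = of_nat (Suc k) powr (- s) - of_nat (Suc (Suc k)) powr (- s)"

lemma holomorphic_dpow [holomorphic_intros]: "dpow k holomorphic_on A"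
  unfolding dpow_def[abs_def] by (intro holomorphic_intros)

lemma norm_dpow_le:
  assumes "Re s \<ge> -1"
  shows "cmod (dpow k s) \<le> cmod s * real (Suc k) powr (- Re s - 1)"
proof -
  have "taylor_rem 0 k (s + 1) = - dpow k s"
    by (simp add: taylor_rem_def dpow_def falling_def)
  then show ?thesis
    using taylor_rem_bound[of "s + 1" 0 k] assms by (simp add: falling_def)
qed

lemma holomorphic_suminf_dpow:
  assumes "\<And>k. cmod (a k) \<le> 1"
  shows "(\<lambda>s. \<Sum>k. a k * dpow k s) holomorphic_on {s. Re s > 0}"
proof (rule holomorphic_suminf)
  show "open {s. Re s > 0}" by (rule open_halfspace_Re_gt)
  show "(\<lambda>s. a k * dpow k s) holomorphic_on {s. Re s > 0}" for k
    by (intro holomorphic_intros)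
  fix x assume "x \<in> {s. Re s > 0}"
  define d where "d = Re x / 2"
  have d: "d > 0" "Re x - d = d" using \<open>x \<in> _\<close> by (auto simp: d_def field_simps)
  have "cmod (a k * dpow k s) \<le> (cmod x + d) * real (Suc k) powr (- (1 + d))"
    if s: "s \<in> cball x d" for k s
  proof -
    have Re: "Re s \<ge> d" using Re_cball_ge[OF s] d by simp
    have "cmod s \<le> cmod x + d"
      using s norm_triangle_ineq2[of s x] by (simp add: dist_norm norm_minus_commute)
    moreover have "real (Suc k) powr (- Re s - 1) \<le> real (Suc k) powr (- (1 + d))"
      using Re by (intro powr_mono) auto
    ultimately have "cmod s * real (Suc k) powr (- Re s - 1) \<le> (cmod x + d) * real (Suc k) powr (- (1 + d))"
      using d by (intro mult_mono) auto
    moreover have "cmod (a k) * cmod (dpow k s) \<le> 1 * (cmod s * real (Suc k) powr (- Re s - 1))"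
      by (intro mult_mono assms norm_dpow_le) (use Re d in auto)
    ultimately show ?thesis by (simp add: norm_mult)
  qed
  moreover have "cball x d \<subseteq> {s. Re s > 0}" using Re_cball_ge[of _ x d] d by force
  moreover have "summable (\<lambda>k. (cmod x + d) * real (Suc k) powr (- (1 + d)))"
    by (intro summable_mult summable_Suc_powr) (use d in auto)
  ultimately show "\<exists>d M. 0 < d \<and> cball x d \<subseteq> {s. Re s > 0} \<and> summable M \<and>
      (\<forall>k. \<forall>s\<in>cball x d. cmod (a k * dpow k s) \<le> M k)"
    using d(1) by blast
qed

lemma summable_dpow:
  assumes "\<And>k. cmod (a k) \<le> 1" "Re s > 0"
  shows "summable (\<lambda>k. a k * dpow k s)"
proof (rule summable_comparison_test'[where N = 0])
  show "summable (\<lambda>k. cmod s * real (Suc k) powr (- (1 + Re s)))"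
    by (intro summable_mult summable_Suc_powr) (use assms in auto)
  show "cmod (a k * dpow k s) \<le> cmod s * real (Suc k) powr (- (1 + Re s))" for k
  proof -
    have "cmod (a k) * cmod (dpow k s) \<le> 1 * (cmod s * real (Suc k) powr (- Re s - 1))"
      by (intro mult_mono assms norm_dpow_le) (use assms in auto)
    also have "- Re s - 1 = - (1 + Re s)" by simp
    finally show ?thesis by (simp only: norm_mult mult_1)
  qed
qed

lemma summation_by_parts:
  fixes A u :: "nat \<Rightarrow> complex"
  shows "A 0 = 0 \<Longrightarrow> (\<Sum>k<N. A (Suc k) * (u k - u (Suc k))) = (\<Sum>k<N. (A (Suc k) - A k) * u k) - A N * u N"
  by (induction N) (auto simp: algebra_simps)

lemma frac_nat_div_Suc:
  assumes "l > 0"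
  shows "frac (real (Suc k) / real l) - frac (real k / real l) = 1 / real l - (if l dvd Suc k then 1 else 0)"
proof -
  have "frac (real n / real l) = real n / real l - real (n div l)" for n
    by (simp add: frac_def floor_divide_of_nat_eq)
  moreover have "Suc k div l = k div l + (if l dvd Suc k then 1 else 0)"
    using assms by (auto simp: div_Suc mod_Suc dvd_eq_mod_eq_0 split: if_splits)
  ultimately show ?thesis by (simp add: add_divide_distrib del: of_nat_Suc) (simp add: add_divide_distrib)
qed

lemma tendsto_nat_powr_neg:
  assumes "Re s > 0"
  shows "(\<lambda>n. of_nat (Suc n) powr (- s)) \<longlonglongrightarrow> (0::complex)"
proof (rule tendsto_norm_zero_cancel)
  show "(\<lambda>n. cmod (of_nat (Suc n) powr (- s))) \<longlonglongrightarrow> 0"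
    unfolding norm_Suc_powr
    by (intro tendsto_neg_powr filterlim_compose[OF filterlim_real_sequentially filterlim_Suc])
       (use assms in auto)
qed

lemma of_nat_mult_powr: "(of_nat (m * n) :: complex) powr s = of_nat m powr s * of_nat n powr s"
  by (simp add: powr_times_real)

text \<open>Summation by parts moves the differences onto the fractional parts, whose increments are
  1/l minus the indicator of the multiples of l. The first part sums to zeta s / l, the second to
  l^(-s) * zeta s.\<close>

lemma frac_dirichlet_sums_gt_1:
  assumes "l > 0" "Re s > 1"
  shows "(\<lambda>k. of_real (frac (real (Suc k) / real l)) * dpow k s) sums (zeta s * (1 / of_nat l - of_nat l powr (- s)))"
proof -
  let ?u = "\<lambda>k. of_nat (Suc k) powr (- s) :: complex"
  define A where "A = (\<lambda>k. complex_of_real (frac (real k / real l)))"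
  have us: "?u sums zeta s"
    using summable_dirichlet[OF assms(2)] assms(2)
    by (simp add: zeta_eq_dirichlet_zeta dirichlet_zeta_altdef summable_sums)
  \<comment> \<open>\<open>g\<close> enumerates the k for which \<open>Suc k\<close> is a multiple
    of l.\<close>
  define g where "g = (\<lambda>m. l * Suc m - 1)"
  have g: "Suc (g m) = l * Suc m" for m using assms(1) by (simp add: g_def)
  have "strict_mono g"
  proof (rule strict_monoI_Suc)
    show "g m < g (Suc m)" for m using g[of m] g[of "Suc m"] assms(1) by simp
  qed
  moreover have "(if l dvd Suc k then ?u k else 0) = 0" if "k \<notin> range g" for k
  proof (cases "l dvd Suc k")
    case True
    then obtain m where m: "Suc k = l * m" by (auto elim: dvdE)
    then have "m = Suc (m - 1)" using assms(1) by (cases m) auto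
    with m g[of "m - 1"] have "k = g (m - 1)" by simp
    with that show ?thesis by auto
  qed simp
  moreover have "(\<lambda>m. if l dvd Suc (g m) then ?u (g m) else 0) sums (of_nat l powr (- s) * zeta s)"
  proof -
    have "(if l dvd Suc (g m) then ?u (g m) else 0) = of_nat l powr (- s) * ?u m" for m
      unfolding g by (simp only: of_nat_mult_powr dvd_triv_left if_True)
    then show ?thesis using sums_mult[OF us] by simp
  qed
  ultimately have ds: "(\<lambda>k. if l dvd Suc k then ?u k else 0) sums (of_nat l powr (- s) * zeta s)"
    by (subst (asm) sums_mono_reindex) auto
  have "(\<lambda>k. 1 / of_nat l * ?u k - (if l dvd Suc k then ?u k else 0)) sums (1 / of_nat l * zeta s - of_nat l powr (- s) * zeta s)"
    by (intro sums_diff sums_mult us ds)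
  moreover have "1 / of_nat l * ?u k - (if l dvd Suc k then ?u k else 0) = (A (Suc k) - A k) * ?u k" for k
  proof -
    have "A (Suc k) - A k = 1 / of_nat l - (if l dvd Suc k then 1 else 0)"
      unfolding A_def of_real_diff[symmetric] frac_nat_div_Suc[OF assms(1)] by simp
    then show ?thesis by (simp add: left_diff_distrib)
  qed
  moreover have "1 / of_nat l * zeta s - of_nat l powr (- s) * zeta s = zeta s * (1 / of_nat l - of_nat l powr (- s))"
    by (simp add: algebra_simps)
  ultimately have 1: "(\<lambda>k. (A (Suc k) - A k) * ?u k) sums (zeta s * (1 / of_nat l - of_nat l powr (- s)))"
    by (simp only:)
  have 2: "(\<lambda>N. A N * ?u N) \<longlonglongrightarrow> 0"
  proof (rule Lim_null_comparison)
    show "(\<lambda>n. cmod (?u n)) \<longlonglongrightarrow> 0"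
      using tendsto_norm[OF tendsto_nat_powr_neg[of s]] assms(2) by simp
    have "cmod (A n) \<le> 1" for n by (simp add: A_def less_imp_le[OF frac_lt_1])
    then have "cmod (A n * ?u n) \<le> 1 * cmod (?u n)" for n
      unfolding norm_mult by (intro mult_right_mono) auto
    then show "\<forall>\<^sub>F n in sequentially. cmod (A n * ?u n) \<le> cmod (?u n)" by simp
  qed
  have "(\<lambda>N. (\<Sum>k<N. (A (Suc k) - A k) * ?u k) - A N * ?u N) \<longlonglongrightarrow> zeta s * (1 / of_nat l - of_nat l powr (- s)) - 0"
    by (intro tendsto_diff 2 1[unfolded sums_def])
  moreover have "(\<Sum>k<N. (A (Suc k) - A k) * ?u k) - A N * ?u N = (\<Sum>k<N. A (Suc k) * dpow k s)" for N
    using summation_by_parts[of A ?u N] by (simp add: A_def dpow_def)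
  ultimately show ?thesis unfolding sums_def A_def by simp
qed

text \<open>Differencing gains a factor 1/n, so the series converges absolutely already for Re s > 0
  and the identity continues from Re s > 1.\<close>

lemma frac_dirichlet_sums:
  assumes "l > 0" "Re s > 0" "s \<noteq> 1"
  shows "(\<lambda>k. of_real (frac (real (Suc k) / real l)) * dpow k s) sums (zeta s * (1 / of_nat l - of_nat l powr (- s)))"
proof -
  let ?a = "\<lambda>k. complex_of_real (frac (real (Suc k) / real l))"
  have a: "cmod (?a k) \<le> 1" for k by (simp add: less_imp_le[OF frac_lt_1])
  have "(\<Sum>k. ?a k * dpow k s) = zeta s * (1 / of_nat l - of_nat l powr (- s))"
  proof (rule analytic_continuation_open[where s = "{s. Re s > 1}" and s' = "{s. Re s > 0} - {1}"
          and f = "\<lambda>s. \<Sum>k. ?a k * dpow k s" and g = "\<lambda>s. zeta s * (1 / of_nat l - of_nat l powr (- s))"])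
    show "{s. Re s > 1} \<noteq> {}" by (auto intro: exI[of _ 2])
    show "(\<lambda>s. \<Sum>k. ?a k * dpow k s) holomorphic_on {s. Re s > 0} - {1}"
      by (rule holomorphic_on_subset[OF holomorphic_suminf_dpow[OF a]]) auto
    show "(\<lambda>s. zeta s * (1 / of_nat l - of_nat l powr (- s))) holomorphic_on {s. Re s > 0} - {1}"
      by (intro holomorphic_intros holomorphic_on_subset[OF holomorphic_zeta]) (use assms in auto)
    show "(\<Sum>k. ?a k * dpow k z) = zeta z * (1 / of_nat l - of_nat l powr (- z))" if "z \<in> {s. Re s > 1}" for z
      using frac_dirichlet_sums_gt_1[OF assms(1)] that sums_iff by blast
  qed (use assms open_connected_right_half_plane_minus_1 in \<open>auto intro: open_halfspace_Re_gt\<close>)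
  with summable_sums[OF summable_dpow[of ?a, OF a assms(2)]] show ?thesis by simp
qed

section \<open>The sequence space\<close>

abbreviation weight :: "nat \<Rightarrow> real" where
  "weight n \<equiv> real n * (real n + 1)"

lemma coord_frac_seq: "coord (frac_seq l) n = of_real (frac (real n / real l))"
  by transfer simp

lemma coord_one_seq: "coord one_seq n = (if n = 0 then 0 else 1)"
  by transfer simp

lemma weighted_sums_norm: "(\<lambda>n. (cmod (coord a n))\<^sup>2 / weight n) sums (norm a)\<^sup>2"
proof -
  have nn: "0 \<le> (\<Sum>\<^sub>\<infinity>n\<in>{1..}. (cmod (coord a n))\<^sup>2 / weight n)"
    by (rule infsum_nonneg) simp
  have "((\<lambda>n. (cmod (coord a n))\<^sup>2 / weight n) has_sum (\<Sum>\<^sub>\<infinity>n\<in>{1..}. (cmod (coord a n))\<^sup>2 / weight n)) {1..}"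
    by (rule has_sum_infsum[OF coord_summable])
  also have "(\<Sum>\<^sub>\<infinity>n\<in>{1..}. (cmod (coord a n))\<^sup>2 / weight n) = (norm a)\<^sup>2"
    using nn by (simp add: norm_hseq_def hinner_self)
  finally have "((\<lambda>n. (cmod (coord a n))\<^sup>2 / weight n) has_sum (norm a)\<^sup>2) UNIV"
    by (rule has_sum_cong_neutral[THEN iffD1, rotated -1]) auto
  then show ?thesis by (rule has_sum_imp_sums)
qed

lemma summable_imp_summable_on_atLeast:
  fixes f :: "nat \<Rightarrow> real"
  assumes "summable f" "\<And>n. f n \<ge> 0"
  shows "f summable_on {1..}"
proof -
  have "f summable_on UNIV" using assms by (simp add: summable_on_UNIV_nonneg_real_iff)
  then show ?thesis by (rule summable_on_subset_banach) auto
qed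

lemma norm_cscale: "norm (cscale c a) = cmod c * norm a"
proof -
  have "(\<lambda>n. (cmod c)\<^sup>2 * ((cmod (coord a n))\<^sup>2 / weight n)) sums ((cmod c)\<^sup>2 * (norm a)\<^sup>2)"
    by (intro sums_mult weighted_sums_norm)
  then have "(\<lambda>n. (cmod (coord (cscale c a) n))\<^sup>2 / weight n) sums ((cmod c)\<^sup>2 * (norm a)\<^sup>2)"
    by (simp add: norm_mult power_mult_distrib)
  then have "(norm (cscale c a))\<^sup>2 = (cmod c * norm a)\<^sup>2"
    using sums_unique2[OF weighted_sums_norm] by (simp add: power_mult_distrib)
  then show ?thesis by (simp add: power2_eq_iff_nonneg)
qed

lemma subspace_closure_span: "hseq.subspace (closure (hseq.span B))"
proof (rule hseq.subspaceI)
  show "0 \<in> closure (hseq.span B)"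
    using closure_subset hseq.span_zero by blast
  fix x y assume x: "x \<in> closure (hseq.span B)"
  {
    assume y: "y \<in> closure (hseq.span B)"
    show "x + y \<in> closure (hseq.span B)"
    proof (rule closure_approachable[THEN iffD2], intro allI impI)
      fix e :: real assume "e > 0"
      then obtain x' y' where *: "x' \<in> hseq.span B" "dist x' x < e/2" "y' \<in> hseq.span B" "dist y' y < e/2"
        using x y unfolding closure_approachable by (meson half_gt_zero)
      then have "dist (x' + y') (x + y) < e"
        using dist_triangle_add[of x' y' x y] by linarith
      with * show "\<exists>z\<in>hseq.span B. dist z (x + y) < e"
        using hseq.span_add by blast
    qed
  }
  fix c
  show "cscale c x \<in> closure (hseq.span B)"
  proof (rule closure_approachable[THEN iffD2], intro allI impI)
    fix e :: real assume "e > 0"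
    then have "e / (cmod c + 1) > 0" by (intro divide_pos_pos) (auto intro: add_nonneg_pos)
    then obtain x' where *: "x' \<in> hseq.span B" "dist x' x < e / (cmod c + 1)"
      using x unfolding closure_approachable by blast
    have "dist (cscale c x') (cscale c x) = cmod c * dist x' x"
      by (simp add: dist_norm hseq.scale_right_diff_distrib[symmetric] norm_cscale)
    also have "\<dots> \<le> (cmod c + 1) * dist x' x" by (intro mult_right_mono) auto
    also have "\<dots> < e"
      using *(2) by (simp add: pos_less_divide_eq add_nonneg_pos mult.commute)
    finally show "\<exists>z\<in>hseq.span B. dist z (cscale c x) < e"
      using * hseq.span_scale by blast
  qed
qed

section \<open>Dilations\<close>

text \<open>Each value a m is repeated on a block of k indices n, and n >= m k together with n + 1
  >= m + 1 gives every one of them at least k times the denominator of m. A block therefore costs no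
  more than the original term; the block of m = 0 is harmless because a 0 = 0.\<close>

lemma dilation_partial_sum_le:
  fixes a :: "nat \<Rightarrow> complex"
  assumes "a 0 = 0" "summable (\<lambda>n. (cmod (a n))\<^sup>2 / weight n)" "k > 0"
  shows "(\<Sum>n<N. (cmod (a (n div k)))\<^sup>2 / weight n) \<le> (\<Sum>n. (cmod (a n))\<^sup>2 / weight n)"
proof -
  have "(\<Sum>n<N. (cmod (a (n div k)))\<^sup>2 / weight n) \<le> (\<Sum>n<N * k. (cmod (a (n div k)))\<^sup>2 / weight n)"
    using assms(3) by (intro sum_mono2) auto
  also have "\<dots> = (\<Sum>m<N. \<Sum>n = m * k..<m * k + k. (cmod (a (n div k)))\<^sup>2 / weight n)"
    by (rule sum.nat_group[symmetric])
  also have "\<dots> \<le> (\<Sum>m<N. (cmod (a m))\<^sup>2 / weight m)"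
  proof (rule sum_mono)
    fix m
    show "(\<Sum>n = m * k..<m * k + k. (cmod (a (n div k)))\<^sup>2 / weight n) \<le> (cmod (a m))\<^sup>2 / weight m"
    proof (cases "m = 0")
      case True
      then show ?thesis using assms(1) by simp
    next
      case False
      have "(\<Sum>n = m * k..<m * k + k. (cmod (a (n div k)))\<^sup>2 / weight n) \<le>
            (\<Sum>n = m * k..<m * k + k. (cmod (a m))\<^sup>2 / (real k * weight m))"
      proof (rule sum_mono)
        fix n assume n: "n \<in> {m * k..<m * k + k}"
        then have "n div k = m" by (intro div_nat_eqI) (auto simp: mult.commute)
        moreover have "real k * weight m \<le> weight n"
        proof -
          have mn: "m * k \<le> n" using n by auto
          have "m \<le> m * k" using assms(3) by (cases k) auto
          with mn have "m + 1 \<le> n + 1" by linarith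
          with mn have "(m * k) * (m + 1) \<le> n * (n + 1)" by (intro mult_mono) auto
          then have "k * (m * (m + 1)) \<le> n * (n + 1)" by (simp only: mult_ac)
          then have "real (k * (m * (m + 1))) \<le> real (n * (n + 1))" by (rule of_nat_mono)
          then show ?thesis by (simp add: algebra_simps)
        qed
        ultimately show "(cmod (a (n div k)))\<^sup>2 / weight n \<le> (cmod (a m))\<^sup>2 / (real k * weight m)"
          using False assms(3) by (intro frac_le) auto
      qed
      also have "\<dots> = (cmod (a m))\<^sup>2 / weight m" using assms(3) by simp
      finally show ?thesis .
    qed
  qed
  also have "\<dots> \<le> (\<Sum>n. (cmod (a n))\<^sup>2 / weight n)"
    by (rule sum_le_suminf[OF assms(2)]) auto
  finally show ?thesis .
qed

lemma summable_dilation: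
  fixes a :: "nat \<Rightarrow> complex"
  assumes "a 0 = 0" "summable (\<lambda>n. (cmod (a n))\<^sup>2 / weight n)" "k > 0"
  shows "summable (\<lambda>n. (cmod (a (n div k)))\<^sup>2 / weight n)"
  by (rule summableI_nonneg_bounded[OF _ dilation_partial_sum_le[OF assms]]) auto

lift_definition dilation :: "nat \<Rightarrow> hseq \<Rightarrow> hseq" is "\<lambda>k a n. a (n div k)"
proof -
  fix k and a :: "nat \<Rightarrow> complex"
  assume a: "a 0 = 0 \<and> (\<lambda>n. (cmod (a n))\<^sup>2 / weight n) summable_on {1..}"
  have "coord (Abs_hseq a) = a" by (rule Abs_hseq_inverse) (use a in simp)
  then have "summable (\<lambda>n. (cmod (a n))\<^sup>2 / weight n)"
    using weighted_sums_norm[of "Abs_hseq a"] by (simp add: sums_iff)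
  with a have "summable (\<lambda>n. (cmod (a (n div k)))\<^sup>2 / weight n)"
    \<comment> \<open>For k = 0 the convention n div 0 = 0 gives the zero sequence.\<close>
    by (cases "k = 0") (auto intro: summable_dilation)
  with a show "a (0 div k) = 0 \<and> (\<lambda>n. (cmod (a (n div k)))\<^sup>2 / weight n) summable_on {1..}"
    by (intro conjI summable_imp_summable_on_atLeast) auto
qed

lemma coord_dilation [simp]: "coord (dilation k a) n = coord a (n div k)"
  by transfer simp

lemma dilation_diff: "dilation k (a - b) = dilation k a - dilation k b"
  by (rule hseq_eqI) simp

lemma norm_dilation_le:
  assumes "k > 0"
  shows "norm (dilation k a) \<le> norm a"
proof -
  have sa: "summable (\<lambda>n. (cmod (coord a n))\<^sup>2 / weight n)" "(\<Sum>n. (cmod (coord a n))\<^sup>2 / weight n) = (norm a)\<^sup>2"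
    using weighted_sums_norm[of a] by (auto simp: sums_iff)
  have "(norm (dilation k a))\<^sup>2 \<le> (norm a)\<^sup>2"
    using dilation_partial_sum_le[of "coord a", OF _ sa(1) assms] weighted_sums_norm[of "dilation k a"]
    by (intro LIMSEQ_le_const2[OF weighted_sums_norm[of "dilation k a", unfolded sums_def]])
       (auto simp: sa(2))
  then show ?thesis by (rule power2_le_imp_le) simp
qed

text \<open>Rests on (n div k) div l = n div (k * l). The right side involves only the generators k
  * l and k, so dilations preserve the span.\<close>

lemma dilation_frac_seq:
  assumes "k > 0" "l > 0"
  shows "dilation k (frac_seq l) = frac_seq (k * l) - cscale (1 / of_nat l) (frac_seq k)"
proof (rule hseq_eqI)
  fix n
  have fr: "frac (real n / real l) = real n / real l - real (n div l)" for n l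
    by (simp add: frac_def floor_divide_of_nat_eq)
  have "frac (real (n div k) / real l) = frac (real n / real (k * l)) - 1 / real l * frac (real n / real k)"
    unfolding fr using assms by (simp add: div_mult2_eq field_simps)
  then show "coord (dilation k (frac_seq l)) n = coord (frac_seq (k * l) - cscale (1 / of_nat l) (frac_seq k)) n"
    unfolding coord_dilation coord_diff coord_cscale coord_frac_seq
    by (simp only: of_real_diff of_real_mult of_real_divide of_real_1 of_real_of_nat_eq)
qed

lemma dilation_closure_span_frac_seq:
  assumes "k > 0" "x \<in> closure (hseq.span (frac_seq ` {1..}))"
  shows "dilation k x \<in> closure (hseq.span (frac_seq ` {1..}))"
proof -
  have span: "dilation k y \<in> hseq.span (frac_seq ` {1..})" if "y \<in> hseq.span (frac_seq ` {1..})" for y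
    using that
  proof (induction rule: hseq.span_induct_alt)
    case base
    have "dilation k 0 = 0" by (rule hseq_eqI) simp
    then show ?case by (simp add: hseq.span_zero)
  next
    case (step c x y)
    then obtain l where l: "l \<ge> 1" "x = frac_seq l" by auto
    have "dilation k (cscale c x + y) = cscale c (dilation k x) + dilation k y"
      by (rule hseq_eqI) simp
    moreover have "dilation k x \<in> hseq.span (frac_seq ` {1..})"
    proof -
      have "l > 0" "k * l \<in> {1..}" "k \<in> {1..}" using l(1) assms(1) by auto
      then show ?thesis
        unfolding l(2) dilation_frac_seq[OF assms(1) \<open>l > 0\<close>]
        by (intro hseq.span_diff hseq.span_scale) (auto intro: hseq.span_base)
    qed
    ultimately show ?case using step by (auto intro!: hseq.span_add hseq.span_scale)
  qed
  show ?thesis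
  proof (rule closure_approachable[THEN iffD2], intro allI impI)
    fix e :: real assume "e > 0"
    then obtain y where y: "y \<in> hseq.span (frac_seq ` {1..})" "dist y x < e"
      using assms(2) unfolding closure_approachable by blast
    have "dist (dilation k y) (dilation k x) \<le> dist y x"
      unfolding dist_norm dilation_diff[symmetric] by (rule norm_dilation_le[OF assms(1)])
    with y span show "\<exists>z\<in>hseq.span (frac_seq ` {1..}). dist z (dilation k x) < e"
      by (intro bexI[of _ "dilation k y"]) auto
  qed
qed

text \<open>Differences of consecutive dilations of \<open>one_seq\<close> are the coordinate unit
  vectors, so every truncation \<open>p N\<close> of x lies in the closed span.\<close>

lemma total_of_one_seq:
  assumes "one_seq \<in> closure (hseq.span (frac_seq ` {1..}))"
  shows "closure (hseq.span (frac_seq ` {1..})) = UNIV"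
proof -
  let ?C = "closure (hseq.span (frac_seq ` {1..}))"
  have "x \<in> ?C" for x
  proof -
    define p where "p = (\<lambda>N. \<Sum>k\<in>{1..<N}. cscale (coord x k) (dilation k one_seq - dilation (Suc k) one_seq))"
    have pC: "p N \<in> ?C" for N
      unfolding p_def
      by (intro hseq.subspace_sum[OF subspace_closure_span] hseq.subspace_scale[OF subspace_closure_span]
            hseq.subspace_diff[OF subspace_closure_span] dilation_closure_span_frac_seq assms) auto
    have pc: "coord (p N) n = (if n < N then coord x n else 0)" for N n
    proof -
      have cs: "coord (sum f A) n = (\<Sum>k\<in>A. coord (f k) n)" if "finite A" for f :: "nat \<Rightarrow> hseq" and A
        using that by induction auto
      have "coord (p N) n = (\<Sum>k\<in>{1..<N}. coord x k * (if k = n then 1 else 0))"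
        unfolding p_def cs[OF finite_atLeastLessThan]
      proof (rule sum.cong[OF refl])
        have dil: "coord (dilation j one_seq) n = (if n < j then 0 else 1)" if "j > 0" for j
          using that div_eq_0_iff[of n j] by (simp add: coord_one_seq)
        fix k assume "k \<in> {1..<N}"
        then have "k > 0" by simp
        then show "coord (cscale (coord x k) (dilation k one_seq - dilation (Suc k) one_seq)) n =
            coord x k * (if k = n then 1 else 0)"
          unfolding coord_cscale coord_diff by (subst (1 2) dil) auto
      qed
      also have "\<dots> = (if n < N then coord x n else 0)"
        by (cases "n = 0") (auto simp: if_distrib[of "\<lambda>z. _ * z"] sum.delta cong: if_cong)
      finally show ?thesis .
    qed
    let ?f = "\<lambda>n. (cmod (coord x n))\<^sup>2 / weight n"
    have sf: "summable ?f" using weighted_sums_norm[of x] by (simp add: sums_iff)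
    have "x \<in> closure ?C"
    proof (rule closure_approachable[THEN iffD2], intro allI impI)
      fix e :: real assume "e > 0"
      then obtain N where "norm (\<Sum>i. ?f (i + N)) < e\<^sup>2"
        using suminf_exist_split[OF _ sf, of "e\<^sup>2"] by (auto simp: power2_eq_square)
      moreover have "(norm (x - p N))\<^sup>2 = (\<Sum>i. ?f (i + N))"
      proof -
        let ?g = "\<lambda>n. (cmod (coord (x - p N) n))\<^sup>2 / weight n"
        have g: "summable ?g" "suminf ?g = (norm (x - p N))\<^sup>2"
          using weighted_sums_norm[of "x - p N"] by (auto simp: sums_iff)
        have "suminf ?g = (\<Sum>i. ?g (i + N)) + (\<Sum>i<N. ?g i)"
          by (rule suminf_split_initial_segment[OF g(1)])
        moreover have "(\<Sum>i<N. ?g i) = 0" by (rule sum.neutral) (simp add: pc)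
        moreover have "(\<lambda>i. ?g (i + N)) = (\<lambda>i. ?f (i + N))"
          by (rule ext) (simp only: coord_diff pc, simp)
        ultimately show ?thesis using g(2) by (simp only: add_0_right)
      qed
      ultimately have "(norm (x - p N))\<^sup>2 < e\<^sup>2" by simp
      then have "dist (p N) x < e"
        using \<open>e > 0\<close> by (simp add: dist_norm norm_minus_commute power2_less_imp_less)
      then show "\<exists>y\<in>?C. dist y x < e" using pC by blast
    qed
    then show ?thesis by simp
  qed
  then show ?thesis by blast
qed

section \<open>Zeros of the zeta function as bounded functionals\<close>

text \<open>Square summability against the dual weight, which makes the pairing with
  \<open>dpow\<close> a bounded functional. The terms behave like n^(-2 Re s), and this is where Re
  s > 1/2 enters.\<close>

lemma summable_weight_dpow:
  assumes "Re s > 1/2"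
  shows "summable (\<lambda>k. (cmod (dpow k s))\<^sup>2 * weight (Suc k))"
proof (rule summable_comparison_test'[where N = 0])
  show "summable (\<lambda>k. 2 * (cmod s)\<^sup>2 * real (Suc k) powr (- (2 * Re s)))"
    by (intro summable_mult summable_Suc_powr) (use assms in auto)
  fix k
  have w: "weight (Suc k) \<le> 2 * (real (Suc k))\<^sup>2"
    by (simp add: power2_eq_square algebra_simps)
  have "(cmod (dpow k s))\<^sup>2 * weight (Suc k) \<le> (cmod s * real (Suc k) powr (- Re s - 1))\<^sup>2 * (2 * (real (Suc k))\<^sup>2)"
    by (rule mult_mono[OF power_mono[OF norm_dpow_le] w]) (use assms in auto)
  also have "\<dots> = 2 * (cmod s)\<^sup>2 * ((real (Suc k) powr (- Re s - 1)) powr 2 * real (Suc k) powr 2)"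
    by (simp add: power_mult_distrib powr_numeral del: of_nat_Suc powr_powr)
  also have "(real (Suc k) powr (- Re s - 1)) powr 2 * real (Suc k) powr 2 = real (Suc k) powr (- (2 * Re s))"
  proof -
    have "(- Re s - 1) * 2 + 2 = - (2 * Re s)" by simp
    then show ?thesis by (simp only: powr_powr powr_add[symmetric])
  qed
  finally show "norm ((cmod (dpow k s))\<^sup>2 * weight (Suc k)) \<le> 2 * (cmod s)\<^sup>2 * real (Suc k) powr (- (2 * Re s))"
    by simp
qed

lemma zeta_nonzero_of_one_seq:
  assumes one: "one_seq \<in> closure (hseq.span (frac_seq ` {1..}))"
    and s: "Re s > 1/2" "s \<noteq> 1"
  shows "zeta s \<noteq> 0"
proof
  assume z: "zeta s = 0"
  define Q where "Q = (\<Sum>k. (cmod (dpow k s))\<^sup>2 * weight (Suc k))"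
  have sQ: "summable (\<lambda>k. (cmod (dpow k s))\<^sup>2 * weight (Suc k))"
    by (rule summable_weight_dpow[OF s(1)])
  have Q0: "Q \<ge> 0" unfolding Q_def by (rule suminf_nonneg[OF sQ]) auto
  have ns: "(\<lambda>k. (cmod (coord a (Suc k)))\<^sup>2 / weight (Suc k)) sums (norm a)\<^sup>2" for a
    using weighted_sums_norm[of a] by (subst sums_Suc_iff) auto
  \<comment> \<open>A weighted arithmetic-geometric mean inequality in place of Cauchy-Schwarz: L =
    1 gives convergence of the series, and a suitable L later gives the continuity estimate.\<close>
  have amgm: "cmod (coord a (Suc k) * dpow k s) \<le>
      (L * ((cmod (coord a (Suc k)))\<^sup>2 / weight (Suc k)) + 1 / L * ((cmod (dpow k s))\<^sup>2 * weight (Suc k))) / 2"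
    if "L > 0" for L a k
  proof -
    define x y w where "x = cmod (coord a (Suc k))" and "y = cmod (dpow k s)" and "w = weight (Suc k)"
    have w: "w > 0" by (simp add: w_def)
    have "0 \<le> (L * x - w * y)\<^sup>2 / (L * w)" using that w by simp
    also have "\<dots> = ((L * x)\<^sup>2 - 2 * (L * x) * (w * y) + (w * y)\<^sup>2) / (L * w)"
      by (simp only: power2_diff) simp
    also have "\<dots> = L * (x\<^sup>2 / w) + 1 / L * (y\<^sup>2 * w) - 2 * (x * y)"
      using that w by (simp add: diff_divide_distrib add_divide_distrib power2_eq_square mult_ac)
    finally have "x * y \<le> (L * (x\<^sup>2 / w) + 1 / L * (y\<^sup>2 * w)) / 2" by simp
    then show ?thesis by (simp only: x_def y_def w_def norm_mult)
  qed
  have sm: "summable (\<lambda>k. coord a (Suc k) * dpow k s)" for a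
  proof (rule summable_comparison_test'[where N = 0])
    show "summable (\<lambda>k. (1 * ((cmod (coord a (Suc k)))\<^sup>2 / weight (Suc k)) + 1 / 1 * ((cmod (dpow k s))\<^sup>2 * weight (Suc k))) / 2)"
      by (intro summable_divide summable_add summable_mult sQ sums_summable[OF ns])
    show "cmod (coord a (Suc k) * dpow k s) \<le> (1 * ((cmod (coord a (Suc k)))\<^sup>2 / weight (Suc k)) + 1 / 1 * ((cmod (dpow k s))\<^sup>2 * weight (Suc k))) / 2" for k
      by (rule amgm) simp
  qed
  define \<phi> where "\<phi> = (\<lambda>a. \<Sum>k. coord a (Suc k) * dpow k s)"
  have bd: "cmod (\<phi> a) \<le> (L * (norm a)\<^sup>2 + 1 / L * Q) / 2" if L: "L > 0" for L a
  proof -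
    have "(\<lambda>k. (L * ((cmod (coord a (Suc k)))\<^sup>2 / weight (Suc k)) + 1 / L * ((cmod (dpow k s))\<^sup>2 * weight (Suc k))) / 2)
        sums ((L * (norm a)\<^sup>2 + 1 / L * Q) / 2)"
      unfolding Q_def by (intro sums_divide sums_add sums_mult ns summable_sums sQ)
    note S = this
    have "cmod (\<phi> a) \<le> (\<Sum>k. (L * ((cmod (coord a (Suc k)))\<^sup>2 / weight (Suc k)) + 1 / L * ((cmod (dpow k s))\<^sup>2 * weight (Suc k))) / 2)"
      unfolding \<phi>_def by (rule norm_suminf_le[OF amgm[OF L] sums_summable[OF S]])
    also have "\<dots> = (L * (norm a)\<^sup>2 + 1 / L * Q) / 2"
      by (rule sums_unique[OF S, symmetric])
    finally show ?thesis .
  qed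
  have add: "\<phi> (a - b) = \<phi> a - \<phi> b" for a b
    unfolding \<phi>_def by (simp add: left_diff_distrib suminf_diff[OF sm sm])
  have span0: "\<phi> a = 0" if "a \<in> hseq.span (frac_seq ` {1..})" for a
    using that
  proof (induction rule: hseq.span_induct_alt)
    case base
    then show ?case by (simp add: \<phi>_def)
  next
    case (step c x y)
    then obtain l where l: "l \<ge> 1" "x = frac_seq l" by auto
    have "\<phi> x = 0"
      using frac_dirichlet_sums[of l s] l s z by (simp add: \<phi>_def coord_frac_seq sums_iff)
    moreover have "\<phi> (cscale c x + y) = c * \<phi> x + \<phi> y"
      unfolding \<phi>_def using suminf_add[OF summable_mult[OF sm[of x], of c] sm[of y]] suminf_mult[OF sm[of x], of c]
      by (simp add: distrib_right mult.assoc)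
    ultimately show ?case using step by simp
  qed
  have "\<phi> one_seq = 1"
  proof -
    have "(\<lambda>k. of_nat (Suc k) powr (- s) - of_nat (Suc (Suc k)) powr (- s)) sums (of_nat (Suc 0) powr (- s) - 0)"
      by (rule telescope_sums'[OF tendsto_nat_powr_neg]) (use s in simp)
    then show ?thesis by (simp add: \<phi>_def coord_one_seq dpow_def sums_iff)
  qed
  \<comment> \<open>With L = Q + 1 in \<open>bd\<close>, this radius makes the two terms at most 1/2
    and 1, so the functional of the difference is at most 3/4; but it equals 1 because
    \<open>\<phi>\<close> vanishes on the span.\<close>
  moreover obtain a where a: "a \<in> hseq.span (frac_seq ` {1..})" "dist a one_seq < sqrt (1 / (2 * (Q + 1)))"
    using one Q0 unfolding closure_approachable by (metis add_nonneg_pos divide_pos_pos mult_pos_pos real_sqrt_gt_zero zero_less_numeral zero_less_one)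
  moreover have "cmod (\<phi> (one_seq - a)) < 1"
  proof -
    have "(norm (one_seq - a))\<^sup>2 \<le> 1 / (2 * (Q + 1))"
      using a(2) Q0 real_less_rsqrt sqrt_ge_absD[of "norm (one_seq - a)"] by (simp add: dist_norm norm_minus_commute)
    then have "(Q + 1) * (norm (one_seq - a))\<^sup>2 \<le> 1/2" using Q0 by (simp add: field_simps)
    moreover have "1 / (Q + 1) * Q \<le> 1" using Q0 by (simp add: field_simps)
    moreover have "c < 1" if "c \<le> (x + y) / 2" "x \<le> 1/2" "y \<le> 1" for c x y :: real
      using that by (simp add: field_simps)
    ultimately show ?thesis using bd[OF add_nonneg_pos[OF Q0 zero_less_one], of "one_seq - a"] by blast
  qed
  ultimately show False using span0[OF a(1)] by (simp add: add)
qed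

section \<open>Growth under the Riemann hypothesis\<close>

text \<open>Going through \<open>zeta_reg\<close> makes the pole of zeta at 1 an honest zero, so the
  function is holomorphic across 1.\<close>

definition zeta_inv :: "complex \<Rightarrow> complex" where
  "zeta_inv s = (s - 1) / zeta_reg s"

lemma zeta_inv_eq: "Re s > 0 \<Longrightarrow> s \<noteq> 1 \<Longrightarrow> zeta_inv s = 1 / zeta s"
  by (simp add: zeta_inv_def zeta_reg_eq)

lemma zeta_inv_1 [simp]: "zeta_inv 1 = 0"
  by (simp add: zeta_inv_def)

locale riemann_hypothesis =
  assumes zeta_nonzero: "Re s > 1/2 \<Longrightarrow> s \<noteq> 1 \<Longrightarrow> zeta s \<noteq> 0"
begin

lemma zeta_reg_nonzero:
  assumes "Re s > 1/2"
  shows "zeta_reg s \<noteq> 0"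
  using assms zeta_nonzero[of s] zeta_reg_1 zeta_reg_eq[of s] by (cases "s = 1") auto

lemma holomorphic_zeta_inv: "zeta_inv holomorphic_on {s. Re s > 1/2}"
  unfolding zeta_inv_def[abs_def]
  by (intro holomorphic_intros holomorphic_on_subset[OF holomorphic_zeta_reg])
     (use zeta_reg_nonzero in auto)

text \<open>With L = ln t, a branch of zeta^(1/L) on a disc around 4 + it is bounded independently
  of t, and its modulus tends to 1 where Re s >= 3. By \<open>near_unimodular_propagation\<close> it
  is then close to 1 on every smaller concentric disc, and raising to the power L turns exp
  (\<plusminus> \<epsilon>) into t^(\<plusminus> \<epsilon>).\<close>

lemma zeta_subpolynomial:
  assumes "\<delta> > 0" "\<epsilon> > 0"
  obtains T where "T \<ge> 5"
    "\<And>s. \<lbrakk>Re s \<ge> 1/2 + \<delta>; Re s \<le> 3; \<bar>Im s\<bar> \<ge> T\<rbrakk> \<Longrightarrow>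
       \<bar>Im s\<bar> powr (- \<epsilon>) \<le> cmod (zeta s) \<and> cmod (zeta s) \<le> \<bar>Im s\<bar> powr \<epsilon>"
proof -
  obtain C where C: "C \<ge> 1" "\<And>s. \<lbrakk>Re s \<ge> 1/4; Re s \<le> 8; \<bar>Im s\<bar> \<ge> 1\<rbrakk> \<Longrightarrow> cmod (zeta s) \<le> C * \<bar>Im s\<bar>"
    using norm_zeta_le_linear by blast
  \<comment> \<open>Chosen so that 1 - e and 1 + e both lie between exp (- \<epsilon>) and exp
    \<epsilon>.\<close>
  define e where "e = 1 - exp (- \<epsilon>)"
  have e: "e > 0" "1 + e \<le> exp \<epsilon>" "1 - e = exp (- \<epsilon>)"
  proof -
    show "e > 0" using assms by (simp add: e_def)
    have "exp \<epsilon> + inverse (exp \<epsilon>) \<ge> 2"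
      using zero_le_power2[of "exp \<epsilon> - 1"] exp_gt_zero[of \<epsilon>]
      by (simp add: field_simps power2_eq_square)
    then show "1 + e \<le> exp \<epsilon>" by (simp add: e_def exp_minus)
  qed (simp add: e_def)
  \<comment> \<open>The disc of radius 7/2 about 4 is tangent to Re z = 1/2, the shrunken one
    reaches exactly to 1/2 + \<delta>, and the unit ball lies in Re z >= 3. After rotation-free
    vertical translation all of them are independent of t.\<close>
  obtain d where d: "d > 0" and near:
    "\<And>u x. \<lbrakk>u holomorphic_on ball 4 (7/2); \<And>z. z \<in> ball 4 (7/2) \<Longrightarrow> cmod (u z) \<le> exp (1 + ln (2 * C));
       \<And>z. z \<in> ball 4 1 \<Longrightarrow> \<bar>cmod (u z) - 1\<bar> \<le> d; x \<in> cball 4 (7/2 - \<delta>)\<rbrakk> \<Longrightarrow> \<bar>cmod (u x) - 1\<bar> \<le> e"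
  proof (rule near_unimodular_propagation[of "cball (4::complex) (7/2 - \<delta>)" "ball 4 (7/2)" 1 4 e "exp (1 + ln (2 * C))"])
    show "cball (4::complex) (7/2 - \<delta>) \<subseteq> ball 4 (7/2)" using assms by (auto simp: dist_norm)
  qed (use e in auto)
  \<comment> \<open>For L >= L0 any number between 1/2 and 2 has its (1/L)-th power within d of 1.
    The 5 in T keeps the translated disc at height at least 1, away from the pole.\<close>
  define L0 where "L0 = max 1 (ln 2 / ln (1 + d))"
  define T where "T = max 5 (exp L0)"
  show ?thesis
  proof (rule that[of T])
    show "T \<ge> 5" by (simp add: T_def)
    fix s assume s: "Re s \<ge> 1/2 + \<delta>" "Re s \<le> 3" "\<bar>Im s\<bar> \<ge> T"
    define t where "t = \<bar>Im s\<bar>"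
    define L where "L = ln t"
    have t: "t \<ge> 5" "t \<ge> exp L0" using s by (auto simp: t_def T_def)
    then have L: "L \<ge> L0" unfolding L_def by (subst ln_ge_iff) auto
    then have L1: "L \<ge> 1" by (simp add: L0_def)
    have texp: "t = exp L" using t by (simp add: L_def)
    let ?f = "\<lambda>z. zeta (z + \<i> * of_real (Im s))"
    have Re_z: "Re z > 1/2 \<and> Re z < 15/2 \<and> \<bar>Im z\<bar> < 7/2" if "z \<in> ball (4::complex) (7/2)" for z
      using that abs_Re_le_cmod[of "4 - z"] abs_Im_le_cmod[of "4 - z"] by (auto simp: dist_norm)
    have Im_z: "\<bar>Im (z + \<i> * of_real (Im s))\<bar> \<ge> 1 \<and> \<bar>Im (z + \<i> * of_real (Im s))\<bar> \<le> 2 * t"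
      if "z \<in> ball (4::complex) (7/2)" for z
      using Re_z[OF that] t unfolding t_def by auto
    have ne1: "z + \<i> * of_real (Im s) \<noteq> 1" if "z \<in> ball (4::complex) (7/2)" for z
      using Im_z[OF that] by (auto simp: complex_eq_iff)
    have "?f holomorphic_on ball 4 (7/2)"
      by (rule holomorphic_on_compose_gen[OF _ holomorphic_zeta, unfolded o_def])
         (use ne1 in \<open>auto intro!: holomorphic_intros\<close>)
    moreover have "?f z \<noteq> 0" if "z \<in> ball (4::complex) (7/2)" for z
      using zeta_nonzero[of "z + \<i> * of_real (Im s)"] Re_z[OF that] ne1[OF that] by simp
    ultimately obtain u where u: "u holomorphic_on ball 4 (7/2)"
      "\<And>z. z \<in> ball 4 (7/2) \<Longrightarrow> u z \<noteq> 0 \<and> cmod (u z) = cmod (?f z) powr (1 / L)"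
      using holomorphic_real_power[of ?f 4 "7/2" "1 / L"] by blast
    have "\<bar>cmod (u (of_real (Re s))) - 1\<bar> \<le> e"
    proof (rule near[OF u(1)])
      fix z :: complex assume z: "z \<in> ball 4 (7/2)"
      have "cmod (?f z) \<le> C * \<bar>Im (z + \<i> * of_real (Im s))\<bar>"
        by (rule C(2)) (use Re_z[OF z] Im_z[OF z] in auto)
      also have "\<dots> \<le> C * (2 * t)" using Im_z[OF z] C(1) by (intro mult_left_mono) auto
      finally have "cmod (?f z) powr (1 / L) \<le> (2 * C * t) powr (1 / L)"
        using L1 by (intro powr_mono2) (auto simp: mult_ac)
      also have "\<dots> = exp (ln (2 * C * t) / L)" using C(1) t by (simp add: powr_def)
      also have "ln (2 * C * t) / L = 1 + ln (2 * C) / L"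
        using C(1) t L1 by (simp add: ln_mult L_def add_divide_distrib)
      also have "ln (2 * C) / L \<le> ln (2 * C)"
        using C(1) L1 divide_left_mono[of 1 L "ln (2 * C)"] by simp
      finally show "cmod (u z) \<le> exp (1 + ln (2 * C))"
        using u(2)[OF z] by simp
    next
      fix z :: complex assume z: "z \<in> ball 4 1"
      then have zb: "z \<in> ball 4 (7/2)" by auto
      have "Re (z + \<i> * of_real (Im s)) \<ge> 3"
        using z abs_Re_le_cmod[of "4 - z"] by (auto simp: dist_norm)
      from norm_zeta_minus_1_le[OF this] have fz: "1/2 \<le> cmod (?f z)" "cmod (?f z) \<le> 2"
        using norm_triangle_ineq3[of "?f z" 1] by auto
      have "L \<ge> ln 2 / ln (1 + d)" using L by (simp add: L0_def)
      then have q: "ln 2 / L \<le> ln (1 + d)" using d L1 by (simp add: field_simps)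
      have up: "cmod (?f z) powr (1 / L) \<le> 1 + d"
      proof -
        have "cmod (?f z) powr (1 / L) \<le> 2 powr (1 / L)" using fz L1 by (intro powr_mono2) auto
        also have "\<dots> = exp (ln 2 / L)" by (simp add: powr_def)
        also have "\<dots> \<le> 1 + d" using q d by (subst ln_ge_iff[symmetric]) auto
        finally show ?thesis .
      qed
      have "1 - d \<le> inverse (1 + d)" using d by (simp add: field_simps power2_eq_square)
      also have "\<dots> \<le> inverse (exp (ln 2 / L))"
        using q d by (intro le_imp_inverse_le) (auto simp: ln_ge_iff[symmetric])
      also have "\<dots> = (1/2) powr (1 / L)" by (simp add: powr_def exp_minus ln_div)
      also have "\<dots> \<le> cmod (?f z) powr (1 / L)" using fz L1 by (intro powr_mono2) auto
      finally show "\<bar>cmod (u z) - 1\<bar> \<le> d" using up u(2)[OF zb] by auto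
    next
      have "cmod (4 - complex_of_real (Re s)) = \<bar>4 - Re s\<bar>"
        by (metis norm_of_real of_real_diff of_real_numeral)
      then show "complex_of_real (Re s) \<in> cball 4 (7/2 - \<delta>)" using s by (simp add: dist_norm)
    qed
    moreover have "complex_of_real (Re s) \<in> ball 4 (7/2)"
    proof -
      have "cmod (4 - complex_of_real (Re s)) = \<bar>4 - Re s\<bar>"
        by (metis norm_of_real of_real_diff of_real_numeral)
      then show ?thesis using s assms by (simp add: dist_norm)
    qed
    moreover have "complex_of_real (Re s) + \<i> * of_real (Im s) = s" by (simp add: complex_eq_iff)
    ultimately have bd: "exp (- \<epsilon>) \<le> cmod (zeta s) powr (1 / L)" "cmod (zeta s) powr (1 / L) \<le> exp \<epsilon>"
      using u(2)[of "of_real (Re s)"] e by auto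
    have pw: "(cmod (zeta s) powr (1 / L)) powr L = cmod (zeta s)"
      using L1 by (simp add: powr_powr)
    have "exp (- \<epsilon>) powr L \<le> cmod (zeta s)" "cmod (zeta s) \<le> exp \<epsilon> powr L"
      using powr_mono2[OF _ _ bd(1), of L] powr_mono2[OF _ _ bd(2), of L] L1 by (simp_all add: pw)
    then show "\<bar>Im s\<bar> powr (- \<epsilon>) \<le> cmod (zeta s) \<and> cmod (zeta s) \<le> \<bar>Im s\<bar> powr \<epsilon>"
      unfolding t_def[symmetric] texp by (simp add: powr_def mult.commute)
  qed
qed

lemma zeta_inv_bound:
  assumes "\<delta> > 0" "\<epsilon> > 0"
  obtains C where "C \<ge> 0" "\<And>s. Re s \<ge> 1/2 + \<delta> \<Longrightarrow> cmod (zeta_inv s) \<le> C * (1 + \<bar>Im s\<bar>) powr \<epsilon>"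
proof -
  obtain T where T: "T \<ge> 5" "\<And>s. \<lbrakk>Re s \<ge> 1/2 + \<delta>; Re s \<le> 3; \<bar>Im s\<bar> \<ge> T\<rbrakk> \<Longrightarrow>
       \<bar>Im s\<bar> powr (- \<epsilon>) \<le> cmod (zeta s) \<and> cmod (zeta s) \<le> \<bar>Im s\<bar> powr \<epsilon>"
    using zeta_subpolynomial[OF assms] by blast
  \<comment> \<open>Outside this box the half-plane consists of Re s >= 3, where |zeta| >= 1/2, and
    of the strip at heights covered by the subpolynomial bound.\<close>
  define K where "K = cbox (Complex (1/2 + \<delta>) (- T)) (Complex 3 T)"
  have "continuous_on K zeta_inv"
    by (rule continuous_on_subset[OF holomorphic_on_imp_continuous_on[OF holomorphic_zeta_inv]])
       (use assms in \<open>auto simp: K_def in_cbox_complex_iff\<close>)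
  then have "bounded (zeta_inv ` K)"
    by (intro compact_imp_bounded compact_continuous_image) (auto simp: K_def)
  then obtain B where B: "\<And>s. s \<in> K \<Longrightarrow> cmod (zeta_inv s) \<le> B"
    unfolding bounded_iff by blast
  show ?thesis
  proof (rule that[of "2 + \<bar>B\<bar>"])
    fix s assume s: "Re s \<ge> 1/2 + \<delta>"
    have p1: "(1 + \<bar>Im s\<bar>) powr \<epsilon> \<ge> 1" using assms by (intro ge_one_powr_ge_zero) auto
    have "cmod (zeta_inv s) \<le> max (2 + \<bar>B\<bar>) (\<bar>Im s\<bar> powr \<epsilon>)"
    proof (cases "s \<in> K")
      case True
      then show ?thesis using B[OF True] by auto
    next
      case False
      show ?thesis
      proof (cases "Re s \<ge> 3")
        case True
        then have "1/2 \<le> cmod (zeta s)" using norm_zeta_minus_1_le[OF True] norm_triangle_ineq3[of "zeta s" 1] by auto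
        moreover have "s \<noteq> 1" "Re s > 0" using True by auto
        ultimately have "cmod (zeta_inv s) \<le> 2"
          by (simp add: zeta_inv_eq norm_divide divide_le_eq)
        then show ?thesis by auto
      next
        case R: False
        with False s have t: "\<bar>Im s\<bar> \<ge> T" by (auto simp: K_def in_cbox_complex_iff)
        then have "s \<noteq> 1" "Re s > 0" using T(1) s assms by auto
        then have "cmod (zeta_inv s) = inverse (cmod (zeta s))" by (simp add: zeta_inv_eq norm_divide inverse_eq_divide)
        also have "\<dots> \<le> inverse (\<bar>Im s\<bar> powr (- \<epsilon>))"
          using T(2)[OF s _ t] R T(1) t by (intro le_imp_inverse_le) auto
        finally show ?thesis by (auto simp: powr_minus)
      qed
    qed
    also have "\<dots> \<le> (2 + \<bar>B\<bar>) * (1 + \<bar>Im s\<bar>) powr \<epsilon>"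
    proof (rule max.boundedI)
      show "2 + \<bar>B\<bar> \<le> (2 + \<bar>B\<bar>) * (1 + \<bar>Im s\<bar>) powr \<epsilon>"
        using p1 mult_left_mono[OF p1, of "2 + \<bar>B\<bar>"] by simp
      have "\<bar>Im s\<bar> powr \<epsilon> \<le> (1 + \<bar>Im s\<bar>) powr \<epsilon>" using assms by (intro powr_mono2) auto
      also have "\<dots> \<le> (2 + \<bar>B\<bar>) * (1 + \<bar>Im s\<bar>) powr \<epsilon>"
        using mult_right_mono[of 1 "2 + \<bar>B\<bar>" "(1 + \<bar>Im s\<bar>) powr \<epsilon>"] by simp
      finally show "\<bar>Im s\<bar> powr \<epsilon> \<le> (2 + \<bar>B\<bar>) * (1 + \<bar>Im s\<bar>) powr \<epsilon>" .
    qed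
    finally show "cmod (zeta_inv s) \<le> (2 + \<bar>B\<bar>) * (1 + \<bar>Im s\<bar>) powr \<epsilon>" .
  qed simp
qed

end

section \<open>Comparison of zeta on the critical line with zeta just to its right\<close>

context riemann_hypothesis
begin

text \<open>After dividing out the zeros \<open>\<rho>\<close> near the critical line, which satisfy
  \<open>cmod (s - \<rho>) \<le> cmod (s + \<delta> - \<rho>)\<close> because \<open>Re \<rho> \<le> 1/2 = Re s\<close>, the remaining zero-free
  function has slowly varying modulus.\<close>

lemma zeta_shift_bound_large:
  assumes "\<eta> > 0"
  obtains T \<delta>0 where "T \<ge> 5" "0 < \<delta>0" "\<delta>0 \<le> 1/32"
    "\<And>t \<delta>. \<lbrakk>\<bar>t\<bar> \<ge> T; 0 < \<delta>; \<delta> \<le> \<delta>0\<rbrakk> \<Longrightarrow>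
       cmod (zeta (Complex (1/2) t)) \<le> \<bar>t\<bar> powr \<eta> * cmod (zeta (Complex (1/2 + \<delta>) t))"
proof -
  obtain C where C: "C \<ge> 1" "\<And>s. \<lbrakk>Re s \<ge> 1/4; Re s \<le> 8; \<bar>Im s\<bar> \<ge> 1\<rbrakk> \<Longrightarrow> cmod (zeta s) \<le> C * \<bar>Im s\<bar>"
    using norm_zeta_le_linear by blast
  obtain T where T: "T \<ge> 5" "\<And>s. \<lbrakk>Re s \<ge> 1/2 + 1/16; Re s \<le> 3; \<bar>Im s\<bar> \<ge> T\<rbrakk> \<Longrightarrow>
       \<bar>Im s\<bar> powr (- 1) \<le> cmod (zeta s) \<and> cmod (zeta s) \<le> \<bar>Im s\<bar> powr 1"
    using zeta_subpolynomial[of "1/16" 1] by auto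
  \<comment> \<open>The centre lies 1/16 to the right of the line, where zeta is bounded from below,
    and the radius 1/8 still reaches across the line, so that 1/2 and 1/2 + \<delta> are inside. The
    outer radius 5/16 used below stops at Re z = 1/4, the edge of the linear bound.\<close>
  define z0 :: complex where "z0 = of_real (9/16)"
  obtain d where d: "d > 0" and slow:
    "\<And>u x y. \<lbrakk>u holomorphic_on ball z0 (1/8);
       \<And>z. z \<in> ball z0 (1/8) \<Longrightarrow> u z \<noteq> 0 \<and> cmod (u z) \<le> exp (1 + ln (2 * C));
       exp (- 1) \<le> cmod (u z0); x \<in> cball z0 (3/32); y \<in> cball z0 (3/32); dist x y < d\<rbrakk>
       \<Longrightarrow> cmod (u x) \<le> (1 + (exp \<eta> - 1)) * cmod (u y)"
    by (rule zero_free_ratio_bound[of "1/8" "cball z0 (3/32)" z0 "exp (- 1)" "exp \<eta> - 1" "exp (1 + ln (2 * C))"])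
       (use assms in auto)
  show ?thesis
  proof (rule that[OF T(1), of "min (1/32) (d / 2)"])
    show "0 < min (1/32) (d / 2)" "min (1/32) (d / 2) \<le> 1/32" using d by auto
    fix t \<delta> :: real assume t: "\<bar>t\<bar> \<ge> T" and \<delta>: "0 < \<delta>" "\<delta> \<le> min (1/32) (d / 2)"
    define L where "L = ln \<bar>t\<bar>"
    have t5: "\<bar>t\<bar> \<ge> 5" using t T(1) by linarith
    have "exp 1 \<le> \<bar>t\<bar>" using exp_le t5 by linarith
    then have L1: "L \<ge> 1" unfolding L_def using t5 by (subst ln_ge_iff) auto
    have texp: "\<bar>t\<bar> = exp L" using t5 by (simp add: L_def)
    define f where "f = (\<lambda>z. zeta (z + \<i> * of_real t))"
    have Re_z: "Re z > 1/4 \<and> Re z < 1 \<and> \<bar>Im z\<bar> < 1" if "z \<in> ball z0 (5/16)" for z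
      using that abs_Re_le_cmod[of "z0 - z"] abs_Im_le_cmod[of "z0 - z"] by (auto simp: dist_norm z0_def)
    have ne1: "z + \<i> * of_real t \<noteq> 1" if "z \<in> ball z0 (5/16)" for z
      using Re_z[OF that] t5 by (auto simp: complex_eq_iff)
    have f_up: "cmod (f z) \<le> 2 * C * \<bar>t\<bar>" if "z \<in> ball z0 (5/16)" for z
    proof -
      have "cmod (f z) \<le> C * \<bar>Im (z + \<i> * of_real t)\<bar>"
        unfolding f_def by (rule C(2)) (use Re_z[OF that] t5 in auto)
      also have "\<dots> \<le> C * (2 * \<bar>t\<bar>)"
        using Re_z[OF that] t5 C(1) by (intro mult_left_mono) auto
      finally show ?thesis by simp
    qed
    have f_hol: "f holomorphic_on ball z0 (5/16)"
      unfolding f_def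
      by (rule holomorphic_on_compose_gen[OF _ holomorphic_zeta, unfolded o_def])
         (use ne1 in \<open>auto intro!: holomorphic_intros\<close>)
    have f0: "inverse \<bar>t\<bar> \<le> cmod (f z0)"
      using T(2)[of "z0 + \<i> * of_real t"] t t5 unfolding f_def z0_def by (simp add: powr_minus)
    have f0nz: "f z0 \<noteq> 0" using f0 t5 by (auto simp: field_simps)
    obtain g zs where g: "set zs \<subseteq> {z \<in> cball z0 (1/8). f z = 0}" "g holomorphic_on ball z0 (5/16)"
      "\<And>z. z \<in> ball z0 (5/16) \<Longrightarrow> f z = (\<Prod>\<rho>\<leftarrow>zs. z - \<rho>) * g z" "\<And>z. z \<in> cball z0 (1/8) \<Longrightarrow> g z \<noteq> 0"
    proof (rule holomorphic_divide_out_zeros[OF f_hol open_ball connected_ball compact_cball[of z0 "1/8"]])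
      show "cball z0 (1/8) \<subseteq> ball z0 (5/16)" by auto
      show "\<exists>z\<in>ball z0 (5/16). f z \<noteq> 0" using f0nz by (intro bexI[of _ z0]) auto
    qed blast
    define p where "p = (\<lambda>z. \<Prod>\<rho>\<leftarrow>zs. z - \<rho>)"
    have zs: "cmod (z0 - \<rho>) \<le> 1/8" "Re \<rho> \<le> 1/2" if "\<rho> \<in> set zs" for \<rho>
    proof -
      from that g(1) have \<rho>: "\<rho> \<in> cball z0 (1/8)" "f \<rho> = 0" by auto
      then show "cmod (z0 - \<rho>) \<le> 1/8" by (simp add: dist_norm)
      have "\<rho> \<in> ball z0 (5/16)" using \<rho>(1) by auto
      then show "Re \<rho> \<le> 1/2"
        using zeta_nonzero[of "\<rho> + \<i> * of_real t"] \<rho>(2) ne1[of \<rho>] unfolding f_def by force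
    qed
    have fp: "f z = p z * g z" if "z \<in> ball z0 (5/16)" for z
      using g(3)[OF that] by (simp add: p_def)
    have p0: "p z0 \<noteq> 0" using fp[of z0] f0nz by auto
    \<comment> \<open>Freezing p at the centre leaves G z0 = f z0. A point on the circle of radius
      1/4 is at least 1/8 away from every zero in \<open>zs\<close>, hence no nearer to it than the
      centre is; so |G| <= |f| there, and the maximum principle carries the bound inside.\<close>
    define G where "G = (\<lambda>z. p z0 * g z)"
    have G_hol: "G holomorphic_on ball z0 (5/16)"
      unfolding G_def by (intro holomorphic_intros g)
    have G_up: "cmod (G z) \<le> 2 * C * \<bar>t\<bar>" if "z \<in> ball z0 (1/8)" for z
    proof (rule maximum_modulus_frontier[of G "cball z0 (1/4)"])
      show "G holomorphic_on interior (cball z0 (1/4))"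
        by (rule holomorphic_on_subset[OF G_hol]) auto
      show "continuous_on (closure (cball z0 (1/4))) G"
        by (rule continuous_on_subset[OF holomorphic_on_imp_continuous_on[OF G_hol]]) auto
      show "cmod (G z) \<le> 2 * C * \<bar>t\<bar>" if z: "z \<in> frontier (cball z0 (1/4))" for z
      proof -
        have zn: "cmod (z - z0) = 1/4" using z by (simp add: frontier_cball dist_norm norm_minus_commute)
        then have zb: "z \<in> ball z0 (5/16)" by (simp add: dist_norm norm_minus_commute)
        have "cmod (p z0) \<le> cmod (p z)"
          unfolding p_def
        proof (rule prod_list_norm_mono)
          fix \<rho> assume "\<rho> \<in> set zs"
          then show "cmod (z0 - \<rho>) \<le> cmod (z - \<rho>)"
            using zs(1)[of \<rho>] norm_triangle_ineq[of "z - \<rho>" "\<rho> - z0"] zn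
            by (simp add: norm_minus_commute)
        qed
        then have "cmod (G z) \<le> cmod (p z) * cmod (g z)"
          unfolding G_def norm_mult by (intro mult_right_mono) auto
        also have "\<dots> = cmod (f z)" using fp[OF zb] by (simp add: norm_mult)
        also have "\<dots> \<le> 2 * C * \<bar>t\<bar>" by (rule f_up[OF zb])
        finally show ?thesis .
      qed
      show "z \<in> cball z0 (1/4)" using that by auto
    qed auto
    have Gnz: "G z \<noteq> 0" if "z \<in> ball z0 (1/8)" for z
      using g(4)[of z] that p0 by (auto simp: G_def)
    have "G holomorphic_on ball z0 (1/8)"
      by (rule holomorphic_on_subset[OF G_hol]) auto
    then obtain u where u: "u holomorphic_on ball z0 (1/8)"
      "\<And>z. z \<in> ball z0 (1/8) \<Longrightarrow> u z \<noteq> 0 \<and> cmod (u z) = cmod (G z) powr (1 / L)"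
      using holomorphic_real_power[of G z0 "1/8" "1 / L"] Gnz by blast
    let ?x = "of_real (1/2) :: complex" and ?y = "of_real (1/2 + \<delta>) :: complex"
    have dists: "dist z0 ?x = 1/16" "dist z0 ?y = 1/16 - \<delta>" "dist ?x ?y = \<delta>"
      unfolding z0_def dist_of_real using \<delta> by (auto simp: dist_real_def)
    \<comment> \<open>The factor is exp \<eta>, which becomes |t|^\<eta> after raising to the power
      L = ln |t|.\<close>
    have "cmod (u ?x) \<le> (1 + (exp \<eta> - 1)) * cmod (u ?y)"
    proof (rule slow[OF u(1)])
      fix z assume z: "z \<in> ball z0 (1/8)"
      have "cmod (G z) powr (1 / L) \<le> (2 * C * \<bar>t\<bar>) powr (1 / L)"
        using L1 G_up[OF z] by (intro powr_mono2) auto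
      also have "\<dots> = exp (ln (2 * C * \<bar>t\<bar>) / L)" using C(1) t5 by (simp add: powr_def)
      also have "ln (2 * C * \<bar>t\<bar>) / L = 1 + ln (2 * C) / L"
        using C(1) t5 L1 by (simp add: ln_mult L_def add_divide_distrib)
      also have "ln (2 * C) / L \<le> ln (2 * C)"
        using C(1) L1 divide_left_mono[of 1 L "ln (2 * C)"] by simp
      finally show "u z \<noteq> 0 \<and> cmod (u z) \<le> exp (1 + ln (2 * C))"
        using u(2)[OF z] by simp
    next
      \<comment> \<open>At the centre |G z0| = |f z0| >= 1/|t|, and the power 1/L of 1/|t| is exp (-
        1) for every t.\<close>
      have "exp (- 1) = inverse \<bar>t\<bar> powr (1 / L)"
        unfolding texp using L1 by (simp add: exp_minus[symmetric] powr_def)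
      also have "\<dots> \<le> cmod (G z0) powr (1 / L)"
        using L1 t5 f0 fp[of z0] by (intro powr_mono2) (auto simp: G_def)
      also have "\<dots> = cmod (u z0)" using u(2)[of z0] by simp
      finally show "exp (- 1) \<le> cmod (u z0)" .
    qed (use dists \<delta> d in auto)
    then have "cmod (G ?x) powr (1 / L) \<le> exp \<eta> * cmod (G ?y) powr (1 / L)"
      using u(2)[of ?x] u(2)[of ?y] dists \<delta> by simp
    then have "(cmod (G ?x) powr (1 / L)) powr L \<le> (exp \<eta> * cmod (G ?y) powr (1 / L)) powr L"
      using L1 by (intro powr_mono2) auto
    also have "\<dots> = \<bar>t\<bar> powr \<eta> * cmod (G ?y)"
      unfolding texp using L1 by (simp add: powr_mult powr_powr) (simp add: powr_def mult.commute)
    also have "(cmod (G ?x) powr (1 / L)) powr L = cmod (G ?x)" using L1 by (simp add: powr_powr)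
    finally have "cmod (p z0) * cmod (g ?x) \<le> cmod (p z0) * (\<bar>t\<bar> powr \<eta> * cmod (g ?y))"
      by (simp add: G_def norm_mult mult_ac)
    then have gg: "cmod (g ?x) \<le> \<bar>t\<bar> powr \<eta> * cmod (g ?y)"
      using p0 by simp
    have pp: "cmod (p ?x) \<le> cmod (p ?y)"
      unfolding p_def
    proof (rule prod_list_norm_mono)
      fix \<rho> assume "\<rho> \<in> set zs"
      then show "cmod (?x - \<rho>) \<le> cmod (?y - \<rho>)"
        using norm_diff_le_shift_right[of \<rho> ?x \<delta>] zs(2) \<delta> by simp
    qed
    have "cmod (f ?x) = cmod (p ?x) * cmod (g ?x)"
      using fp[of ?x] dists by (simp add: norm_mult)
    also have "\<dots> \<le> cmod (p ?y) * (\<bar>t\<bar> powr \<eta> * cmod (g ?y))"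
      by (intro mult_mono pp gg) auto
    also have "\<dots> = \<bar>t\<bar> powr \<eta> * cmod (f ?y)"
      using fp[of ?y] dists \<delta> by (simp add: norm_mult)
    finally have "cmod (f ?x) \<le> \<bar>t\<bar> powr \<eta> * cmod (f ?y)" .
    moreover have "?x + \<i> * of_real t = Complex (1/2) t" "?y + \<i> * of_real t = Complex (1/2 + \<delta>) t"
      by (simp_all add: complex_eq_iff)
    ultimately show "cmod (zeta (Complex (1/2) t)) \<le> \<bar>t\<bar> powr \<eta> * cmod (zeta (Complex (1/2 + \<delta>) t))"
      by (simp only: f_def)
  qed
qed

text \<open>At bounded height compactness replaces normal families: once the zeros in the rectangle
  are divided out, g x / g y is bounded on K \<times> K, and the product over the zeros does not
  decrease under the shift to the right.\<close>

lemma zeta_reg_shift_bound_small: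
  obtains B where "B \<ge> 0"
    "\<And>t \<delta>. \<lbrakk>\<bar>t\<bar> \<le> T; 0 < \<delta>; \<delta> \<le> 1/4\<rbrakk> \<Longrightarrow>
       cmod (zeta_reg (Complex (1/2) t)) \<le> B * cmod (zeta_reg (Complex (1/2 + \<delta>) t))"
proof -
  define K where "K = cbox (Complex (1/2) (- T)) (Complex (3/4) T)"
  have K: "compact K" "K \<subseteq> {s. Re s > 0}" by (auto simp: K_def in_cbox_complex_iff)
  obtain g zs where g: "set zs \<subseteq> {z \<in> K. zeta_reg z = 0}" "g holomorphic_on {s. Re s > 0}"
      "\<And>z. z \<in> {s. Re s > 0} \<Longrightarrow> zeta_reg z = (\<Prod>\<rho>\<leftarrow>zs. z - \<rho>) * g z" "\<And>z. z \<in> K \<Longrightarrow> g z \<noteq> 0"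
  proof (rule holomorphic_divide_out_zeros[OF holomorphic_zeta_reg open_halfspace_Re_gt _ K])
    show "connected {s. 0 < Re s}" by (intro convex_connected convex_halfspace_Re_gt)
    show "\<exists>z\<in>{s. 0 < Re s}. zeta_reg z \<noteq> 0" using zeta_reg_1 by (intro bexI[of _ 1]) auto
  qed blast
  have gc: "continuous_on K g"
    using g(2) K(2) by (meson holomorphic_on_imp_continuous_on continuous_on_subset)
  have "continuous_on (K \<times> K) (\<lambda>(x, y). g x / g y)"
    unfolding case_prod_unfold
    by (intro continuous_intros continuous_on_compose2[OF gc]) (use g(4) in auto)
  then have "bounded ((\<lambda>(x, y). g x / g y) ` (K \<times> K))"
    by (intro compact_imp_bounded compact_continuous_image compact_Times K)
  then obtain B where B: "\<And>x y. x \<in> K \<Longrightarrow> y \<in> K \<Longrightarrow> cmod (g x / g y) \<le> B"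
    unfolding bounded_iff by fastforce
  show ?thesis
  proof (rule that[of "\<bar>B\<bar>"])
    fix t \<delta> :: real assume t: "\<bar>t\<bar> \<le> T" and \<delta>: "0 < \<delta>" "\<delta> \<le> 1/4"
    let ?x = "Complex (1/2) t" and ?y = "Complex (1/2 + \<delta>) t"
    have xy: "?x \<in> K" "?y \<in> K" using t \<delta> by (auto simp: K_def in_cbox_complex_iff)
    have "cmod (\<Prod>\<rho>\<leftarrow>zs. ?x - \<rho>) \<le> cmod (\<Prod>\<rho>\<leftarrow>zs. ?y - \<rho>)"
    proof (rule prod_list_norm_mono)
      fix \<rho> assume "\<rho> \<in> set zs"
      then have "zeta_reg \<rho> = 0" using g(1) by auto
      then have "Re \<rho> \<le> 1/2" using zeta_reg_nonzero[of \<rho>] by force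
      moreover have "?x + of_real \<delta> = ?y" by (simp add: complex_eq_iff)
      ultimately show "cmod (?x - \<rho>) \<le> cmod (?y - \<rho>)"
        using norm_diff_le_shift_right[of \<rho> ?x \<delta>] \<delta> by simp
    qed
    moreover have "cmod (g ?x) \<le> \<bar>B\<bar> * cmod (g ?y)"
      using B[OF xy] g(4)[OF xy(2)] by (simp add: norm_divide field_simps)
         (smt (verit) mult_right_mono norm_ge_zero abs_ge_self)
    ultimately have "cmod (\<Prod>\<rho>\<leftarrow>zs. ?x - \<rho>) * cmod (g ?x) \<le> cmod (\<Prod>\<rho>\<leftarrow>zs. ?y - \<rho>) * (\<bar>B\<bar> * cmod (g ?y))"
      by (intro mult_mono) auto
    then show "cmod (zeta_reg ?x) \<le> \<bar>B\<bar> * cmod (zeta_reg ?y)"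
      using g(3)[of ?x] g(3)[of ?y] \<delta> by (simp add: norm_mult mult_ac)
  qed simp
qed

text \<open>The constant does not depend on \<delta>; this gives the majorant for the limit \<delta>
  \<rightarrow> 0, in spite of possible zeros on the line.\<close>

lemma zeta_shift_bound:
  assumes "\<eta> > 0"
  obtains C \<delta>0 where "C \<ge> 0" "0 < \<delta>0" "\<delta>0 \<le> 1/32"
    "\<And>t \<delta>. \<lbrakk>0 < \<delta>; \<delta> \<le> \<delta>0\<rbrakk> \<Longrightarrow>
       cmod (zeta (Complex (1/2) t) * zeta_inv (Complex (1/2 + \<delta>) t)) \<le> C * (1 + \<bar>t\<bar>) powr \<eta>"
proof -
  obtain T \<delta>0 where T: "T \<ge> 5" "0 < \<delta>0" "\<delta>0 \<le> 1/32" and large: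
    "\<And>t \<delta>. \<lbrakk>\<bar>t\<bar> \<ge> T; 0 < \<delta>; \<delta> \<le> \<delta>0\<rbrakk> \<Longrightarrow>
       cmod (zeta (Complex (1/2) t)) \<le> \<bar>t\<bar> powr \<eta> * cmod (zeta (Complex (1/2 + \<delta>) t))"
    using zeta_shift_bound_large[OF assms] by blast
  obtain B where B: "B \<ge> 0" and small:
    "\<And>t \<delta>. \<lbrakk>\<bar>t\<bar> \<le> T; 0 < \<delta>; \<delta> \<le> 1/4\<rbrakk> \<Longrightarrow>
       cmod (zeta_reg (Complex (1/2) t)) \<le> B * cmod (zeta_reg (Complex (1/2 + \<delta>) t))"
    using zeta_reg_shift_bound_small by blast
  show ?thesis
  proof (rule that[of "1 + B" \<delta>0])
    fix t \<delta> :: real assume \<delta>: "0 < \<delta>" "\<delta> \<le> \<delta>0"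
    let ?x = "Complex (1/2) t" and ?y = "Complex (1/2 + \<delta>) t"
    have y1: "?y \<noteq> 1" "?x \<noteq> 1" using \<delta> T by (auto simp: complex_eq_iff)
    have ynz: "zeta ?y \<noteq> 0" "zeta_reg ?y \<noteq> 0" using zeta_nonzero[of ?y] zeta_reg_nonzero[of ?y] y1 \<delta> by auto
    have p1: "(1 + \<bar>t\<bar>) powr \<eta> \<ge> 1" using assms by (intro ge_one_powr_ge_zero) auto
    show "cmod (zeta ?x * zeta_inv ?y) \<le> (1 + B) * (1 + \<bar>t\<bar>) powr \<eta>"
    proof (cases "\<bar>t\<bar> \<ge> T")
      case True
      have "cmod (zeta ?x * zeta_inv ?y) = cmod (zeta ?x) / cmod (zeta ?y)"
        using zeta_inv_eq[of ?y] y1 \<delta> by (simp add: norm_mult norm_divide)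
      also have "\<dots> \<le> \<bar>t\<bar> powr \<eta>"
        using large[OF True \<delta>] ynz by (simp add: field_simps)
      also have "\<dots> \<le> 1 * (1 + \<bar>t\<bar>) powr \<eta>" using assms by (simp add: powr_mono2)
      also have "\<dots> \<le> (1 + B) * (1 + \<bar>t\<bar>) powr \<eta>" using B by (intro mult_right_mono) auto
      finally show ?thesis .
    next
      case False
      have "cmod (zeta ?x) = cmod (zeta_reg ?x) / cmod (?x - 1)"
        using zeta_reg_eq[of ?x] y1 by (simp add: norm_mult)
      then have "cmod (zeta ?x * zeta_inv ?y) = (cmod (zeta_reg ?x) / cmod (zeta_reg ?y)) * (cmod (?y - 1) / cmod (?x - 1))"
        by (simp add: zeta_inv_def norm_mult norm_divide)
      also have "\<dots> \<le> B * 1"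
      proof (rule mult_mono)
        show "cmod (zeta_reg ?x) / cmod (zeta_reg ?y) \<le> B"
          using small[of t \<delta>] False \<delta> T ynz by (simp add: divide_le_eq)
        \<comment> \<open>Moving right brings the point closer to the pole at 1, so the pole factors
          contribute at most 1.\<close>
        have "(1/2 - \<delta>)\<^sup>2 \<le> (1/2)\<^sup>2" using \<delta> T by (intro power_mono) auto
        then have "cmod (?y - 1) \<le> cmod (?x - 1)"
          by (auto simp: cmod_def power2_eq_square algebra_simps intro!: real_sqrt_le_mono)
        then show "cmod (?y - 1) / cmod (?x - 1) \<le> 1" using y1 by (simp add: divide_le_eq)
      qed (use B in auto)
      also have "\<dots> \<le> (1 + B) * (1 + \<bar>t\<bar>) powr \<eta>" using B p1 by (intro mult_mono) auto
      finally show ?thesis .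
    qed
  qed (use B T in auto)
qed

text \<open>The Lindelof bound on the line itself, obtained by writing zeta(s) as zeta(s)/zeta(s +
  \<delta>0) times zeta(s + \<delta>0); each factor grows at most like |t|^(\<eta>/2).\<close>

lemma zeta_critical_line_bound:
  assumes "\<eta> > 0"
  obtains C where "C \<ge> 0" "\<And>t. cmod (zeta (Complex (1/2) t)) \<le> C * (1 + \<bar>t\<bar>) powr \<eta>"
proof -
  obtain C \<delta>0 where C: "C \<ge> 0" "0 < \<delta>0" "\<delta>0 \<le> 1/32"
    "\<And>t \<delta>. \<lbrakk>0 < \<delta>; \<delta> \<le> \<delta>0\<rbrakk> \<Longrightarrow>
       cmod (zeta (Complex (1/2) t) * zeta_inv (Complex (1/2 + \<delta>) t)) \<le> C * (1 + \<bar>t\<bar>) powr (\<eta> / 2)"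
    using zeta_shift_bound[of "\<eta> / 2"] assms by auto
  obtain T where T: "T \<ge> 5" "\<And>s. \<lbrakk>Re s \<ge> 1/2 + \<delta>0; Re s \<le> 3; \<bar>Im s\<bar> \<ge> T\<rbrakk> \<Longrightarrow>
       \<bar>Im s\<bar> powr (- (\<eta> / 2)) \<le> cmod (zeta s) \<and> cmod (zeta s) \<le> \<bar>Im s\<bar> powr (\<eta> / 2)"
    using zeta_subpolynomial[of \<delta>0 "\<eta> / 2"] C assms by auto
  have "continuous_on {-T..T} (\<lambda>t. zeta (Complex (1/2) t))"
    by (rule continuous_on_compose2[OF holomorphic_on_imp_continuous_on[OF holomorphic_zeta]])
       (auto simp: complex_eq_iff intro!: continuous_intros)
  then have "bounded ((\<lambda>t. zeta (Complex (1/2) t)) ` {-T..T})"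
    by (intro compact_imp_bounded compact_continuous_image) auto
  then obtain B where B: "\<And>t. \<bar>t\<bar> \<le> T \<Longrightarrow> cmod (zeta (Complex (1/2) t)) \<le> B"
    unfolding bounded_iff by (force simp: abs_le_iff)
  show ?thesis
  proof (rule that[of "C + \<bar>B\<bar>"])
    fix t
    let ?x = "Complex (1/2) t" and ?y = "Complex (1/2 + \<delta>0) t"
    have p1: "(1 + \<bar>t\<bar>) powr \<eta> \<ge> 1" using assms by (intro ge_one_powr_ge_zero) auto
    show "cmod (zeta ?x) \<le> (C + \<bar>B\<bar>) * (1 + \<bar>t\<bar>) powr \<eta>"
    proof (cases "\<bar>t\<bar> \<le> T")
      case True
      have "cmod (zeta ?x) \<le> (C + \<bar>B\<bar>) * 1" using B[OF True] C by simp
      also have "\<dots> \<le> (C + \<bar>B\<bar>) * (1 + \<bar>t\<bar>) powr \<eta>" using p1 C by (intro mult_left_mono) auto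
      finally show ?thesis .
    next
      case False
      have y1: "?y \<noteq> 1" using C by (auto simp: complex_eq_iff)
      have ynz: "zeta ?y \<noteq> 0" using zeta_nonzero[of ?y] y1 C by auto
      have "cmod (zeta ?x) = cmod (zeta ?x * zeta_inv ?y) * cmod (zeta ?y)"
        using zeta_inv_eq[of ?y] y1 ynz C by (simp add: norm_mult norm_divide)
      also have "\<dots> \<le> (C * (1 + \<bar>t\<bar>) powr (\<eta> / 2)) * (1 + \<bar>t\<bar>) powr (\<eta> / 2)"
      proof (rule mult_mono)
        have "cmod (zeta ?y) \<le> \<bar>t\<bar> powr (\<eta> / 2)" using T(2)[of ?y] False C by simp
        also have "\<dots> \<le> (1 + \<bar>t\<bar>) powr (\<eta> / 2)" using assms by (intro powr_mono2) auto
        finally show "cmod (zeta ?y) \<le> (1 + \<bar>t\<bar>) powr (\<eta> / 2)" .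
      qed (use C in auto)
      also have "\<dots> = C * (1 + \<bar>t\<bar>) powr \<eta>" by (simp add: powr_add[symmetric])
      also have "\<dots> \<le> (C + \<bar>B\<bar>) * (1 + \<bar>t\<bar>) powr \<eta>" by (intro mult_right_mono) auto
      finally show ?thesis .
    qed
  qed (use C in auto)
qed

end

section \<open>Functions of moderate growth\<close>

text \<open>The exponent only has to be positive and smaller than \<open>1/2\<close>.\<close>

definition tempered :: "(real \<Rightarrow> complex) set" where
  "tempered = {f. f \<in> borel_measurable borel \<and> (\<exists>C. \<forall>t. cmod (f t) \<le> C * (1 + \<bar>t\<bar>) powr (3/8))}"

definition ip :: "(real \<Rightarrow> complex) \<Rightarrow> (real \<Rightarrow> complex) \<Rightarrow> complex" where
  "ip f g = (LINT t|cauchy. f t * cnj (g t))"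

definition nsq :: "(real \<Rightarrow> complex) \<Rightarrow> real" where
  "nsq f = (LINT t|cauchy. (cmod (f t))\<^sup>2)"

lemma temperedI:
  assumes "f \<in> borel_measurable borel" "\<And>t. cmod (f t) \<le> C * (1 + \<bar>t\<bar>) powr (3/8)"
  shows "f \<in> tempered"
  using assms by (auto simp: tempered_def)

lemma tempered_measurable [measurable_dest]: "f \<in> tempered \<Longrightarrow> f \<in> borel_measurable borel"
  by (simp add: tempered_def)

lemma tempered_bound:
  assumes "f \<in> tempered"
  obtains C where "C \<ge> 0" "\<And>t. cmod (f t) \<le> C * (1 + \<bar>t\<bar>) powr (3/8)"
proof -
  obtain C where C: "\<And>t. cmod (f t) \<le> C * (1 + \<bar>t\<bar>) powr (3/8)"
    using assms by (auto simp: tempered_def)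
  have "C \<ge> 0" using order_trans[OF norm_ge_zero C[of 0]] by simp
  with C that show ?thesis by blast
qed

lemma tempered_bounded:
  assumes "f \<in> borel_measurable borel" "\<And>t. cmod (f t) \<le> C"
  shows "f \<in> tempered"
proof (rule temperedI[OF assms(1)])
  fix t :: real
  have "C \<ge> 0" using order_trans[OF norm_ge_zero assms(2)] .
  moreover have "1 \<le> (1 + \<bar>t\<bar>) powr (3/8)" by (intro ge_one_powr_ge_zero) auto
  ultimately have "C * 1 \<le> C * (1 + \<bar>t\<bar>) powr (3/8)" by (intro mult_left_mono)
  with assms(2)[of t] show "cmod (f t) \<le> C * (1 + \<bar>t\<bar>) powr (3/8)" by linarith
qed

lemma tempered_add:
  assumes "f \<in> tempered" "g \<in> tempered"
  shows "(\<lambda>t. f t + g t) \<in> tempered"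
proof -
  obtain C D where "\<And>t. cmod (f t) \<le> C * (1 + \<bar>t\<bar>) powr (3/8)" "\<And>t. cmod (g t) \<le> D * (1 + \<bar>t\<bar>) powr (3/8)"
    using assms tempered_bound by metis
  then have "cmod (f t + g t) \<le> (C + D) * (1 + \<bar>t\<bar>) powr (3/8)" for t
    by (metis distrib_right norm_triangle_le add_mono)
  moreover have "(\<lambda>t. f t + g t) \<in> borel_measurable borel" using assms by measurable
  ultimately show ?thesis by (rule temperedI[rotated])
qed

lemma tempered_cmult:
  assumes "f \<in> tempered"
  shows "(\<lambda>t. c * f t) \<in> tempered"
proof -
  obtain C where "\<And>t. cmod (f t) \<le> C * (1 + \<bar>t\<bar>) powr (3/8)"
    using assms tempered_bound by metis
  then have "cmod (c * f t) \<le> (cmod c * C) * (1 + \<bar>t\<bar>) powr (3/8)" for t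
    by (simp add: norm_mult mult.assoc mult_left_mono)
  moreover have "(\<lambda>t. c * f t) \<in> borel_measurable borel" using assms by measurable
  ultimately show ?thesis by (rule temperedI[rotated])
qed

lemma tempered_diff:
  assumes "f \<in> tempered" "g \<in> tempered"
  shows "(\<lambda>t. f t - g t) \<in> tempered"
  using tempered_add[OF assms(1) tempered_cmult[OF assms(2), of "-1"]] by simp

lemma tempered_0: "(\<lambda>t. 0) \<in> tempered"
  by (rule tempered_bounded[of _ 0]) auto

lemma tempered_sum:
  assumes "\<And>i. i \<in> I \<Longrightarrow> f i \<in> tempered"
  shows "(\<lambda>t. \<Sum>i\<in>I. f i t) \<in> tempered"
  using assms by (induction I rule: infinite_finite_induct) (auto intro: tempered_0 tempered_add)

lemma borel_measurable_cnj [measurable (raw)]: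
  assumes "f \<in> borel_measurable M"
  shows "(\<lambda>x. cnj (f x)) \<in> borel_measurable M"
  by (rule measurable_compose[OF assms borel_measurable_continuous_onI]) (intro continuous_intros)

lemma norm_tempered_product_le:
  assumes "\<And>t. cmod (f t) \<le> C * (1 + \<bar>t\<bar>) powr (3/8)" "\<And>t. cmod (g t) \<le> D * (1 + \<bar>t\<bar>) powr (3/8)" "C \<ge> 0"
  shows "cmod (f t * cnj (g t)) \<le> C * D * (1 + \<bar>t\<bar>) powr (3/4)"
proof -
  have "cmod (f t) * cmod (g t) \<le> (C * (1 + \<bar>t\<bar>) powr (3/8)) * (D * (1 + \<bar>t\<bar>) powr (3/8))"
    by (intro mult_mono assms) (use assms(3) in auto)
  also have "\<dots> = C * D * ((1 + \<bar>t\<bar>) powr (3/8) * (1 + \<bar>t\<bar>) powr (3/8))" by simp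
  also have "\<dots> = C * D * (1 + \<bar>t\<bar>) powr (3/4)" by (simp only: powr_add[symmetric]) simp
  finally show ?thesis by (simp add: norm_mult)
qed

lemma integrable_ip:
  assumes "f \<in> tempered" "g \<in> tempered"
  shows "integrable cauchy (\<lambda>t. f t * cnj (g t))"
proof -
  obtain C where C: "C \<ge> 0" "\<And>t. cmod (f t) \<le> C * (1 + \<bar>t\<bar>) powr (3/8)"
    using tempered_bound[OF assms(1)] by blast
  obtain D where D: "D \<ge> 0" "\<And>t. cmod (g t) \<le> D * (1 + \<bar>t\<bar>) powr (3/8)"
    using tempered_bound[OF assms(2)] by blast
  have "integrable cauchy (\<lambda>t. C * D * (1 + \<bar>t\<bar>) powr (3/4))"
    by (intro integrable_mult_right integrable_cauchy_powr) simp
  then show ?thesis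
  proof (rule Bochner_Integration.integrable_bound)
    show "(\<lambda>t. f t * cnj (g t)) \<in> borel_measurable cauchy" using assms by measurable
    show "AE t in cauchy. norm (f t * cnj (g t)) \<le> norm (C * D * (1 + \<bar>t\<bar>) powr (3/4))"
      using norm_tempered_product_le[OF C(2) D(2) C(1)] C(1) D(1) by (intro AE_I2) simp
  qed
qed

section \<open>Inner product identities and the Cauchy-Schwarz inequality\<close>

lemma ip_self: "ip f f = of_real (nsq f)"
proof -
  have "f t * cnj (f t) = of_real ((cmod (f t))\<^sup>2)" for t
    by (simp add: complex_norm_square del: of_real_power)
  then show ?thesis unfolding ip_def nsq_def by (simp only: integral_complex_of_real)
qed

lemma nsq_nonneg: "nsq f \<ge> 0"
  unfolding nsq_def by (rule integral_nonneg_AE) simp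

lemma ip_cnj: "ip g f = cnj (ip f g)"
proof -
  have "ip g f = (LINT t|cauchy. cnj (f t * cnj (g t)))"
    unfolding ip_def by (simp add: mult.commute del: Bochner_Integration.integral_cnj)
  then show ?thesis by (simp only: Bochner_Integration.integral_cnj ip_def)
qed

lemma ip_add_left: "\<lbrakk>f \<in> tempered; g \<in> tempered; h \<in> tempered\<rbrakk> \<Longrightarrow> ip (\<lambda>t. f t + g t) h = ip f h + ip g h"
  unfolding ip_def by (subst Bochner_Integration.integral_add[symmetric]) (auto intro: integrable_ip simp: distrib_right)

lemma ip_cmult_left: "ip (\<lambda>t. c * f t) h = c * ip f h"
  unfolding ip_def by (simp add: mult.assoc)

lemma ip_diff_left: "\<lbrakk>f \<in> tempered; g \<in> tempered; h \<in> tempered\<rbrakk> \<Longrightarrow> ip (\<lambda>t. f t - g t) h = ip f h - ip g h"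
  unfolding ip_def by (subst Bochner_Integration.integral_diff[symmetric]) (auto intro: integrable_ip simp: left_diff_distrib)

lemma ip_diff_right: "\<lbrakk>f \<in> tempered; g \<in> tempered; h \<in> tempered\<rbrakk> \<Longrightarrow> ip h (\<lambda>t. f t - g t) = ip h f - ip h g"
  using ip_diff_left[of f g h] by (metis complex_cnj_diff ip_cnj)

lemma ip_sum_left:
  "\<lbrakk>\<And>i. i \<in> I \<Longrightarrow> f i \<in> tempered; h \<in> tempered\<rbrakk> \<Longrightarrow> ip (\<lambda>t. \<Sum>i\<in>I. f i t) h = (\<Sum>i\<in>I. ip (f i) h)"
proof (induction I rule: infinite_finite_induct)
  case (insert i I)
  have "ip (\<lambda>t. \<Sum>i\<in>insert i I. f i t) h = ip (\<lambda>t. f i t + (\<Sum>i\<in>I. f i t)) h"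
    using insert by simp
  also have "\<dots> = ip (f i) h + ip (\<lambda>t. \<Sum>i\<in>I. f i t) h"
    using insert by (intro ip_add_left tempered_sum) auto
  finally show ?case using insert by simp
qed (simp_all add: ip_def)

lemma nsq_diff_cmult:
  assumes f: "f \<in> tempered" and g: "g \<in> tempered"
  shows "nsq (\<lambda>t. f t - c * g t) = nsq f - 2 * Re (cnj c * ip f g) + (cmod c)\<^sup>2 * nsq g"
proof -
  note cg = tempered_cmult[OF g, of c]
  note d = tempered_diff[OF f cg]
  have "complex_of_real (nsq (\<lambda>t. f t - c * g t)) = ip (\<lambda>t. f t - c * g t) (\<lambda>t. f t - c * g t)"
    by (rule ip_self[symmetric])
  also have "\<dots> = ip f (\<lambda>t. f t - c * g t) - c * ip g (\<lambda>t. f t - c * g t)"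
    by (simp add: ip_diff_left[OF f cg d] ip_cmult_left)
  also have "ip f (\<lambda>t. f t - c * g t) = of_real (nsq f) - cnj c * ip f g"
    unfolding ip_diff_right[OF f cg f] ip_self ip_cnj[of f "\<lambda>t. c * g t"] ip_cmult_left
    by (simp add: ip_cnj[of g f])
  also have "ip g (\<lambda>t. f t - c * g t) = cnj (ip f g) - cnj c * of_real (nsq g)"
    unfolding ip_diff_right[OF f cg g] ip_cnj[of g "\<lambda>t. c * g t"] ip_cmult_left ip_self
    by (simp add: ip_cnj[of g f])
  also have "(of_real (nsq f) - cnj c * ip f g) - c * (cnj (ip f g) - cnj c * of_real (nsq g)) =
      of_real (nsq f) - (cnj c * ip f g + cnj (cnj c * ip f g)) + c * cnj c * of_real (nsq g)"
    by (simp add: algebra_simps)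
  also have "\<dots> = of_real (nsq f - 2 * Re (cnj c * ip f g) + (cmod c)\<^sup>2 * nsq g)"
    by (simp only: complex_add_cnj complex_norm_square[symmetric] of_real_diff of_real_add of_real_mult)
  finally show ?thesis by (simp only: of_real_eq_iff)
qed

text \<open>The discriminant argument, tested on real multiples of p. It serves both for
  Cauchy-Schwarz and for near-orthogonality, where a is the excess over an infimum.\<close>

lemma quadratic_bound:
  fixes p :: complex and a b :: real
  assumes "\<And>c. 2 * Re (cnj c * p) \<le> a + (cmod c)\<^sup>2 * b" "b \<ge> 0"
  shows "(cmod p)\<^sup>2 \<le> a * b"
proof (cases "p = 0")
  case True
  then show ?thesis using assms(1)[of 0] assms(2) by simp
next
  case False
  define P where "P = (cmod p)\<^sup>2"
  have P: "P > 0" using False by (simp add: P_def)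
  have *: "2 * r * P \<le> a + r\<^sup>2 * P * b" for r
  proof -
    have "cnj (of_real r * p) * p = of_real r * (p * cnj p)" by simp
    also have "\<dots> = of_real (r * P)"
      by (simp only: P_def complex_norm_square[symmetric] of_real_mult)
    finally have "cnj (of_real r * p) * p = of_real (r * P)" .
    then have "2 * Re (of_real (r * P)) \<le> a + (cmod (of_real r * p))\<^sup>2 * b"
      using assms(1)[of "of_real r * p"] by (simp only:)
    then show ?thesis
      by (simp add: norm_mult power_mult_distrib P_def)
  qed
  show ?thesis
  proof (cases "b = 0")
    case True
    have "2 * ((a + 1) / P) * P = 2 * (a + 1)" using P by simp
    with *[of "(a + 1) / P"] True have "2 * (a + 1) \<le> a" by simp
    moreover have "a \<ge> 0" using assms(1)[of 0] by simp
    ultimately show ?thesis by simp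
  next
    case False
    then have b: "b > 0" using assms(2) by simp
    have "2 * (P / b) \<le> a + P / b" using *[of "1 / b"] b by (simp add: power2_eq_square mult.commute)
    then have "P / b \<le> a" by linarith
    then show ?thesis using b by (simp add: P_def field_simps)
  qed
qed

lemma ip_Cauchy_Schwarz:
  assumes "f \<in> tempered" "g \<in> tempered"
  shows "cmod (ip f g) \<le> sqrt (nsq f) * sqrt (nsq g)"
proof -
  have "(cmod (ip f g))\<^sup>2 \<le> nsq f * nsq g"
  proof (rule quadratic_bound)
    show "2 * Re (cnj c * ip f g) \<le> nsq f + (cmod c)\<^sup>2 * nsq g" for c
      using nsq_diff_cmult[OF assms, of c] nsq_nonneg[of "\<lambda>t. f t - c * g t"] by linarith
  qed (rule nsq_nonneg)
  then show ?thesis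
    unfolding real_sqrt_mult[symmetric] by (rule real_le_rsqrt)
qed

lemma nsq_bound:
  assumes "\<And>t. cmod (f t) \<le> C * (1 + \<bar>t\<bar>) powr (3/8)"
  shows "nsq f \<le> C\<^sup>2 * (LINT t|cauchy. (1 + \<bar>t\<bar>) powr (3/4))"
proof -
  have "nsq f \<le> (LINT t|cauchy. C\<^sup>2 * (1 + \<bar>t\<bar>) powr (3/4))"
    unfolding nsq_def
  proof (rule integral_mono')
    show "integrable cauchy (\<lambda>t. C\<^sup>2 * (1 + \<bar>t\<bar>) powr (3/4))"
      by (intro integrable_mult_right integrable_cauchy_powr) simp
    fix t
    have "(cmod (f t))\<^sup>2 \<le> (C * (1 + \<bar>t\<bar>) powr (3/8))\<^sup>2"
      by (intro power_mono assms) auto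
    also have "\<dots> = C\<^sup>2 * ((1 + \<bar>t\<bar>) powr (3/8) * (1 + \<bar>t\<bar>) powr (3/8))"
      by (simp add: power_mult_distrib power2_eq_square)
    also have "\<dots> = C\<^sup>2 * (1 + \<bar>t\<bar>) powr (3/4)" by (simp only: powr_add[symmetric]) simp
    finally show "(cmod (f t))\<^sup>2 \<le> C\<^sup>2 * (1 + \<bar>t\<bar>) powr (3/4)" .
  qed auto
  then show ?thesis by simp
qed

section \<open>Holomorphic dependence on a parameter\<close>

text \<open>Cauchy's inequality on discs of radius r inside one of radius 2r makes F Lipschitz in w
  with constant proportional to h t. This dominates the difference quotients, and dominated
  convergence along sequences gives the derivative.\<close>

lemma holomorphic_parametric_integral:
  fixes F :: "complex \<Rightarrow> 'a \<Rightarrow> complex"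
  assumes S: "open S" and hol: "\<And>t. (\<lambda>w. F w t) holomorphic_on S"
    and meas: "\<And>w. w \<in> S \<Longrightarrow> F w \<in> borel_measurable M"
    and h: "integrable M h"
    and dom: "\<And>Q. \<lbrakk>compact Q; Q \<subseteq> S\<rbrakk> \<Longrightarrow> \<exists>C. \<forall>w\<in>Q. \<forall>t. cmod (F w t) \<le> C * h t"
  shows "(\<lambda>w. LINT t|M. F w t) holomorphic_on S"
proof (rule holomorphic_onI, rule field_differentiable_at_within)
  fix w0 assume "w0 \<in> S"
  then obtain r' where "r' > 0" "cball w0 r' \<subseteq> S" using S open_contains_cball by blast
  define r where "r = r' / 2"
  have r: "r > 0" "cball w0 (2 * r) \<subseteq> S" using \<open>r' > 0\<close> \<open>cball w0 r' \<subseteq> S\<close> by (auto simp: r_def)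
  obtain C where C: "\<And>w t. w \<in> cball w0 (2 * r) \<Longrightarrow> cmod (F w t) \<le> C * h t"
    using dom[OF compact_cball r(2)] by blast
  define D where "D = (\<lambda>t. deriv (\<lambda>w. F w t) w0)"
  have lip: "cmod (F w t - F w0 t) \<le> (C * h t / r) * cmod (w - w0)" if "w \<in> cball w0 r" for w t
  proof (rule field_differentiable_bound[of "cball w0 r"])
    fix v assume v: "v \<in> cball w0 r"
    have sub: "cball v r \<subseteq> cball w0 (2 * r)" 
    proof
      fix y assume "y \<in> cball v r"
      then show "y \<in> cball w0 (2 * r)" using v dist_triangle[of w0 y v] by auto
    qed
    have "v \<in> S" using sub r by (meson centre_in_cball less_imp_le subsetD)
    then show "((\<lambda>w. F w t) has_field_derivative deriv (\<lambda>w. F w t) v) (at v within cball w0 r)"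
      using hol S by (meson has_field_derivative_at_within holomorphic_derivI)
    have "cmod ((deriv ^^ 1) (\<lambda>w. F w t) v) \<le> fact 1 * (C * h t) / r ^ 1"
    proof (rule Cauchy_inequality)
      show "(\<lambda>w. F w t) holomorphic_on ball v r"
        by (rule holomorphic_on_subset[OF hol]) (use sub r ball_subset_cball in blast)
      show "continuous_on (cball v r) (\<lambda>w. F w t)"
        by (rule continuous_on_subset[OF holomorphic_on_imp_continuous_on[OF hol]]) (use sub r in blast)
      show "cmod (F x t) \<le> C * h t" if "cmod (v - x) = r" for x
        using C[of x t] sub that by (auto simp: dist_norm)
    qed (use r in auto)
    then show "cmod (deriv (\<lambda>w. F w t) v) \<le> C * h t / r" by simp
  qed (use that r in auto)
  have "((\<lambda>w. ((LINT t|M. F w t) - (LINT t|M. F w0 t)) / (w - w0)) \<longlongrightarrow> (LINT t|M. D t)) (at w0)"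
    unfolding tendsto_at_iff_sequentially comp_def
  proof (intro allI impI)
    fix X assume X: "\<forall>i. X i \<in> UNIV - {w0}" "X \<longlonglongrightarrow> w0"
    have int: "integrable M (F w)" if "w \<in> cball w0 (2 * r)" for w
    proof (rule Bochner_Integration.integrable_bound[of M "\<lambda>t. C * h t"])
      show "F w \<in> borel_measurable M" using meas that r by blast
      show "AE t in M. cmod (F w t) \<le> norm (C * h t)"
        using C[OF that] by (intro AE_I2) (auto intro: order_trans[OF _ abs_ge_self])
    qed (intro integrable_mult_right h)
    have "\<forall>\<^sub>F i in sequentially. X i \<in> cball w0 r"
      using X(2) r(1) unfolding tendsto_iff by (auto simp: dist_commute elim!: allE[of _ r] eventually_mono)
    then obtain N where N: "\<And>i. i \<ge> N \<Longrightarrow> X i \<in> cball w0 r"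
      unfolding eventually_sequentially by blast
    \<comment> \<open>The shift by N discards the finitely many terms outside the disc, since
      domination is asked for every index.\<close>
    define q where "q = (\<lambda>i t. (F (X (i + N)) t - F w0 t) / (X (i + N) - w0))"
    have XN: "X (i + N) \<in> cball w0 r" "X (i + N) \<in> cball w0 (2 * r)" "X (i + N) \<noteq> w0" for i
      using N[of "i + N"] X(1) r(1) by auto
    have w0c: "w0 \<in> cball w0 (2 * r)" using r by simp
    have qlim: "(\<lambda>i. q i t) \<longlonglongrightarrow> D t" for t
    proof -
      have "((\<lambda>w. F w t) has_field_derivative D t) (at w0)"
        unfolding D_def using hol S \<open>w0 \<in> S\<close> by (meson holomorphic_derivI)
      then have "((\<lambda>w. (F w t - F w0 t) / (w - w0)) \<longlongrightarrow> D t) (at w0)"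
        by (simp add: has_field_derivative_iff)
      then have "(\<lambda>i. (F (X i) t - F w0 t) / (X i - w0)) \<longlonglongrightarrow> D t"
        using X unfolding tendsto_at_iff_sequentially comp_def by blast
      then show ?thesis unfolding q_def by (rule LIMSEQ_ignore_initial_segment)
    qed
    have qm: "q i \<in> borel_measurable M" for i
      unfolding q_def using subsetD[OF r(2) XN(2)] subsetD[OF r(2) w0c]
      by (intro borel_measurable_divide borel_measurable_diff meas) auto
    have Dm: "D \<in> borel_measurable M"
      by (rule borel_measurable_LIMSEQ_metric[OF qm qlim])
    have "(\<lambda>i. LINT t|M. q i t) \<longlonglongrightarrow> (LINT t|M. D t)"
    proof (rule integral_dominated_convergence[where w = "\<lambda>t. C * h t / r"])
      show "AE t in M. cmod (q i t) \<le> C * h t / r" for i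
      proof (rule AE_I2)
        fix t
        show "cmod (q i t) \<le> C * h t / r"
          using lip[OF XN(1)[of i], of t] XN(3)[of i] by (simp add: q_def norm_divide divide_le_eq)
      qed
    qed (use qm Dm qlim h in auto)
    moreover have "(LINT t|M. q i t) = ((LINT t|M. F (X (i + N)) t) - (LINT t|M. F w0 t)) / (X (i + N) - w0)" for i
      unfolding q_def using int[OF XN(2)[of i]] int[OF w0c] by simp
    ultimately have "(\<lambda>i. ((LINT t|M. F (X (i + N)) t) - (LINT t|M. F w0 t)) / (X (i + N) - w0)) \<longlonglongrightarrow> (LINT t|M. D t)"
      by simp
    then show "(\<lambda>i. ((LINT t|M. F (X i) t) - (LINT t|M. F w0 t)) / (X i - w0)) \<longlonglongrightarrow> (LINT t|M. D t)"
      by (rule LIMSEQ_offset)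
  qed
  then show "(\<lambda>w. LINT t|M. F w t) field_differentiable at w0"
    unfolding field_differentiable_def has_field_derivative_iff by blast
qed

section \<open>Holomorphic families and closed subspaces\<close>

lemma nsq_diff_le:
  assumes "f \<in> tempered" "g \<in> tempered"
  shows "nsq (\<lambda>t. f t - g t) \<le> 2 * nsq f + 2 * nsq g"
  using nsq_diff_cmult[OF assms, of 1] nsq_diff_cmult[OF assms, of "-1"] nsq_nonneg[of "\<lambda>t. f t - (-1) * g t"]
  by simp

text \<open>Tempered functions are not complete, so no exact orthogonal projection is at hand. If K
  w1 stays away from MM, near-minimal residuals \<open>b k\<close> replace it: they are
  asymptotically orthogonal to MM, the functions w \<mapsto> ip (K w) (b k) are holomorphic and
  locally bounded, and a Montel limit of them vanishes for Re w > c, hence at w1. But there its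
  value has real part at least the squared distance D.\<close>

lemma holomorphic_family_in_closure:
  fixes K :: "complex \<Rightarrow> real \<Rightarrow> complex" and MM :: "(real \<Rightarrow> complex) set"
  assumes MM: "MM \<subseteq> tempered" "(\<lambda>t. 0) \<in> MM" "\<And>f g c. \<lbrakk>f \<in> MM; g \<in> MM\<rbrakk> \<Longrightarrow> (\<lambda>t. f t + c * g t) \<in> MM"
    and meas: "\<And>w. Re w > 0 \<Longrightarrow> K w \<in> borel_measurable borel"
    and hol: "\<And>t. (\<lambda>w. K w t) holomorphic_on {w. Re w > 0}"
    and bd: "\<And>Q. \<lbrakk>compact Q; Q \<subseteq> {w. Re w > 0}\<rbrakk> \<Longrightarrow> \<exists>C. \<forall>w\<in>Q. \<forall>t. cmod (K w t) \<le> C * (1 + \<bar>t\<bar>) powr (3/8)"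
    and c: "c > 0" and far: "\<And>w e. \<lbrakk>Re w > c; e > 0\<rbrakk> \<Longrightarrow> \<exists>m\<in>MM. nsq (\<lambda>t. K w t - m t) < e"
    and w1: "Re w1 > 0" and e: "e > 0"
  shows "\<exists>m\<in>MM. nsq (\<lambda>t. K w1 t - m t) < e"
proof (rule ccontr)
  assume no: "\<not> (\<exists>m\<in>MM. nsq (\<lambda>t. K w1 t - m t) < e)"
  define S where "S = {w::complex. Re w > 0}"
  have S: "open S" "connected S"
    unfolding S_def by (intro open_halfspace_Re_gt convex_connected convex_halfspace_Re_gt)+
  have tempK: "K w \<in> tempered" if w: "Re w > 0" for w
  proof -
    obtain C where "\<And>t. cmod (K w t) \<le> C * (1 + \<bar>t\<bar>) powr (3/8)"
      using bd[of "{w}"] w by auto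
    then show ?thesis by (rule temperedI[OF meas[OF w]])
  qed
  have tempM: "m \<in> tempered" if "m \<in> MM" for m using that MM(1) by blast
  define N where "N = (\<lambda>m. nsq (\<lambda>t. K w1 t - m t)) ` MM"
  define D where "D = Inf N"
  have N: "N \<noteq> {}" "bdd_below N" using MM(2) nsq_nonneg unfolding N_def by (auto intro!: bdd_belowI[of _ 0])
  have "e \<le> D" unfolding D_def by (rule cInf_greatest[OF N(1)]) (use no in \<open>auto simp: N_def not_less\<close>)
  then have D: "D > 0" using e by simp
  have D_le: "D \<le> nsq (\<lambda>t. K w1 t - m t)" if "m \<in> MM" for m
    unfolding D_def by (rule cInf_lower[OF _ N(2)]) (use that in \<open>auto simp: N_def\<close>)
  have "\<exists>m\<in>MM. nsq (\<lambda>t. K w1 t - m t) < D + 1 / real (Suc k)" for k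
  proof -
    have "Inf N < D + 1 / real (Suc k)" by (simp add: D_def)
    then obtain x where "x \<in> N" "x < D + 1 / real (Suc k)" using cInf_lessD[OF N(1)] by blast
    then show ?thesis by (auto simp: N_def)
  qed
  then obtain m where m: "\<And>k. m k \<in> MM" "\<And>k. nsq (\<lambda>t. K w1 t - m k t) < D + 1 / real (Suc k)" by metis
  define b where "b = (\<lambda>k t. K w1 t - m k t)"
  have tempb: "b k \<in> tempered" for k
    unfolding b_def by (intro tempered_diff tempK w1 tempM m)
  have nb: "D \<le> nsq (b k)" "nsq (b k) \<le> D + 1 / real (Suc k)" "nsq (b k) \<le> D + 1" for k
  proof -
    show "D \<le> nsq (b k)" "nsq (b k) \<le> D + 1 / real (Suc k)"
      using D_le[OF m(1)] m(2)[of k] by (auto simp: b_def)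
    moreover have "1 / real (Suc k) \<le> 1" by simp
    ultimately show "nsq (b k) \<le> D + 1" by linarith
  qed
  \<comment> \<open>Changing \<open>m k\<close> by a multiple of f cannot go below the infimum D, so
    the quadratic in c is controlled by the gap \<open>nsq (b k) - D\<close>, at most 1/(k +
    1).\<close>
  have orth: "cmod (ip f (b k)) \<le> sqrt (nsq f / real (Suc k))" if f: "f \<in> MM" for f k
  proof -
    have "(cmod (ip (b k) f))\<^sup>2 \<le> (nsq (b k) - D) * nsq f"
    proof (rule quadratic_bound)
      fix c
      have "D \<le> nsq (\<lambda>t. K w1 t - (m k t + c * f t))"
        by (rule D_le[OF MM(3)[OF m(1) f]])
      also have "(\<lambda>t. K w1 t - (m k t + c * f t)) = (\<lambda>t. b k t - c * f t)" by (simp add: b_def algebra_simps)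
      also have "nsq \<dots> = nsq (b k) - 2 * Re (cnj c * ip (b k) f) + (cmod c)\<^sup>2 * nsq f"
        by (rule nsq_diff_cmult[OF tempb tempM[OF f]])
      finally show "2 * Re (cnj c * ip (b k) f) \<le> nsq (b k) - D + (cmod c)\<^sup>2 * nsq f" by simp
    qed (rule nsq_nonneg)
    also have "\<dots> \<le> (1 / real (Suc k)) * nsq f"
      using nb(2)[of k] by (intro mult_right_mono nsq_nonneg) simp
    finally have "(cmod (ip f (b k)))\<^sup>2 \<le> nsq f / real (Suc k)"
      by (subst ip_cnj) simp
    then show ?thesis by (rule real_le_rsqrt)
  qed
  have lim0: "(\<lambda>k. sqrt (B / real (Suc k))) \<longlonglongrightarrow> 0" for B
  proof -
    have "(\<lambda>k. sqrt (B * inverse (real (Suc k)))) \<longlonglongrightarrow> sqrt (B * 0)"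
      by (intro tendsto_intros LIMSEQ_inverse_real_of_nat)
    then show ?thesis by (simp add: divide_inverse)
  qed
  define \<psi> where "\<psi> = (\<lambda>k w. ip (K w) (b k))"
  have hol\<psi>: "\<psi> k holomorphic_on S" for k
    unfolding \<psi>_def ip_def
  proof (rule holomorphic_parametric_integral[OF S(1)])
    show "(\<lambda>w. K w t * cnj (b k t)) holomorphic_on S" for t
      using hol[of t] unfolding S_def by (intro holomorphic_intros)
    show "(\<lambda>t. K w t * cnj (b k t)) \<in> borel_measurable cauchy" if "w \<in> S" for w
      using integrable_ip[OF tempK tempb, of w k] that unfolding S_def by auto
    show "integrable cauchy (\<lambda>t. (1 + \<bar>t\<bar>) powr (3/4))" by (rule integrable_cauchy_powr) simp
    fix Q assume Q: "compact Q" "Q \<subseteq> S"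
    obtain C where C: "\<And>w t. w \<in> Q \<Longrightarrow> cmod (K w t) \<le> C * (1 + \<bar>t\<bar>) powr (3/8)"
      using bd[OF Q(1)] Q(2) unfolding S_def by blast
    obtain B where B: "B \<ge> 0" "\<And>t. cmod (b k t) \<le> B * (1 + \<bar>t\<bar>) powr (3/8)"
      using tempered_bound[OF tempb] by blast
    have "cmod (K w t * cnj (b k t)) \<le> (C * B) * (1 + \<bar>t\<bar>) powr (3/4)" if "w \<in> Q" for w t
    proof -
      have "C \<ge> 0" using order_trans[OF norm_ge_zero C[OF that, of 0]] by simp
      then show ?thesis by (rule norm_tempered_product_le[OF C[OF that] B(2)])
    qed
    then show "\<exists>C. \<forall>w\<in>Q. \<forall>t. cmod (K w t * cnj (b k t)) \<le> C * (1 + \<bar>t\<bar>) powr (3/4)" by blast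
  qed
  define J where "J = (LINT t|cauchy. (1 + \<bar>t\<bar>) powr (3/4))"
  have bd\<psi>: "\<exists>B. \<forall>h\<in>range \<psi>. \<forall>w\<in>Q. cmod (h w) \<le> B" if Q: "compact Q" "Q \<subseteq> S" for Q
  proof -
    obtain C where C: "\<And>w t. w \<in> Q \<Longrightarrow> cmod (K w t) \<le> C * (1 + \<bar>t\<bar>) powr (3/8)"
      using bd[OF Q(1)] Q(2) unfolding S_def by blast
    have "cmod (\<psi> k w) \<le> sqrt (C\<^sup>2 * J) * sqrt (D + 1)" if w: "w \<in> Q" for k w
    proof -
      have "Re w > 0" using w Q(2) by (auto simp: S_def)
      then have "cmod (\<psi> k w) \<le> sqrt (nsq (K w)) * sqrt (nsq (b k))"
        unfolding \<psi>_def by (rule ip_Cauchy_Schwarz[OF tempK tempb])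
      also have "\<dots> \<le> sqrt (C\<^sup>2 * J) * sqrt (D + 1)"
        using nsq_bound[OF C[OF w]] nb(3)[of k] nsq_nonneg[of "b k"] order_trans[OF nsq_nonneg nsq_bound[OF C[OF w]]] unfolding J_def
        by (intro mult_mono real_sqrt_le_mono) auto
      finally show ?thesis .
    qed
    then show ?thesis by blast
  qed
  obtain g r where g: "g holomorphic_on S" and r: "strict_mono (r :: nat \<Rightarrow> nat)"
    and lim: "\<And>w. w \<in> S \<Longrightarrow> (\<lambda>n. \<psi> (r n) w) \<longlonglongrightarrow> g w"
    by (rule Montel[OF S(1), of "range \<psi>" \<psi>]) (use hol\<psi> bd\<psi> in auto)
  have g_far: "g w = 0" if w: "Re w > c" for w
  proof -
    have wS: "w \<in> S" using w c by (simp add: S_def)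
    have "cmod (g w) \<le> \<epsilon>" if \<epsilon>: "\<epsilon> > 0" for \<epsilon>
    proof -
      \<comment> \<open>The number D + 1 bounds the squared norms of all residuals, so an error q in
        K w changes the pairing by at most \<epsilon>.\<close>
      define q where "q = (\<epsilon> / sqrt (D + 1))\<^sup>2"
      have "sqrt (D + 1) > 0" using D by simp
      then have q: "q > 0" "sqrt q * sqrt (D + 1) = \<epsilon>" using \<epsilon> by (auto simp: q_def)
      obtain f where f: "f \<in> MM" "nsq (\<lambda>t. K w t - f t) < q" using far[OF w q(1)] by blast
      have tKw: "K w \<in> tempered" using tempK w c by simp
      have "cmod (\<psi> k w) \<le> \<epsilon> + sqrt (nsq f / real (Suc k))" for k
      proof -
        have "\<psi> k w = ip (\<lambda>t. K w t - f t) (b k) + ip f (b k)"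
          unfolding \<psi>_def using ip_diff_left[OF tKw tempM[OF f(1)] tempb] by simp
        then have "cmod (\<psi> k w) \<le> cmod (ip (\<lambda>t. K w t - f t) (b k)) + cmod (ip f (b k))"
          by (simp add: norm_triangle_ineq)
        moreover have "cmod (ip (\<lambda>t. K w t - f t) (b k)) \<le> sqrt (nsq (\<lambda>t. K w t - f t)) * sqrt (nsq (b k))"
          by (rule ip_Cauchy_Schwarz[OF tempered_diff[OF tKw tempM[OF f(1)]] tempb])
        moreover have "\<dots> \<le> sqrt q * sqrt (D + 1)"
          using f(2) nb(3)[of k] nsq_nonneg[of "b k"] q(1) by (intro mult_mono real_sqrt_le_mono) auto
        ultimately show ?thesis using orth[OF f(1), of k] q(2) by linarith
      qed
      then have "\<forall>n\<ge>0. cmod (\<psi> (r n) w) \<le> \<epsilon> + sqrt (nsq f / real (Suc (r n)))" by blast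
      moreover have "(\<lambda>n. \<epsilon> + sqrt (nsq f / real (Suc (r n)))) \<longlonglongrightarrow> \<epsilon> + 0"
        by (intro tendsto_add tendsto_const LIMSEQ_subseq_LIMSEQ[OF lim0 r, unfolded comp_def])
      ultimately have "cmod (g w) \<le> \<epsilon> + 0"
        using LIMSEQ_le[OF tendsto_norm[OF lim[OF wS]]] by blast
      then show ?thesis by simp
    qed
    then show ?thesis by (metis field_le_epsilon add_0 norm_le_zero_iff)
  qed
  have "g w1 = (\<lambda>_. 0) w1"
  proof (rule analytic_continuation_open[where s = "{w. Re w > c}" and s' = S and f = g and g = "\<lambda>_. 0"])
    show "{w. Re w > c} \<noteq> {}" by (auto intro!: exI[of _ "of_real (c + 1)"])
    show "{w. Re w > c} \<subseteq> S" using c by (auto simp: S_def)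
  qed (use S g g_far w1 in \<open>auto simp: S_def open_halfspace_Re_gt\<close>)
  then have "(\<lambda>n. \<psi> (r n) w1) \<longlonglongrightarrow> 0" using lim[of w1] w1 by (simp add: S_def)
  then have re: "(\<lambda>n. Re (\<psi> (r n) w1)) \<longlonglongrightarrow> 0" using tendsto_Re by fastforce
  define B where "B = 2 * nsq (K w1) + 2 * (D + 1)"
  \<comment> \<open>Since K w1 = b k + m k, the pairing is \<open>nsq (b k)\<close> >= D plus a term
    with \<open>m k\<close> in MM, which is small because the \<open>m k\<close> are bounded in
    norm.\<close>
  have "D \<le> Re (\<psi> k w1) + sqrt (B / real (Suc k))" for k
  proof -
    have tKw: "K w1 \<in> tempered" using tempK w1 by simp
    have mb: "(\<lambda>t. K w1 t - b k t) = m k" by (simp add: b_def)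
    have "\<psi> k w1 = ip (\<lambda>t. b k t + m k t) (b k)" by (simp add: \<psi>_def b_def)
    also have "\<dots> = of_real (nsq (b k)) + ip (m k) (b k)"
      by (simp add: ip_add_left[OF tempb tempM[OF m(1)] tempb] ip_self)
    finally have "Re (\<psi> k w1) = nsq (b k) + Re (ip (m k) (b k))" by simp
    moreover have "\<bar>Re (ip (m k) (b k))\<bar> \<le> sqrt (nsq (m k) / real (Suc k))"
      using order_trans[OF abs_Re_le_cmod orth[OF m(1)]] .
    moreover have "nsq (m k) \<le> B"
      using nsq_diff_le[OF tKw tempb[of k]] nb(3)[of k] unfolding mb B_def by simp
    then have "sqrt (nsq (m k) / real (Suc k)) \<le> sqrt (B / real (Suc k))"
      by (intro real_sqrt_le_mono divide_right_mono) auto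
    ultimately show ?thesis using nb(1)[of k] by linarith
  qed
  then have "\<forall>n\<ge>0. D \<le> Re (\<psi> (r n) w1) + sqrt (B / real (Suc (r n)))" by blast
  moreover have "(\<lambda>n. Re (\<psi> (r n) w1) + sqrt (B / real (Suc (r n)))) \<longlonglongrightarrow> 0 + 0"
    by (intro tendsto_add re LIMSEQ_subseq_LIMSEQ[OF lim0 r, unfolded comp_def])
  ultimately have "D \<le> 0 + 0" by (meson LIMSEQ_le_const)
  then show False using D by simp
qed

section \<open>Dirichlet polynomials\<close>

text \<open>The rules mirror linear combinations, so that statements linear in P reduce to
  monomials; closure under products is derived.\<close>

inductive dirichlet_poly :: "(complex \<Rightarrow> complex) \<Rightarrow> bool" where
  monomial: "n > 0 \<Longrightarrow> dirichlet_poly (\<lambda>s. c * of_nat n powr (- s))"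
| add: "dirichlet_poly P \<Longrightarrow> dirichlet_poly Q \<Longrightarrow> dirichlet_poly (\<lambda>s. P s + Q s)"

lemma dirichlet_poly_const: "dirichlet_poly (\<lambda>s. c)"
  using monomial[of 1 c] by simp

lemma dirichlet_poly_sum: "(\<And>i. i \<in> I \<Longrightarrow> dirichlet_poly (P i)) \<Longrightarrow> dirichlet_poly (\<lambda>s. \<Sum>i\<in>I. P i s)"
  by (induction I rule: infinite_finite_induct) (auto intro: dirichlet_poly_const dirichlet_poly.add)

lemma dirichlet_poly_mult:
  assumes "dirichlet_poly P" "dirichlet_poly Q"
  shows "dirichlet_poly (\<lambda>s. P s * Q s)"
  using assms
proof (induction arbitrary: Q)
  case (monomial m c)
  from \<open>dirichlet_poly Q\<close> show ?case
  proof induction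
    case (monomial n d)
    have "(\<lambda>s. c * of_nat m powr (- s) * (d * of_nat n powr (- s))) = (\<lambda>s. (c * d) * of_nat (m * n) powr (- s))"
      by (rule ext) (simp only: of_nat_mult_powr mult_ac)
    moreover have "m * n > 0" using \<open>m > 0\<close> \<open>n > 0\<close> by simp
    ultimately show ?case using dirichlet_poly.monomial by metis
  qed (simp add: distrib_left dirichlet_poly.add)
qed (simp add: distrib_right dirichlet_poly.add)

lemma dirichlet_poly_power: "dirichlet_poly P \<Longrightarrow> dirichlet_poly (\<lambda>s. P s ^ n)"
  by (induction n) (auto intro: dirichlet_poly_const dirichlet_poly_mult)

lemma zeta_approx_dirichlet_poly:
  assumes "\<epsilon> > 0"
  obtains P where "dirichlet_poly P" "\<And>s. Re s \<ge> 3 \<Longrightarrow> cmod (zeta s - P s) \<le> \<epsilon>"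
proof -
  let ?a = "\<lambda>n. real (Suc n) powr (- 3)"
  have sa: "summable ?a" by (rule summable_Suc_powr) simp
  obtain N where N: "norm (\<Sum>i. ?a (i + N)) < \<epsilon>" using suminf_exist_split[OF assms sa] by blast
  show ?thesis
  proof
    have "dirichlet_poly (\<lambda>s. 1 * of_nat (Suc n) powr (- s))" for n by (rule monomial) simp
    then show "dirichlet_poly (\<lambda>s. \<Sum>n<N. 1 * of_nat (Suc n) powr (- s))"
      by (intro dirichlet_poly_sum)
    fix s :: complex assume s: "Re s \<ge> 3"
    have sm: "summable (\<lambda>n. of_nat (Suc n) powr (- s))" by (rule summable_dirichlet) (use s in simp)
    have "zeta s = (\<Sum>n. of_nat (Suc n) powr (- s))"
      using s by (simp add: zeta_eq_dirichlet_zeta dirichlet_zeta_altdef)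
    also have "\<dots> = (\<Sum>n. of_nat (Suc (n + N)) powr (- s)) + (\<Sum>n<N. of_nat (Suc n) powr (- s))"
      by (rule suminf_split_initial_segment[OF sm])
    finally have "zeta s - (\<Sum>n<N. 1 * of_nat (Suc n) powr (- s)) = (\<Sum>n. of_nat (Suc (n + N)) powr (- s))" by simp
    also have "cmod \<dots> \<le> (\<Sum>n. ?a (n + N))"
    proof (rule norm_suminf_le)
      show "summable (\<lambda>n. ?a (n + N))" using sa by (rule summable_ignore_initial_segment)
      show "cmod (of_nat (Suc (n + N)) powr (- s)) \<le> ?a (n + N)" for n
        unfolding norm_Suc_powr using s by (intro powr_mono) auto
    qed
    also have "\<dots> \<le> \<epsilon>" using N by simp
    finally show "cmod (zeta s - (\<Sum>n<N. 1 * of_nat (Suc n) powr (- s))) \<le> \<epsilon>" .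
  qed
qed

text \<open>With \<open>P\<close> close to \<open>1 - zeta\<close>, the geometric sums of \<open>P\<close> approximate \<open>1 / (1 - P)\<close>,
  hence \<open>1 / zeta\<close>.\<close>

lemma inverse_zeta_approx_dirichlet_poly:
  assumes "\<epsilon> > 0"
  obtains P where "dirichlet_poly P" "\<And>s. Re s \<ge> 3 \<Longrightarrow> cmod (1 / zeta s - P s) \<le> \<epsilon>"
proof -
  \<comment> \<open>The 1/4 keeps |P| <= 1/2 + 1/4 = 3/4; the \<epsilon>/16 absorbs the factor 8 by
    which 1/(zeta * (1 - P)) can enlarge the error.\<close>
  define e where "e = min (1/4) (\<epsilon> / 16)"
  have e: "e > 0" "e \<le> 1/4" "8 * e \<le> \<epsilon> / 2" using assms by (auto simp: e_def)
  obtain R where R: "dirichlet_poly R" "\<And>s. Re s \<ge> 3 \<Longrightarrow> cmod (zeta s - R s) \<le> e"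
    using zeta_approx_dirichlet_poly[OF e(1)] by blast
  define P where "P = (\<lambda>s. 1 + (-1) * R s)"
  have P: "dirichlet_poly P"
    unfolding P_def by (intro dirichlet_poly.add dirichlet_poly_mult dirichlet_poly_const R(1))
  have "(\<lambda>n. 4 * (3/4 :: real) ^ n) \<longlonglongrightarrow> 4 * 0" by (intro tendsto_intros LIMSEQ_realpow_zero) auto
  then have "\<forall>\<^sub>F n in sequentially. 4 * (3/4 :: real) ^ n < \<epsilon> / 2"
    using order_tendstoD(2)[of "\<lambda>n. 4 * (3/4 :: real) ^ n" 0 sequentially "\<epsilon> / 2"] assms by simp
  then obtain J where J: "4 * (3/4 :: real) ^ J < \<epsilon> / 2" by (auto simp: eventually_sequentially)
  show ?thesis
  proof (rule that[of "\<lambda>s. \<Sum>j<J. P s ^ j"])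
    show "dirichlet_poly (\<lambda>s. \<Sum>j<J. P s ^ j)" by (intro dirichlet_poly_sum dirichlet_poly_power P)
    fix s assume s: "Re s \<ge> 3"
    have "P s = (1 - zeta s) + (zeta s - R s)" by (simp add: P_def)
    then have "cmod (P s) \<le> cmod (1 - zeta s) + cmod (zeta s - R s)" by (metis norm_triangle_ineq)
    moreover have "cmod (1 - zeta s) \<le> 1/2" using norm_zeta_minus_1_le[OF s] by (simp add: norm_minus_commute)
    ultimately have P34: "cmod (P s) \<le> 3/4" using R(2)[OF s] e by linarith
    then have P14: "1/4 \<le> cmod (1 - P s)" using norm_triangle_ineq2[of 1 "P s"] by simp
    have z12: "1/2 \<le> cmod (zeta s)" using norm_triangle_ineq2[of 1 "1 - zeta s"] \<open>cmod (1 - zeta s) \<le> 1/2\<close> by simp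
    have nz: "1 - P s \<noteq> 0" "zeta s \<noteq> 0" "P s \<noteq> 1" using P14 z12 by auto
    have "1 / zeta s - (\<Sum>j<J. P s ^ j) = (1 / zeta s - 1 / (1 - P s)) + (1 / (1 - P s) - (\<Sum>j<J. P s ^ j))" by simp
    also have "1 / zeta s - 1 / (1 - P s) = (R s - zeta s) / (zeta s * (1 - P s))"
      using nz by (simp add: P_def field_simps)
    also have "1 / (1 - P s) - (\<Sum>j<J. P s ^ j) = P s ^ J / (1 - P s)"
      using nz by (subst sum_gp_strict) (simp add: field_simps)
    also have "cmod ((R s - zeta s) / (zeta s * (1 - P s)) + P s ^ J / (1 - P s)) \<le>
        cmod (R s - zeta s) / (cmod (zeta s) * cmod (1 - P s)) + cmod (P s) ^ J / cmod (1 - P s)"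
      by (rule order_trans[OF norm_triangle_ineq]) (simp add: norm_mult norm_divide norm_power)
    also have "\<dots> \<le> e / (1/2 * (1/4)) + (3/4) ^ J / (1/4)"
      using R(2)[OF s] P34 P14 z12 e by (intro add_mono frac_le mult_mono power_mono) (auto simp: norm_minus_commute)
    also have "\<dots> \<le> \<epsilon>" using e J by simp
    finally show "cmod (1 / zeta s - (\<Sum>j<J. P s ^ j)) \<le> \<epsilon>" .
  qed
qed

section \<open>Mellin transforms on the critical line\<close>

abbreviation crit :: "real \<Rightarrow> complex" where
  "crit t \<equiv> Complex (1/2) t"

lemma continuous_crit: "continuous_on A crit"
  by (intro continuous_intros)

lemma borel_measurable_powr_crit: "(\<lambda>t. of_nat n powr (- crit t) :: complex) \<in> borel_measurable borel"
proof (cases "n = 0")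
  case False
  then show ?thesis
    by (intro borel_measurable_continuous_onI continuous_intros continuous_crit) auto
qed simp

lemma norm_powr_crit_le: "cmod (of_nat n powr (- crit t)) \<le> 1"
proof (cases n)
  case (Suc k)
  have "cmod (of_nat (Suc k) powr (- crit t)) = real (Suc k) powr (- (1/2))"
    by (subst norm_Suc_powr) simp
  also have "\<dots> \<le> real (Suc k) powr 0" by (intro powr_mono) auto
  finally show ?thesis using Suc by (simp del: of_nat_Suc)
qed simp

lemma tempered_powr_crit: "(\<lambda>t. of_nat n powr (- crit t)) \<in> tempered"
  by (rule tempered_bounded[OF borel_measurable_powr_crit norm_powr_crit_le])

text \<open>With m, n for the successors of j, k, the integrand is (m n)^(-1/2) exp(i t ln(n/m)),
  and the characteristic function of \<open>cauchy\<close> at ln(n/m) is (min/max)^(1/2). The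
  product is 1/max.\<close>

lemma ip_powr_crit:
  "ip (\<lambda>t. of_nat (Suc j) powr (- crit t)) (\<lambda>t. of_nat (Suc k) powr (- crit t)) = of_real (1 / real (Suc (max j k)))"
proof -
  define a b where "a = ln (real (Suc j))" and "b = ln (real (Suc k))"
  have pw: "of_nat (Suc n) powr (- crit t) = exp (- crit t * of_real (ln (real (Suc n))))" for n t
    by (simp add: powr_def Ln_of_nat del: of_nat_Suc)
  have "of_nat (Suc j) powr (- crit t) * cnj (of_nat (Suc k) powr (- crit t)) =
      of_real (exp (- (a + b) / 2)) * exp (\<i> * of_real ((b - a) * t))" for t
  proof -
    have "of_nat (Suc j) powr (- crit t) * cnj (of_nat (Suc k) powr (- crit t)) =
        exp (- crit t * of_real a + cnj (- crit t * of_real b))"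
      unfolding pw a_def b_def exp_cnj exp_add ..
    also have "- crit t * of_real a + cnj (- crit t * of_real b) = of_real (- (a + b) / 2) + \<i> * of_real ((b - a) * t)"
      by (simp add: complex_eq_iff algebra_simps)
    also have "exp \<dots> = of_real (exp (- (a + b) / 2)) * exp (\<i> * of_real ((b - a) * t))"
      by (simp only: exp_add exp_of_real)
    finally show ?thesis .
  qed
  then have "ip (\<lambda>t. of_nat (Suc j) powr (- crit t)) (\<lambda>t. of_nat (Suc k) powr (- crit t)) =
      of_real (exp (- (a + b) / 2)) * of_real (exp (- \<bar>b - a\<bar> / 2))"
    unfolding ip_def by (simp only: integral_mult_right_zero cauchy_fourier)
  also have "\<dots> = of_real (exp (- max a b))"
    by (simp only: of_real_mult[symmetric] exp_add[symmetric]) (simp add: max_def abs_if field_simps)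
  also have "max a b = ln (real (Suc (max j k)))"
    by (auto simp: a_def b_def max_def)
  also have "exp (- ln (real (Suc (max j k)))) = 1 / real (Suc (max j k))"
    by (simp add: exp_minus inverse_eq_divide del: of_nat_Suc)
  finally show ?thesis .
qed

section \<open>The orthogonal system of transformed unit vectors\<close>

abbreviation ehat :: "nat \<Rightarrow> real \<Rightarrow> complex" where
  "ehat k t \<equiv> dpow k (crit t)"

lemma tempered_ehat: "ehat k \<in> tempered"
  unfolding dpow_def by (intro tempered_diff tempered_powr_crit)

lemma ip_powr_ehat:
  "ip (\<lambda>t. of_nat (Suc j) powr (- crit t)) (ehat k) = (if j \<le> k then of_real (1 / weight (Suc k)) else 0)"
proof -
  have "ip (\<lambda>t. of_nat (Suc j) powr (- crit t)) (ehat k) =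
      of_real (1 / real (Suc (max j k)) - 1 / real (Suc (max j (Suc k))))"
    unfolding dpow_def ip_diff_right[OF tempered_powr_crit tempered_powr_crit tempered_powr_crit] ip_powr_crit by simp
  moreover have "1 / real (Suc k) - 1 / real (Suc (Suc k)) = 1 / weight (Suc k)"
    by (simp add: field_simps)
  ultimately show ?thesis
    by (cases "j \<le> k") (simp_all only: max_absorb2 le_SucI if_True, simp add: max_def)
qed

text \<open>Differencing 1/max in both variables leaves only the diagonal. The value 1/weight is the
  squared norm of the unit sequence at \<open>Suc k\<close>, so the transform preserves the geometry
  of coordinate vectors.\<close>

lemma ip_ehat_ehat: "ip (ehat j) (ehat k) = (if j = k then of_real (1 / weight (Suc k)) else 0)"
proof -
  have "ip (ehat j) (ehat k) = (if j \<le> k then of_real (1 / weight (Suc k)) else 0) -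
      (if Suc j \<le> k then of_real (1 / weight (Suc k)) else 0)"
    unfolding ip_powr_ehat[symmetric]
    using ip_diff_left[OF tempered_powr_crit tempered_powr_crit tempered_ehat, of "Suc j" "Suc (Suc j)" k]
    by (simp only: dpow_def)
  then show ?thesis by auto
qed

text \<open>Projections are removed one at a time; the induction carries along that the residual R
  keeps the coefficients from N onwards.\<close>

lemma Bessel_ehat:
  assumes F: "F \<in> tempered"
  shows "(\<Sum>k<N. weight (Suc k) * (cmod (ip F (ehat k)))\<^sup>2) \<le> nsq F"
proof -
  have "\<exists>R\<in>tempered. (\<forall>j\<ge>N. ip R (ehat j) = ip F (ehat j)) \<and>
      nsq R = nsq F - (\<Sum>k<N. weight (Suc k) * (cmod (ip F (ehat k)))\<^sup>2)"
  proof (induction N)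
    case 0
    then show ?case using F by auto
  next
    case (Suc N)
    then obtain R where R: "R \<in> tempered" "\<And>j. j \<ge> N \<Longrightarrow> ip R (ehat j) = ip F (ehat j)"
      "nsq R = nsq F - (\<Sum>k<N. weight (Suc k) * (cmod (ip F (ehat k)))\<^sup>2)" by blast
    define w where "w = weight (Suc N)"
    define p where "p = ip F (ehat N)"
    define c where "c = of_real w * p"
    have w: "w > 0" by (simp add: w_def)
    have ne: "nsq (ehat N) = 1 / w"
      using ip_self[of "ehat N"] ip_ehat_ehat[of N N] unfolding w_def by (simp only: if_True refl of_real_eq_iff)
    have "nsq (\<lambda>t. R t - c * ehat N t) = nsq R - 2 * Re (cnj c * p) + (cmod c)\<^sup>2 * (1 / w)"
      using nsq_diff_cmult[OF R(1) tempered_ehat[of N], of c] R(2)[of N] ne by (simp add: p_def)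
    also have "cnj c * p = of_real (w * (cmod p)\<^sup>2)"
      unfolding c_def of_real_mult complex_norm_square by simp
    also have "(cmod c)\<^sup>2 * (1 / w) = w * (cmod p)\<^sup>2"
      using w by (simp add: c_def norm_mult power_mult_distrib power2_eq_square)
    finally have "nsq (\<lambda>t. R t - c * ehat N t) = nsq R - w * (cmod p)\<^sup>2" by simp
    moreover have "ip (\<lambda>t. R t - c * ehat N t) (ehat j) = ip F (ehat j)" if "j \<ge> Suc N" for j
      using that R(2)[of j] ip_ehat_ehat[of N j]
      by (simp add: ip_diff_left[OF R(1) tempered_cmult[OF tempered_ehat] tempered_ehat] ip_cmult_left)
    moreover have "(\<lambda>t. R t - c * ehat N t) \<in> tempered"
      by (intro tempered_diff R tempered_cmult tempered_ehat)
    ultimately show ?case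
      using R(3) by (intro bexI[of _ "\<lambda>t. R t - c * ehat N t"]) (auto simp: w_def p_def)
  qed
  then obtain R where "nsq R = nsq F - (\<Sum>k<N. weight (Suc k) * (cmod (ip F (ehat k)))\<^sup>2)" by blast
  then show ?thesis using nsq_nonneg[of R] by linarith
qed

text \<open>\<open>ehat k\<close> is the transform of the unit vector at index \<open>Suc k\<close>; \<open>represents f x\<close> says that \<open>f\<close>
  is the transform of \<open>x\<close>, expressed through the coefficients with respect to this orthogonal system.\<close>

definition represents :: "(real \<Rightarrow> complex) \<Rightarrow> hseq \<Rightarrow> bool" where
  "represents f x \<longleftrightarrow> f \<in> tempered \<and> (\<forall>k. ip f (ehat k) = coord x (Suc k) / of_real (weight (Suc k)))"

lemma represents_add_cmult:
  assumes "represents f x" "represents g y"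
  shows "represents (\<lambda>t. f t + c * g t) (x + cscale c y)"
  using assms unfolding represents_def
  by (auto simp: tempered_add tempered_cmult ip_add_left tempered_ehat ip_cmult_left add_divide_distrib)

lemma represents_0: "represents (\<lambda>t. 0) 0"
  by (simp add: represents_def tempered_0 ip_def)

lemma represents_one_seq: "represents (\<lambda>t. 1) one_seq"
proof -
  have 1: "(\<lambda>t. of_nat (Suc 0) powr (- crit t) :: complex) = (\<lambda>t. 1)" by simp
  show ?thesis
    using tempered_powr_crit[of "Suc 0"] ip_powr_ehat[of 0]
    unfolding represents_def 1 by (simp add: coord_one_seq)
qed

text \<open>Bessel's inequality for the system \<open>ehat\<close>. It transfers approximation on
  the critical line back to approximation of sequences.\<close>

lemma norm_le_of_represents:
  assumes "represents f x"
  shows "(norm x)\<^sup>2 \<le> nsq f"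
proof -
  have f: "f \<in> tempered" and eq: "ip f (ehat k) = coord x (Suc k) / of_real (weight (Suc k))" for k
    using assms by (auto simp: represents_def)
  have "(\<lambda>k. (cmod (coord x (Suc k)))\<^sup>2 / weight (Suc k)) sums (norm x)\<^sup>2"
    using weighted_sums_norm[of x] by (subst sums_Suc_iff) auto
  moreover have "weight (Suc k) * (cmod (ip f (ehat k)))\<^sup>2 = (cmod (coord x (Suc k)))\<^sup>2 / weight (Suc k)" for k
  proof -
    have w: "weight (Suc k) > 0" by simp
    have "cmod (ip f (ehat k)) = cmod (coord x (Suc k)) / weight (Suc k)"
      unfolding eq norm_divide norm_of_real using w by (simp only: abs_of_pos)
    then show ?thesis using w by (simp add: power_divide power2_eq_square del: of_nat_Suc)
  qed
  ultimately have "(\<lambda>N. \<Sum>k<N. weight (Suc k) * (cmod (ip f (ehat k)))\<^sup>2) \<longlonglongrightarrow> (norm x)\<^sup>2"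
    by (simp only: sums_def)
  then show ?thesis
    by (rule LIMSEQ_le_const2) (use Bessel_ehat[OF f] in blast)
qed

section \<open>Transforms of the fractional part sequences\<close>

definition ghat :: "nat \<Rightarrow> real \<Rightarrow> complex" where
  "ghat l t = zeta (crit t) * (1 / of_nat l - of_nat l powr (- crit t))"

lemma continuous_zeta_crit: "continuous_on A (\<lambda>t. zeta (crit t))"
  by (rule continuous_on_compose2[OF holomorphic_on_imp_continuous_on[OF holomorphic_zeta] continuous_crit])
     (auto simp: complex_eq_iff)

text \<open>Interpolates the mean value bound |s| n^(-3/2) and the trivial bound 2 n^(-1/2) with
  exponents 3/4 and 1/4. The first alone grows too fast in t to be integrable, the second is not
  summable in n; the mixture n^(-5/4) |t|^(3/4) is both.\<close>

lemma norm_ehat_le: "cmod (ehat k t) \<le> 2 * (1 + \<bar>t\<bar>) powr (3/4) * real (Suc k) powr (- (5/4))"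
proof -
  define n where "n = real (Suc k)"
  define x where "x = cmod (ehat k t)"
  have n: "n \<ge> 1" by (simp add: n_def)
  have "cmod (crit t) \<le> 1 + \<bar>t\<bar>" using cmod_le[of "crit t"] by simp
  then have "cmod (crit t) * n powr (- (3/2)) \<le> (1 + \<bar>t\<bar>) * n powr (- (3/2))"
    by (intro mult_right_mono) auto
  moreover have "x \<le> cmod (crit t) * n powr (- (3/2))"
    using norm_dpow_le[of "crit t" k] by (simp add: x_def n_def)
  ultimately have "x \<le> (1 + \<bar>t\<bar>) * n powr (- (3/2))" by linarith
  then have 1: "x powr (3/4) \<le> (1 + \<bar>t\<bar>) powr (3/4) * n powr (- (9/8))"
    using powr_mono2[of "3/4" x "(1 + \<bar>t\<bar>) * n powr (- (3/2))"] unfolding x_def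
    by (simp add: powr_mult powr_powr)
  have "x \<le> cmod (of_nat (Suc k) powr (- crit t)) + cmod (of_nat (Suc (Suc k)) powr (- crit t))"
    unfolding x_def dpow_def by (rule norm_triangle_ineq4)
  also have "\<dots> = n powr (- (1/2)) + (n + 1) powr (- (1/2))"
    unfolding norm_Suc_powr n_def by simp
  also have "\<dots> \<le> 2 * n powr (- (1/2))"
    using powr_mono2'[of "-(1/2)" n "n + 1"] n by simp
  finally have "x powr (1/4) \<le> (2 * n powr (- (1/2))) powr (1/4)"
    unfolding x_def by (intro powr_mono2) auto
  also have "\<dots> = 2 powr (1/4) * n powr (- (1/8))" by (simp add: powr_mult powr_powr)
  also have "\<dots> \<le> 2 * n powr (- (1/8))"
    using powr_mono[of "1/4" 1 "2::real"] by (intro mult_right_mono) auto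
  finally have 2: "x powr (1/4) \<le> 2 * n powr (- (1/8))" .
  have "x = x powr (3/4) * x powr (1/4)" by (simp add: powr_add[symmetric] x_def)
  also have "\<dots> \<le> ((1 + \<bar>t\<bar>) powr (3/4) * n powr (- (9/8))) * (2 * n powr (- (1/8)))"
    by (intro mult_mono 1 2) auto
  also have "\<dots> = 2 * (1 + \<bar>t\<bar>) powr (3/4) * (n powr (- (9/8)) * n powr (- (1/8)))" by simp
  also have "n powr (- (9/8)) * n powr (- (1/8)) = n powr (- (5/4))" by (simp add: powr_add[symmetric])
  finally show ?thesis unfolding x_def n_def .
qed

text \<open>By \<open>frac_dirichlet_sums\<close>, \<open>ghat l\<close> is the pointwise limit of
  the partial sums \<open>G N\<close> in the orthogonal system. Domination comes from
  \<open>norm_ehat_le\<close> and not from growth of zeta, so the coefficients are known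
  unconditionally.\<close>

lemma ip_ghat:
  assumes "l > 0"
  shows "ip (ghat l) (ehat j) = coord (frac_seq l) (Suc j) / of_real (weight (Suc j))"
proof -
  define A where "A = (\<lambda>k. complex_of_real (frac (real (Suc k) / real l)))"
  have A1: "cmod (A k) \<le> 1" for k by (simp add: A_def less_imp_le[OF frac_lt_1])
  define G where "G = (\<lambda>N t. \<Sum>k<N. A k * ehat k t)"
  have tG: "G N \<in> tempered" for N
    unfolding G_def by (intro tempered_sum tempered_cmult tempered_ehat)
  have ipG: "ip (G N) (ehat j) = A j / of_real (weight (Suc j))" if "N > j" for N
  proof -
    have "ip (G N) (ehat j) = (\<Sum>k<N. A k * ip (ehat k) (ehat j))"
      unfolding G_def by (subst ip_sum_left) (auto intro: tempered_cmult tempered_ehat simp: ip_cmult_left)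
    also have "\<dots> = (\<Sum>k<N. if k = j then A j * of_real (1 / weight (Suc j)) else 0)"
      by (rule sum.cong[OF refl]) (simp add: ip_ehat_ehat del: of_nat_Suc of_real_divide)
    also have "\<dots> = A j / of_real (weight (Suc j))" using that by (simp add: sum.delta)
    finally show ?thesis .
  qed
  let ?b = "\<lambda>k. real (Suc k) powr (- (5/4))"
  have sb: "summable ?b" by (rule summable_Suc_powr) simp
  define C where "C = suminf ?b"
  have Gb: "cmod (G N t) \<le> 2 * C * (1 + \<bar>t\<bar>) powr (3/4)" for N t
  proof -
    have "cmod (G N t) \<le> (\<Sum>k<N. cmod (A k) * cmod (ehat k t))"
      unfolding G_def norm_mult[symmetric] by (rule norm_sum)
    also have "\<dots> \<le> (\<Sum>k<N. 1 * (2 * (1 + \<bar>t\<bar>) powr (3/4) * ?b k))"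
      by (intro sum_mono mult_mono A1 norm_ehat_le) auto
    also have "\<dots> = 2 * (1 + \<bar>t\<bar>) powr (3/4) * (\<Sum>k<N. ?b k)"
      by (simp only: mult_1 sum_distrib_left)
    also have "\<dots> \<le> 2 * (1 + \<bar>t\<bar>) powr (3/4) * C"
      unfolding C_def by (intro mult_left_mono sum_le_suminf[OF sb]) auto
    finally show ?thesis by (simp add: mult_ac)
  qed
  have C0: "C \<ge> 0" unfolding C_def by (rule suminf_nonneg[OF sb]) simp
  have "(\<lambda>N. ip (G N) (ehat j)) \<longlonglongrightarrow> ip (ghat l) (ehat j)"
    unfolding ip_def
  proof (rule integral_dominated_convergence[where w = "\<lambda>t. 4 * C * (1 + \<bar>t\<bar>) powr (3/4)"])
    have "ghat l \<in> borel_measurable borel"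
      unfolding ghat_def
      by (intro borel_measurable_times borel_measurable_diff borel_measurable_powr_crit
            borel_measurable_continuous_onI[OF continuous_zeta_crit]) auto
    then show "(\<lambda>t. ghat l t * cnj (ehat j t)) \<in> borel_measurable cauchy"
      using tempered_ehat[of j] by measurable
    show "(\<lambda>t. G N t * cnj (ehat j t)) \<in> borel_measurable cauchy" for N
      using tG[of N] tempered_ehat[of j] by measurable
    show "integrable cauchy (\<lambda>t. 4 * C * (1 + \<bar>t\<bar>) powr (3/4))"
      by (intro integrable_mult_right integrable_cauchy_powr) simp
    show "AE t in cauchy. (\<lambda>N. G N t * cnj (ehat j t)) \<longlonglongrightarrow> ghat l t * cnj (ehat j t)"
    proof (rule AE_I2)
      fix t
      have "crit t \<noteq> 1" by (auto simp: complex_eq_iff)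
      then have "(\<lambda>N. G N t) \<longlonglongrightarrow> ghat l t"
        using frac_dirichlet_sums[OF assms, of "crit t"] by (simp add: sums_def G_def A_def ghat_def)
      then show "(\<lambda>N. G N t * cnj (ehat j t)) \<longlonglongrightarrow> ghat l t * cnj (ehat j t)"
        by (intro tendsto_intros)
    qed
    show "AE t in cauchy. cmod (G N t * cnj (ehat j t)) \<le> 4 * C * (1 + \<bar>t\<bar>) powr (3/4)" for N
    proof (rule AE_I2)
      fix t
      have "cmod (ehat j t) \<le> 2"
        using norm_triangle_ineq4[of "of_nat (Suc j) powr (- crit t)" "of_nat (Suc (Suc j)) powr (- crit t)"]
          norm_powr_crit_le[of "Suc j" t] norm_powr_crit_le[of "Suc (Suc j)" t]
        unfolding dpow_def by linarith
      then have "cmod (G N t) * cmod (ehat j t) \<le> (2 * C * (1 + \<bar>t\<bar>) powr (3/4)) * 2"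
        using C0 by (intro mult_mono Gb) auto
      then show "cmod (G N t * cnj (ehat j t)) \<le> 4 * C * (1 + \<bar>t\<bar>) powr (3/4)"
        by (simp add: norm_mult)
    qed
  qed
  moreover have "(\<lambda>N. ip (G N) (ehat j)) \<longlonglongrightarrow> A j / of_real (weight (Suc j))"
    by (rule tendsto_eventually, rule eventually_sequentiallyI[of "Suc j"]) (use ipG in simp)
  ultimately have "ip (ghat l) (ehat j) = A j / of_real (weight (Suc j))"
    by (rule LIMSEQ_unique)
  then show ?thesis by (simp add: A_def coord_frac_seq)
qed

section \<open>The approximation of the constant sequence\<close>

text \<open>The witness x ties each function to an actual finite combination of the
  \<open>frac_seq l\<close>.\<close>

definition frac_transforms :: "(real \<Rightarrow> complex) set" where
  "frac_transforms = {f. \<exists>x\<in>hseq.span (frac_seq ` {1..}). represents f x}"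

lemma frac_transforms_tempered: "frac_transforms \<subseteq> tempered"
  by (auto simp: frac_transforms_def represents_def)

lemma frac_transforms_0: "(\<lambda>t. 0) \<in> frac_transforms"
  unfolding frac_transforms_def using represents_0 hseq.span_zero by blast

lemma frac_transforms_add_cmult:
  assumes "f \<in> frac_transforms" "g \<in> frac_transforms"
  shows "(\<lambda>t. f t + c * g t) \<in> frac_transforms"
proof -
  obtain x y where "x \<in> hseq.span (frac_seq ` {1..})" "represents f x"
    "y \<in> hseq.span (frac_seq ` {1..})" "represents g y"
    using assms unfolding frac_transforms_def by blast
  then show ?thesis
    unfolding frac_transforms_def
    by (auto intro!: bexI[of _ "x + cscale c y"] represents_add_cmult hseq.span_add hseq.span_scale)
qed

definition zeta_quotient :: "complex \<Rightarrow> real \<Rightarrow> complex" where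
  "zeta_quotient w t = zeta (crit t) * (zeta_inv (crit t + w) - zeta_inv (1 + w))"

text \<open>At a zero on the line \<open>zeta_quotient\<close> vanishes identically and cannot tend
  to 1. Such zeros are countable, so convergence still holds almost everywhere.\<close>

lemma null_set_zeta_crit: "AE t in cauchy. zeta (crit t) \<noteq> 0"
proof -
  let ?S = "{s. Re s > 0}"
  have "countable {z \<in> ?S. zeta_reg z = 0}"
  proof (rule holomorphic_countable_zeros[OF holomorphic_zeta_reg open_halfspace_Re_gt])
    show "connected ?S" by (intro convex_connected convex_halfspace_Re_gt)
    have "?S = (\<Union>n. {s. Re s \<ge> inverse (real (Suc n))})"
    proof (intro equalityI subsetI)
      fix s assume "s \<in> ?S"
      then obtain n where "inverse (real (Suc n)) < Re s" using reals_Archimedean[of "Re s"] by auto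
      then show "s \<in> (\<Union>n. {s. Re s \<ge> inverse (real (Suc n))})" by (blast intro: less_imp_le)
    next
      fix s assume "s \<in> (\<Union>n. {s. Re s \<ge> inverse (real (Suc n))})"
      then obtain n where "inverse (real (Suc n)) \<le> Re s" by blast
      moreover have "0 < inverse (real (Suc n))" by simp
      ultimately show "s \<in> ?S" unfolding mem_Collect_eq by linarith
    qed
    then show "fsigma ?S" by (simp only: fsigma.intros[OF closed_halfspace_Re_ge])
    \<comment> \<open>A constant would be \<open>zeta_reg 1\<close> = 1, but
      \<open>zeta_reg 4\<close> = 3 zeta(4) has modulus at least 3/2.\<close>
    show "\<not> zeta_reg constant_on ?S"
    proof
      assume "zeta_reg constant_on ?S"
      then have "zeta_reg 4 = zeta_reg 1" unfolding constant_on_def by force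
      then have "cmod (3 * zeta 4) = 1" using zeta_reg_eq[of 4] by (simp add: zeta_reg_1)
      moreover have "1/2 \<le> cmod (zeta 4)"
        using norm_zeta_minus_1_le[of 4] norm_triangle_ineq2[of 1 "1 - zeta 4"]
        by (simp add: norm_minus_commute)
      ultimately show False by (simp add: norm_mult)
    qed
  qed
  moreover have "crit ` {t. zeta (crit t) = 0} \<subseteq> {z \<in> ?S. zeta_reg z = 0}"
    by (auto simp: zeta_reg_eq complex_eq_iff)
  moreover have "inj_on crit {t. zeta (crit t) = 0}" by (auto simp: inj_on_def)
  ultimately have "countable {t. zeta (crit t) = 0}"
    by (meson countable_image_inj_on countable_subset)
  then have "{t. zeta (crit t) = 0} \<in> null_sets lborel" by (rule countable_imp_null_set_lborel)
  then have "AE t in lborel. zeta (crit t) \<noteq> 0" by (auto dest: AE_not_in)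
  then show ?thesis
    unfolding cauchy_def by (subst AE_density) (auto elim: eventually_mono)
qed

section \<open>Approximation of 1 by the functions \<open>zeta_quotient\<close>\<close>

context riemann_hypothesis
begin

lemma represents_ghat:
  assumes "l > 0"
  shows "represents (ghat l) (frac_seq l)"
proof -
  obtain C where C: "C \<ge> 0" "\<And>t. cmod (zeta (crit t)) \<le> C * (1 + \<bar>t\<bar>) powr (3/8)"
    using zeta_critical_line_bound[of "3/8"] by auto
  have "ghat l \<in> tempered"
  proof (rule temperedI)
    show "ghat l \<in> borel_measurable borel"
      unfolding ghat_def
      by (intro borel_measurable_times borel_measurable_diff borel_measurable_powr_crit
            borel_measurable_continuous_onI[OF continuous_zeta_crit]) auto
    fix t
    have "cmod (1 / of_nat l - of_nat l powr (- crit t)) \<le> cmod (1 / of_nat l) + cmod (of_nat l powr (- crit t))"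
      by (rule norm_triangle_ineq4)
    also have "\<dots> \<le> 1 + 1"
      using assms by (intro add_mono norm_powr_crit_le) (simp add: norm_divide)
    finally have "cmod (ghat l t) \<le> (C * (1 + \<bar>t\<bar>) powr (3/8)) * 2"
      unfolding ghat_def norm_mult using C by (intro mult_mono) auto
    then show "cmod (ghat l t) \<le> (2 * C) * (1 + \<bar>t\<bar>) powr (3/8)" by simp
  qed
  then show ?thesis unfolding represents_def using ip_ghat[OF assms] by blast
qed

text \<open>For a monomial the factor n^(-w) comes out and leaves n^(-s) - n^(-1), the bracket of
  \<open>ghat n\<close> up to sign. Hence the value at 1 + w is the constant to subtract.\<close>

lemma dirichlet_poly_frac_transforms:
  assumes "dirichlet_poly P"
  shows "(\<lambda>t. zeta (crit t) * (P (crit t + w) - P (1 + w))) \<in> frac_transforms"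
  using assms
proof induction
  case (monomial n c)
  have g: "ghat n \<in> frac_transforms"
    using represents_ghat[OF monomial] monomial unfolding frac_transforms_def
    by (auto intro!: bexI[of _ "frac_seq n"] hseq.span_base)
  have "zeta (crit t) * (c * of_nat n powr (- (crit t + w)) - c * of_nat n powr (- (1 + w))) =
      0 + (- c * of_nat n powr (- w)) * ghat n t" for t
  proof -
    have 1: "of_nat n powr (- (crit t + w)) = of_nat n powr (- crit t) * of_nat n powr (- w)"
      by (simp only: minus_add_distrib powr_add)
    have 2: "(of_nat n :: complex) powr (- (1 + w)) = 1 / of_nat n * of_nat n powr (- w)"
      by (simp only: minus_add_distrib powr_add) (simp add: powr_minus inverse_eq_divide)
    show ?thesis unfolding 1 2 ghat_def by (simp add: algebra_simps)
  qed
  then show ?case by (simp only: frac_transforms_add_cmult[OF frac_transforms_0 g])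
next
  case (add P Q)
  from frac_transforms_add_cmult[OF add.IH, of 1] show ?case by (simp add: algebra_simps)
qed

lemma zeta_quotient_holomorphic: "(\<lambda>w. zeta_quotient w t) holomorphic_on {w. Re w > 0}"
proof -
  have "(\<lambda>w. zeta_inv (s + w)) holomorphic_on {w. Re w > 0}" if "Re s \<ge> 1/2" for s
    by (rule holomorphic_on_compose_gen[OF _ holomorphic_zeta_inv, unfolded o_def])
       (use that in \<open>auto intro!: holomorphic_intros\<close>)
  from this[of "crit t"] this[of 1] show ?thesis
    unfolding zeta_quotient_def by (intro holomorphic_intros) auto
qed

lemma continuous_zeta_quotient:
  assumes "Re w > 0"
  shows "continuous_on A (zeta_quotient w)"
proof -
  have "continuous_on A (\<lambda>t. zeta_inv (crit t + w))"
    by (rule continuous_on_compose2[OF holomorphic_on_imp_continuous_on[OF holomorphic_zeta_inv]])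
       (use assms in \<open>auto intro!: continuous_intros\<close>)
  then show ?thesis
    unfolding zeta_quotient_def by (intro continuous_intros continuous_zeta_crit)
qed

text \<open>On a compact Q the real parts stay above some \<delta> > 0, so \<open>zeta_inv\<close>
  is evaluated only at Re s >= 1/2 + \<delta>. The exponents 1/8 for zeta and 1/4 for
  \<open>zeta_inv\<close> add up to the 3/8 of \<open>tempered\<close>.\<close>

lemma zeta_quotient_bound:
  assumes Q: "compact Q" "Q \<subseteq> {w. Re w > 0}"
  shows "\<exists>C. \<forall>w\<in>Q. \<forall>t. cmod (zeta_quotient w t) \<le> C * (1 + \<bar>t\<bar>) powr (3/8)"
proof (cases "Q = {}")
  case False
  have "continuous_on Q Re" by (intro continuous_intros)
  then obtain w0 where w0: "w0 \<in> Q" "\<And>w. w \<in> Q \<Longrightarrow> Re w0 \<le> Re w"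
    using continuous_attains_inf[OF Q(1) False] by blast
  define \<delta> where "\<delta> = Re w0"
  have \<delta>: "\<delta> > 0" using w0 Q(2) by (auto simp: \<delta>_def)
  obtain B where B: "B \<ge> 0" "\<And>w. w \<in> Q \<Longrightarrow> cmod w \<le> B"
    using compact_imp_bounded[OF Q(1)] False unfolding bounded_iff by (meson norm_ge_zero order_trans w0(1))
  obtain C1 where C1: "C1 \<ge> 0" "\<And>t. cmod (zeta (crit t)) \<le> C1 * (1 + \<bar>t\<bar>) powr (1/8)"
    using zeta_critical_line_bound[of "1/8"] by auto
  obtain C2 where C2: "C2 \<ge> 0" "\<And>s. Re s \<ge> 1/2 + \<delta> \<Longrightarrow> cmod (zeta_inv s) \<le> C2 * (1 + \<bar>Im s\<bar>) powr (1/4)"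
    using zeta_inv_bound[OF \<delta>, of "1/4"] by auto
  define C3 where "C3 = C2 * (1 + B) powr (1/4)"
  have inv: "cmod (zeta_inv (s + w)) \<le> C3 * (1 + \<bar>t\<bar>) powr (1/4)"
    if w: "w \<in> Q" and s: "Re s \<ge> 1/2" "\<bar>Im s\<bar> \<le> \<bar>t\<bar>" for s w t
  proof -
    have "\<bar>Im (s + w)\<bar> \<le> \<bar>t\<bar> + B"
      using s B(2)[OF w] abs_Im_le_cmod[of w] by simp
    also have "1 + (\<bar>t\<bar> + B) \<le> (1 + B) * (1 + \<bar>t\<bar>)" using B(1) by (simp add: algebra_simps)
    finally have "1 + \<bar>Im (s + w)\<bar> \<le> (1 + B) * (1 + \<bar>t\<bar>)" by simp
    then have "(1 + \<bar>Im (s + w)\<bar>) powr (1/4) \<le> ((1 + B) * (1 + \<bar>t\<bar>)) powr (1/4)"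
      by (intro powr_mono2) auto
    also have "\<dots> = (1 + B) powr (1/4) * (1 + \<bar>t\<bar>) powr (1/4)" using B(1) by (simp add: powr_mult)
    finally have "C2 * (1 + \<bar>Im (s + w)\<bar>) powr (1/4) \<le> C2 * ((1 + B) powr (1/4) * (1 + \<bar>t\<bar>) powr (1/4))"
      by (rule mult_left_mono[OF _ C2(1)])
    moreover have "cmod (zeta_inv (s + w)) \<le> C2 * (1 + \<bar>Im (s + w)\<bar>) powr (1/4)"
      by (rule C2(2)) (use s w0(2)[OF w] in \<open>simp add: \<delta>_def\<close>)
    ultimately show ?thesis by (simp add: C3_def mult.assoc)
  qed
  have "cmod (zeta_quotient w t) \<le> (2 * C1 * C3) * (1 + \<bar>t\<bar>) powr (3/8)" if w: "w \<in> Q" for w t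
  proof -
    have "cmod (zeta_inv (crit t + w) - zeta_inv (1 + w)) \<le> 2 * C3 * (1 + \<bar>t\<bar>) powr (1/4)"
      using inv[OF w, of "crit t" t] inv[OF w, of 1 t] norm_triangle_ineq4[of "zeta_inv (crit t + w)" "zeta_inv (1 + w)"]
      by simp
    then have "cmod (zeta_quotient w t) \<le> (C1 * (1 + \<bar>t\<bar>) powr (1/8)) * (2 * C3 * (1 + \<bar>t\<bar>) powr (1/4))"
      unfolding zeta_quotient_def norm_mult using C1 by (intro mult_mono) auto
    also have "\<dots> = (2 * C1 * C3) * ((1 + \<bar>t\<bar>) powr (1/8) * (1 + \<bar>t\<bar>) powr (1/4))" by simp
    also have "(1 + \<bar>t\<bar>) powr (1/8) * (1 + \<bar>t\<bar>) powr (1/4) = (1 + \<bar>t\<bar>) powr (3/8)"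
      by (simp only: powr_add[symmetric]) simp
    finally show ?thesis .
  qed
  then show ?thesis by blast
qed simp

text \<open>Re w > 5/2 puts crit t + w and 1 + w into Re s >= 3, where Dirichlet polynomials
  approximate 1/zeta uniformly; the factor zeta(crit t) only costs a square integrable
  weight.\<close>

lemma zeta_quotient_far:
  assumes w: "Re w > 5/2" and e: "e > 0"
  shows "\<exists>m\<in>frac_transforms. nsq (\<lambda>t. zeta_quotient w t - m t) < e"
proof -
  obtain C where C: "C \<ge> 0" "\<And>t. cmod (zeta (crit t)) \<le> C * (1 + \<bar>t\<bar>) powr (3/8)"
    using zeta_critical_line_bound[of "3/8"] by auto
  define J where "J = (LINT t|cauchy. (1 + \<bar>t\<bar>) powr (3/4))"
  have J: "J \<ge> 0" unfolding J_def by (rule integral_nonneg_AE) simp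
  \<comment> \<open>The final estimate is (2 \<epsilon> C)^2 J = \<epsilon>^2 (M - 1); the extra 1
    makes M positive and the inequality strict.\<close>
  define M where "M = 4 * C\<^sup>2 * J + 1"
  have M: "M > 0" using J by (simp add: M_def add_nonneg_pos)
  define \<epsilon> where "\<epsilon> = sqrt (e / M)"
  have \<epsilon>: "\<epsilon> > 0" "\<epsilon>\<^sup>2 = e / M" using e M by (auto simp: \<epsilon>_def)
  obtain P where P: "dirichlet_poly P" "\<And>s. Re s \<ge> 3 \<Longrightarrow> cmod (1 / zeta s - P s) \<le> \<epsilon>"
    using inverse_zeta_approx_dirichlet_poly[OF \<epsilon>(1)] by blast
  define m where "m = (\<lambda>t. zeta (crit t) * (P (crit t + w) - P (1 + w)))"
  have inv: "cmod (zeta_inv s - P s) \<le> \<epsilon>" if "Re s \<ge> 3" for s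
  proof -
    have "s \<noteq> 1" using that by auto
    then show ?thesis using P(2)[OF that] zeta_inv_eq[of s] that by simp
  qed
  have "cmod (zeta_quotient w t - m t) \<le> (2 * \<epsilon> * C) * (1 + \<bar>t\<bar>) powr (3/8)" for t
  proof -
    have "zeta_quotient w t - m t =
        zeta (crit t) * ((zeta_inv (crit t + w) - P (crit t + w)) - (zeta_inv (1 + w) - P (1 + w)))"
      by (simp add: zeta_quotient_def m_def algebra_simps)
    moreover have "cmod ((zeta_inv (crit t + w) - P (crit t + w)) - (zeta_inv (1 + w) - P (1 + w))) \<le> \<epsilon> + \<epsilon>"
      by (rule order_trans[OF norm_triangle_ineq4 add_mono[OF inv inv]]) (use w in auto)
    ultimately have "cmod (zeta_quotient w t - m t) \<le> (C * (1 + \<bar>t\<bar>) powr (3/8)) * (\<epsilon> + \<epsilon>)"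
      unfolding norm_mult using C by (simp only: norm_mult, intro mult_mono) auto
    then show ?thesis by (simp add: mult_ac)
  qed
  then have "nsq (\<lambda>t. zeta_quotient w t - m t) \<le> (2 * \<epsilon> * C)\<^sup>2 * J"
    unfolding J_def by (rule nsq_bound)
  also have "\<dots> = \<epsilon>\<^sup>2 * (M - 1)" by (simp add: M_def power_mult_distrib)
  also have "\<dots> < \<epsilon>\<^sup>2 * M" using \<epsilon>(1) by (intro mult_strict_left_mono) auto
  also have "\<dots> = e" using \<epsilon>(2) M by simp
  finally show ?thesis
    using dirichlet_poly_frac_transforms[OF P(1), of w] unfolding m_def[symmetric] by blast
qed

text \<open>Dominated convergence along w = d n. The term with zeta_inv(crit t + w) is dominated
  uniformly by \<open>zeta_shift_bound\<close>; the other tends to 0 because zeta_inv vanishes at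
  1.\<close>

lemma zeta_quotient_tends_1:
  assumes "e > 0"
  shows "\<exists>\<delta>>0. nsq (\<lambda>t. 1 - zeta_quotient (of_real \<delta>) t) < e"
proof -
  obtain C1 \<delta>0 where C1: "C1 \<ge> 0" "0 < \<delta>0" "\<delta>0 \<le> 1/32"
    "\<And>t \<delta>. \<lbrakk>0 < \<delta>; \<delta> \<le> \<delta>0\<rbrakk> \<Longrightarrow>
       cmod (zeta (crit t) * zeta_inv (Complex (1/2 + \<delta>) t)) \<le> C1 * (1 + \<bar>t\<bar>) powr (3/8)"
    using zeta_shift_bound[of "3/8"] by auto
  obtain C2 where C2: "C2 \<ge> 0" "\<And>t. cmod (zeta (crit t)) \<le> C2 * (1 + \<bar>t\<bar>) powr (3/8)"
    using zeta_critical_line_bound[of "3/8"] by auto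
  \<comment> \<open>This is evaluated only at the real points 1 + d n, where the growth factor is 1,
    so any positive exponent would do.\<close>
  obtain C3 where C3: "C3 \<ge> 0" "\<And>s. Re s \<ge> 1/2 + 1/2 \<Longrightarrow> cmod (zeta_inv s) \<le> C3 * (1 + \<bar>Im s\<bar>) powr 1"
    using zeta_inv_bound[of "1/2" 1] by auto
  define d where "d = (\<lambda>n. \<delta>0 * inverse (real (Suc n)))"
  have d: "0 < d n" "d n \<le> \<delta>0" for n
    using C1(2) by (auto simp: d_def field_simps)
  have dlim: "d \<longlonglongrightarrow> 0"
    using tendsto_mult_left[OF LIMSEQ_inverse_real_of_nat, of \<delta>0] by (simp add: d_def)
  let ?K = "\<lambda>n t. zeta_quotient (of_real (d n)) t"
  define C where "C = 1 + C1 + C2 * C3"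
  have Kb: "cmod (1 - ?K n t) \<le> C * (1 + \<bar>t\<bar>) powr (3/8)" for n t
  proof -
    have p1: "1 \<le> (1 + \<bar>t\<bar>) powr (3/8)" by (intro ge_one_powr_ge_zero) auto
    have "crit t + of_real (d n) = Complex (1/2 + d n) t" by (simp add: complex_eq_iff)
    then have 1: "cmod (zeta (crit t) * zeta_inv (crit t + of_real (d n))) \<le> C1 * (1 + \<bar>t\<bar>) powr (3/8)"
      using C1(4)[OF d(1)[of n] d(2)[of n], of t] by simp
    have "cmod (zeta_inv (1 + of_real (d n))) \<le> C3" using C3(2)[of "1 + of_real (d n)"] d(1)[of n] by simp
    then have 2: "cmod (zeta (crit t) * zeta_inv (1 + of_real (d n))) \<le> (C2 * (1 + \<bar>t\<bar>) powr (3/8)) * C3"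
      unfolding norm_mult using C2 by (intro mult_mono) auto
    have "1 - ?K n t = 1 - zeta (crit t) * zeta_inv (crit t + of_real (d n)) + zeta (crit t) * zeta_inv (1 + of_real (d n))"
      by (simp add: zeta_quotient_def algebra_simps)
    moreover have "cmod \<dots> \<le> 1 + cmod (zeta (crit t) * zeta_inv (crit t + of_real (d n))) + cmod (zeta (crit t) * zeta_inv (1 + of_real (d n)))"
      using norm_triangle_ineq[of "1 - zeta (crit t) * zeta_inv (crit t + of_real (d n))" "zeta (crit t) * zeta_inv (1 + of_real (d n))"]
        norm_triangle_ineq4[of 1 "zeta (crit t) * zeta_inv (crit t + of_real (d n))"]
      unfolding norm_one by linarith
    moreover have "\<dots> \<le> (1 + \<bar>t\<bar>) powr (3/8) + C1 * (1 + \<bar>t\<bar>) powr (3/8) + (C2 * (1 + \<bar>t\<bar>) powr (3/8)) * C3"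
      using 1 2 p1 by linarith
    ultimately have "cmod (1 - ?K n t) \<le> (1 + \<bar>t\<bar>) powr (3/8) + C1 * (1 + \<bar>t\<bar>) powr (3/8) + (C2 * (1 + \<bar>t\<bar>) powr (3/8)) * C3"
      by (simp only: order_trans)
    then show ?thesis by (simp add: C_def algebra_simps)
  qed
  have "(\<lambda>n. nsq (\<lambda>t. 1 - ?K n t)) \<longlonglongrightarrow> (LINT t|cauchy. 0)"
    unfolding nsq_def
  proof (rule integral_dominated_convergence[where w = "\<lambda>t. C\<^sup>2 * (1 + \<bar>t\<bar>) powr (3/4)"])
    show "integrable cauchy (\<lambda>t. C\<^sup>2 * (1 + \<bar>t\<bar>) powr (3/4))"
      by (intro integrable_mult_right integrable_cauchy_powr) simp
    have "(\<lambda>t. (cmod (1 - ?K n t))\<^sup>2) \<in> borel_measurable borel" for n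
      by (intro borel_measurable_continuous_onI continuous_intros continuous_zeta_quotient) (use d(1)[of n] in simp)
    then show "(\<lambda>t. (cmod (1 - ?K n t))\<^sup>2) \<in> borel_measurable cauchy" for n
      using measurable_cong_sets[OF sets_cauchy refl] by blast
    show "AE t in cauchy. norm ((cmod (1 - ?K n t))\<^sup>2) \<le> C\<^sup>2 * (1 + \<bar>t\<bar>) powr (3/4)" for n
    proof (rule AE_I2)
      fix t
      have "(cmod (1 - ?K n t))\<^sup>2 \<le> (C * (1 + \<bar>t\<bar>) powr (3/8))\<^sup>2"
        by (intro power_mono Kb) auto
      also have "\<dots> = C\<^sup>2 * ((1 + \<bar>t\<bar>) powr (3/8) * (1 + \<bar>t\<bar>) powr (3/8))"
        by (simp add: power_mult_distrib power2_eq_square)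
      also have "\<dots> = C\<^sup>2 * (1 + \<bar>t\<bar>) powr (3/4)" by (simp only: powr_add[symmetric]) simp
      finally show "norm ((cmod (1 - ?K n t))\<^sup>2) \<le> C\<^sup>2 * (1 + \<bar>t\<bar>) powr (3/4)" by simp
    qed
    show "AE t in cauchy. (\<lambda>n. (cmod (1 - ?K n t))\<^sup>2) \<longlonglongrightarrow> 0"
      using null_set_zeta_crit
    proof eventually_elim
      case (elim t)
      have c1: "crit t \<noteq> 1" by (auto simp: complex_eq_iff)
      have rnz: "zeta_reg (crit t) \<noteq> 0" using elim c1 zeta_reg_eq[of "crit t"] by simp
      have cont: "isCont zeta_reg s" if "Re s > 0" for s
        using holomorphic_on_imp_continuous_on[OF holomorphic_zeta_reg] that
        by (simp add: continuous_on_eq_continuous_at open_halfspace_Re_gt)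
      have lim: "(\<lambda>n. zeta_inv (s + of_real (d n))) \<longlonglongrightarrow> zeta_inv s" if s: "Re s > 0" "zeta_reg s \<noteq> 0" for s
      proof -
        have sl: "(\<lambda>n. s + of_real (d n)) \<longlonglongrightarrow> s + of_real 0" by (intro tendsto_intros dlim)
        then have sl': "(\<lambda>n. s + of_real (d n)) \<longlonglongrightarrow> s" by simp
        have "(\<lambda>n. zeta_reg (s + of_real (d n))) \<longlonglongrightarrow> zeta_reg s"
          by (rule isCont_tendsto_compose[OF cont[OF s(1)] sl'])
        then show ?thesis unfolding zeta_inv_def by (intro tendsto_intros sl' s(2))
      qed
      have "(\<lambda>n. (cmod (1 - ?K n t))\<^sup>2) \<longlonglongrightarrow> (cmod (1 - zeta (crit t) * (zeta_inv (crit t) - zeta_inv 1)))\<^sup>2"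
        unfolding zeta_quotient_def
        by (intro tendsto_intros lim) (use rnz zeta_reg_1 in auto)
      moreover have "zeta (crit t) * (zeta_inv (crit t) - zeta_inv 1) = 1"
        using elim c1 by (simp add: zeta_inv_eq)
      ultimately show ?case by simp
    qed
  qed simp
  then have "\<forall>\<^sub>F n in sequentially. nsq (\<lambda>t. 1 - ?K n t) < e"
    using order_tendstoD(2)[of _ "0" sequentially e] assms by simp
  then obtain n where "nsq (\<lambda>t. 1 - ?K n t) < e" by (auto simp: eventually_sequentially)
  then show ?thesis using d(1)[of n] by blast
qed

lemma one_seq_in_closure: "one_seq \<in> closure (hseq.span (frac_seq ` {1..}))"
proof (rule closure_approachable[THEN iffD2], intro allI impI)
  fix e :: real assume e: "e > 0"
  \<comment> \<open>Both errors enter with the factor 2 of \<open>nsq_diff_le\<close>, so e^2/4 each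
    gives e^2 in total.\<close>
  then have e4: "e\<^sup>2 / 4 > 0" by simp
  obtain \<delta> where \<delta>: "\<delta> > 0" "nsq (\<lambda>t. 1 - zeta_quotient (of_real \<delta>) t) < e\<^sup>2 / 4"
    using zeta_quotient_tends_1[OF e4] by blast
  have meas: "zeta_quotient w \<in> borel_measurable borel" if "Re w > 0" for w
    by (intro borel_measurable_continuous_onI continuous_zeta_quotient that)
  have "\<exists>m\<in>frac_transforms. nsq (\<lambda>t. zeta_quotient (of_real \<delta>) t - m t) < e\<^sup>2 / 4"
    by (rule holomorphic_family_in_closure[where c = "5/2", OF frac_transforms_tempered frac_transforms_0 frac_transforms_add_cmult
          meas zeta_quotient_holomorphic zeta_quotient_bound _ zeta_quotient_far _ e4])
       (use \<delta>(1) in auto)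
  then obtain m where m: "m \<in> frac_transforms" "nsq (\<lambda>t. zeta_quotient (of_real \<delta>) t - m t) < e\<^sup>2 / 4" by blast
  obtain x where x: "x \<in> hseq.span (frac_seq ` {1..})" "represents m x"
    using m(1) unfolding frac_transforms_def by blast
  obtain C where "\<And>t. cmod (zeta_quotient (of_real \<delta>) t) \<le> C * (1 + \<bar>t\<bar>) powr (3/8)"
    using zeta_quotient_bound[of "{of_real \<delta>}"] \<delta>(1) by auto
  then have tK: "zeta_quotient (of_real \<delta>) \<in> tempered"
    by (intro temperedI[OF meas]) (use \<delta>(1) in simp)
  have t1: "(\<lambda>t. 1) \<in> tempered" and tm: "m \<in> tempered"
    using represents_one_seq x(2) by (auto simp: represents_def)
  have "nsq (\<lambda>t. (1 - zeta_quotient (of_real \<delta>) t) - (m t - zeta_quotient (of_real \<delta>) t)) \<le>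
      2 * nsq (\<lambda>t. 1 - zeta_quotient (of_real \<delta>) t) + 2 * nsq (\<lambda>t. m t - zeta_quotient (of_real \<delta>) t)"
    by (rule nsq_diff_le) (intro tempered_diff t1 tm tK)+
  moreover have "nsq (\<lambda>t. m t - zeta_quotient (of_real \<delta>) t) = nsq (\<lambda>t. zeta_quotient (of_real \<delta>) t - m t)"
    unfolding nsq_def by (simp add: norm_minus_commute)
  ultimately have n: "nsq (\<lambda>t. 1 + (-1) * m t) < e\<^sup>2" using \<delta>(2) m(2) by simp
  have "(norm (one_seq - x))\<^sup>2 \<le> nsq (\<lambda>t. 1 + (-1) * m t)"
  proof -
    have "one_seq + cscale (-1) x = one_seq - x" by (rule hseq_eqI) simp
    then show ?thesis using norm_le_of_represents[OF represents_add_cmult[OF represents_one_seq x(2), of "-1"]] by simp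
  qed
  with n have "(norm (one_seq - x))\<^sup>2 < e\<^sup>2" by linarith
  then have "dist x one_seq < e"
    using e by (simp add: dist_norm norm_minus_commute power2_less_imp_less)
  then show "\<exists>y\<in>hseq.span (frac_seq ` {1..}). dist y one_seq < e" using x(1) by blast
qed

end

theorem theorem1:
  shows "((\<forall>s::complex. Re s > 1 / 2 \<and> s \<noteq> 1 \<longrightarrow> zeta s \<noteq> 0)
            \<longleftrightarrow> one_seq \<in> closure (hseq.span (frac_seq ` {1..})))
       \<and> (one_seq \<in> closure (hseq.span (frac_seq ` {1..}))
            \<longleftrightarrow> closure (hseq.span (frac_seq ` {1..})) = UNIV)"
proof (intro conjI iffI)
  assume "\<forall>s::complex. Re s > 1 / 2 \<and> s \<noteq> 1 \<longrightarrow> zeta s \<noteq> 0"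
  then interpret riemann_hypothesis by unfold_locales blast
  show "one_seq \<in> closure (hseq.span (frac_seq ` {1..}))" by (rule one_seq_in_closure)
next
  assume "one_seq \<in> closure (hseq.span (frac_seq ` {1..}))"
  then show "\<forall>s::complex. Re s > 1 / 2 \<and> s \<noteq> 1 \<longrightarrow> zeta s \<noteq> 0"
    using zeta_nonzero_of_one_seq by blast
qed (use total_of_one_seq in auto)

end
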